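(* Let $n,d\in\mathbb{N}$, $[a,b]\subseteq\mathbb{R}$, and $B,C\in\mathbb{R}^{nd\times nd}$, and suppose that the associated domain $D\subseteq W_{2}^{d,n}[a,b]$ (defined in the context) is PIE-compatible. For matrix-valued polynomials $\boldsymbol{A}_{k}\in\mathbb{R}^{n\times n}[s]$, $k\in\{0,\dots,d\}$, define $A:D\to L_{2}^{n}[a,b]$ by $$(A\mathbf{u})(s):=\sum_{k=0}^{d}\boldsymbol{A}_{k}(s)\,\partial_{s}^{k}\mathbf{u}(s),\qquad \mathbf{u}\in D.$$ Let $\mathcal{T}:=(\partial_s^d)^{-1}:L_{2}^{n}[a,b]\to D$ be the integral operator defined in the context, and let $\mathcal{A}:=A\circ\mathcal{T}\in \mathcal{L}(L_{2}^{n}[a,b])$. For any $\epsilon_{1},\epsilon_{2}>0$ and $\omega\in\mathbb{R}$, if there exist a PI operator $\mathcal{P}$ on $L_2^n[a,b]$ and a scalar $\lambda>\omega$ satisfying $$\mathcal{P}\succeq\epsilon_{1}^2 I_{n},\qquad \mathcal{T}^*\mathcal{P}\mathcal{A}+\mathcal{A}^*\mathcal{P}\mathcal{T}\preceq 2\omega\,\mathcal{T}^*\mathcal{P}\mathcal{T},\qquad (\lambda\mathcal{T}-\mathcal{A})(\lambda\mathcal{T}^*-\mathcal{A}^* )\succeq\epsilon_{2}^2 I_{n},$$ then $A$ is the infinitesimal generator of a $C_{0}$-semigroup on $L_{2}^{n}[a,b]$ with growth rate $\omega$ and gain $M:=\frac{\sqrt{\|\mathcal{P}\|_{\mathcal{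L}(L_{2})}}}{\epsilon_{1}}$.
   Context: $L_2^n[a,b]$ is the real Hilbert space of $\mathbb{R}^n$-valued square-integrable functions on $[a,b]$ with standard inner product $\langle\cdot,\cdot\rangle_{L_2}$; $\mathcal{L}(L_2^n)$ is the space of bounded linear operators on it, with operator norm $\|\cdot\|_{\mathcal{L}(L_2)}$; adjoints are with respect to $\langle\cdot,\cdot\rangle_{L_2}$. $\mathbb{R}^{n\times m}[s]$ is the space of $n\times m$ matrix-valued polynomials in $s$. $W_2^{d,n}[a,b]:=\{\mathbf{u}\in L_2^n[a,b]\mid \partial_s^k\mathbf{u}\in L_2^n[a,b],\ \forall k\in\{1,\dots,d\}\}$. Domain and PIE-compatibility: Write $B=[B_{i,j}]$ and $C=[C_{i,j}]$ in blocks $B_{i,j},C_{i,j}\in\mathbb{R}^{n\times n}$, $i,j\in\{0,\dots,d-1\}$. The associated domain is $$D:=\Bigl\{\mathbf{u}\in W_2^{d,n}[a,b]\ \Bigl|\ \sum_{j=0}^{d-1}B_{i,j}\,\partial_s^j\mathbf{u}(a)+C_{i,j}\,\partial_s^j\mathbf{u}(b)=0\ \text{ for all } i\in\{0,\dots,d-1\}\Bigr\}.$$ Let $\boldsymbol{Q}(z)\in\mathbb{R}^{nd\times nd}$ be the block upper-triangular matrix whose $(i,j)$ block, $i,j\in\{0,\dots,d-1\}$, is $\frac{z^{j-i}}{(j-i)!}I_n$ if $j\ge i$ and $0_n$ if $j<i$. $D$ is called PIE-compatible if $K:=B+C\boldsymbol{Q}(b-a)$ is invertible. The operator $\mathcal{T}$: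 if $D$ is PIE-compatible then $\partial_s^d:D\to L_2^n[a,b]$ is invertible, and $\mathcal{T}:=(\partial_s^d)^{-1}$ is given by $(\mathcal{T}\mathbf{v})(s)=\int_a^b\boldsymbol{G}(s,\theta)\mathbf{v}(\theta)\,d\theta$, where $\boldsymbol{G}(s,\theta)=E_1^T\hat{\boldsymbol{G}}(s,\theta)E_d$ with $$\hat{\boldsymbol{G}}(s,\theta):=\begin{cases}\boldsymbol{Q}(s-\theta)-\boldsymbol{Q}(s-a)K^{-1}C\boldsymbol{Q}(b-\theta), & \theta\le s,\\ -\boldsymbol{Q}(s-a)K^{-1}C\boldsymbol{Q}(b-\theta), & \theta>s,\end{cases}$$ and $E_1:=[I_n\ 0_n\ \cdots\ 0_n]^T$, $E_d:=[0_n\ \cdots\ 0_n\ I_n]^T\in\mathbb{R}^{nd\times n}$. $\mathcal{T}$ is bounded as an operator on $L_2^n[a,b]$, and $\mathcal{T}^*$ is the adjoint of this operator on $L_2^n[a,b]$. PI operator: a Partial Integral (PI) operator on $L_2^n[a,b]$ is an operator of the form $$(\mathcal{P}\mathbf{v})(s)=\boldsymbol{P}(s)\mathbf{v}(s)+\int_a^s\boldsymbol{L}(s,\theta)\mathbf{v}(\theta)\,d\theta+\int_s^b\boldsymbol{U}(s,\theta)\mathbf{v}(\theta)\,d\theta,$$ with $\boldsymbol{P},\boldsymbol{L},\boldsymbol{U}$ $n\times n$ matrix-valued polynomials. Operator inequalities: for $\mathcal{R}\in\mathcal{L}(L_2^n)$ self-adjoint, $\mathcal{R}\succeq0$ means $\langle\mathbf{v},\mathcal{R}\mathbf{v}\rangle_{L_2}\ge0$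 for all $\mathbf{v}\in L_2^n$; $\mathcal{R}\succeq\mathcal{S}$ (equivalently $\mathcal{S}\preceq\mathcal{R}$) means $\mathcal{R}-\mathcal{S}\succeq0$. In particular $\mathcal{P}\succeq\epsilon_1^2I_n$ includes self-adjointness of $\mathcal{P}$. $I_n$ denotes here the identity operator on $L_2^n[a,b]$. A $C_0$-semigroup on a Hilbert space $H$ is a family $(S(t))_{t\ge 0}$ in $\mathcal{L}(H)$ with $S(0)=I$, $S(t+s)=S(t)S(s)$ for all $t,s\ge 0$, and $\lim_{t\to0^+}S(t)\mathbf{x}=\mathbf{x}$ for all $\mathbf{x}\in H$. Its infinitesimal generator is the operator $\mathbf{x}\mapsto \lim_{t\to 0^+}\frac{1}{t}[S(t)-I]\mathbf{x}$, whose domain is exactly the set of all $\mathbf{x}\in H$ for which this limit exists in $H$; saying that $A:D\to H$ is the infinitesimal generator includes the statement that this domain equals $D$. A $C_0$-semigroup $(S(t))_{t\ge0}$ on $H$ has growth rate $\omega\in\mathbb{R}$ and gain $M\ge1$ if $\|S(t)\|_{\mathcal{L}(H)}\le Me^{\omega t}$ for all $t\ge0$. *)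

theory Defs
  imports "HOL-Analysis.Analysis" "HOL-Computational_Algebra.Polynomial"
begin

text \<open>
  The interval is a term, so \<open>L\<^sub>2\<^sup>n[a,b]\<close> cannot be a type. Its elements are represented by
  square-integrable functions \<open>real \<Rightarrow> real ^ 'n\<close>, of which only the restriction to \<open>{a..b}\<close>
  matters, and equality in \<open>L\<^sub>2\<^sup>n[a,b]\<close> is \<open>L2_eq a b\<close>. All notions below are invariant under
  change of representative.
\<close>

definition L2 :: "real \<Rightarrow> real \<Rightarrow> (real \<Rightarrow> real ^ 'n::finite) set" where
  "L2 a b = {u. u \<in> borel_measurable (lebesgue_on {a..b}) \<and>
                integrable (lebesgue_on {a..b}) (\<lambda>s. (norm (u s))\<^sup>2)}"

definition L2_eq :: "real \<Rightarrow> real \<Rightarrow> (real \<Rightarrow> real ^ 'n::finite) \<Rightarrow> (real \<Rightarrow> real ^ 'n) \<Rightarrow> bool" where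
  "L2_eq a b u v \<longleftrightarrow> (AE s in lebesgue_on {a..b}. u s = v s)"

definition L2_inner :: "real \<Rightarrow> real \<Rightarrow> (real \<Rightarrow> real ^ 'n::finite) \<Rightarrow> (real \<Rightarrow> real ^ 'n) \<Rightarrow> real" where
  "L2_inner a b u v = (LINT s|lebesgue_on {a..b}. u s \<bullet> v s)"

definition L2_norm :: "real \<Rightarrow> real \<Rightarrow> (real \<Rightarrow> real ^ 'n::finite) \<Rightarrow> real" where
  "L2_norm a b u = sqrt (L2_inner a b u u)"

definition L2_tendsto ::
  "real \<Rightarrow> real \<Rightarrow> (real \<Rightarrow> real \<Rightarrow> real ^ 'n::finite) \<Rightarrow> (real \<Rightarrow> real ^ 'n) \<Rightarrow> real filter \<Rightarrow> bool" where
  "L2_tendsto a b f g F \<longleftrightarrow> ((\<lambda>t. L2_norm a b (\<lambda>s. f t s - g s)) \<longlongrightarrow> 0) F"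

type_synonym 'n l2op = "(real \<Rightarrow> real ^ 'n) \<Rightarrow> (real \<Rightarrow> real ^ 'n)"

text \<open>Compatibility with \<open>L2_eq\<close> follows from linearity and boundedness.\<close>

definition L2_bounded_op :: "real \<Rightarrow> real \<Rightarrow> 'n::finite l2op \<Rightarrow> bool" where
  "L2_bounded_op a b R \<longleftrightarrow>
     (\<forall>v\<in>L2 a b. R v \<in> L2 a b) \<and>
     (\<forall>u\<in>L2 a b. \<forall>v\<in>L2 a b. L2_eq a b (R (\<lambda>s. u s + v s)) (\<lambda>s. R u s + R v s)) \<and>
     (\<forall>c. \<forall>v\<in>L2 a b. L2_eq a b (R (\<lambda>s. c *\<^sub>R v s)) (\<lambda>s. c *\<^sub>R R v s)) \<and>
     (\<exists>k. \<forall>v\<in>L2 a b. L2_norm a b (R v) \<le> k * L2_norm a b v)"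

definition L2_onorm :: "real \<Rightarrow> real \<Rightarrow> 'n::finite l2op \<Rightarrow> real" where
  "L2_onorm a b R = (SUP v\<in>L2 a b. L2_norm a b (R v) / L2_norm a b v)"

text \<open>As for \<^const>\<open>adjoint\<close>, by choice; for bounded \<open>R\<close> the adjoint exists and is unique
  up to \<open>L2_eq\<close>.\<close>

definition L2_adjoint :: "real \<Rightarrow> real \<Rightarrow> 'n::finite l2op \<Rightarrow> 'n l2op" where
  "L2_adjoint a b R = (SOME R'. L2_bounded_op a b R' \<and>
     (\<forall>u\<in>L2 a b. \<forall>v\<in>L2 a b. L2_inner a b (R u) v = L2_inner a b u (R' v)))"

definition L2_selfadjoint :: "real \<Rightarrow> real \<Rightarrow> 'n::finite l2op \<Rightarrow> bool" where
  "L2_selfadjoint a b R \<longleftrightarrow> L2_bounded_op a b R \<and>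
     (\<forall>u\<in>L2 a b. \<forall>v\<in>L2 a b. L2_inner a b (R u) v = L2_inner a b u (R v))"

definition L2_op_nonneg :: "real \<Rightarrow> real \<Rightarrow> 'n::finite l2op \<Rightarrow> bool" where
  "L2_op_nonneg a b R \<longleftrightarrow> L2_selfadjoint a b R \<and> (\<forall>v\<in>L2 a b. 0 \<le> L2_inner a b v (R v))"

definition op_add :: "'n::finite l2op \<Rightarrow> 'n l2op \<Rightarrow> 'n l2op" where
  "op_add R S = (\<lambda>v s. R v s + S v s)"

definition op_diff :: "'n::finite l2op \<Rightarrow> 'n l2op \<Rightarrow> 'n l2op" where
  "op_diff R S = (\<lambda>v s. R v s - S v s)"

definition op_scale :: "real \<Rightarrow> 'n::finite l2op \<Rightarrow> 'n l2op" where
  "op_scale c R = (\<lambda>v s. c *\<^sub>R R v s)"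

definition L2_op_le :: "real \<Rightarrow> real \<Rightarrow> 'n::finite l2op \<Rightarrow> 'n l2op \<Rightarrow> bool" where
  "L2_op_le a b S R \<longleftrightarrow> L2_op_nonneg a b (op_diff R S)"

definition test_fun :: "real \<Rightarrow> real \<Rightarrow> (real \<Rightarrow> real) \<Rightarrow> bool" where
  "test_fun a b \<phi> \<longleftrightarrow>
     (\<forall>k x. (deriv ^^ k) \<phi> field_differentiable at x) \<and>
     (\<exists>c e. a < c \<and> e < b \<and> (\<forall>x. x \<notin> {c..e} \<longrightarrow> \<phi> x = 0))"

definition has_weak_deriv ::
  "real \<Rightarrow> real \<Rightarrow> nat \<Rightarrow> (real \<Rightarrow> real ^ 'n::finite) \<Rightarrow> (real \<Rightarrow> real ^ 'n) \<Rightarrow> bool" where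
  "has_weak_deriv a b k u v \<longleftrightarrow>
     (\<forall>\<phi>. test_fun a b \<phi> \<longrightarrow>
        (LINT s|lebesgue_on {a..b}. (deriv ^^ k) \<phi> s *\<^sub>R u s) =
        (-1) ^ k *\<^sub>R (LINT s|lebesgue_on {a..b}. \<phi> s *\<^sub>R v s))"

definition sobolev :: "nat \<Rightarrow> real \<Rightarrow> real \<Rightarrow> (real \<Rightarrow> real ^ 'n::finite) set" where
  "sobolev d a b = {u \<in> L2 a b. \<forall>k\<in>{1..d}. \<exists>v\<in>L2 a b. has_weak_deriv a b k u v}"

text \<open>A representative of \<open>\<partial>\<^sub>s\<^sup>k u\<close>, determined up to \<open>L2_eq\<close> when \<open>u\<close> is in \<open>sobolev k a b\<close>.\<close>

definition wderiv ::
  "real \<Rightarrow> real \<Rightarrow> nat \<Rightarrow> (real \<Rightarrow> real ^ 'n::finite) \<Rightarrow> (real \<Rightarrow> real ^ 'n)" where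
  "wderiv a b k u = (SOME v. v \<in> L2 a b \<and> has_weak_deriv a b k u v)"

text \<open>Point values of an \<open>L\<^sub>2\<close> class are those of its continuous representative, which is
  unique on \<open>{a..b}\<close> if \<open>a < b\<close>, and exists for \<open>\<partial>\<^sub>s\<^sup>j u\<close> if \<open>u\<close> is in \<open>sobolev d a b\<close> and \<open>j < d\<close>.\<close>

definition cont_rep ::
  "real \<Rightarrow> real \<Rightarrow> (real \<Rightarrow> real ^ 'n::finite) \<Rightarrow> (real \<Rightarrow> real ^ 'n)" where
  "cont_rep a b u = (SOME g. continuous_on {a..b} g \<and> L2_eq a b g u)"

text \<open>A matrix in \<open>\<real>\<^bsup>nd\<times>nd\<^esup>\<close> is given by its blocks \<open>X i j\<close>, of which only those with
  \<open>i < d\<close> and \<open>j < d\<close> matter.\<close>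

type_synonym 'n blockmat = "nat \<Rightarrow> nat \<Rightarrow> real ^ 'n ^ 'n"

definition block_mult :: "nat \<Rightarrow> 'n::finite blockmat \<Rightarrow> 'n blockmat \<Rightarrow> 'n blockmat" where
  "block_mult d X Y = (\<lambda>i j. \<Sum>k<d. X i k ** Y k j)"

definition block_is_inverse :: "nat \<Rightarrow> 'n::finite blockmat \<Rightarrow> 'n blockmat \<Rightarrow> bool" where
  "block_is_inverse d X Y \<longleftrightarrow>
     (\<forall>i<d. \<forall>j<d. block_mult d X Y i j = (if i = j then mat 1 else 0) \<and>
                    block_mult d Y X i j = (if i = j then mat 1 else 0))"

definition block_invertible :: "nat \<Rightarrow> 'n::finite blockmat \<Rightarrow> bool" where
  "block_invertible d X \<longleftrightarrow> (\<exists>Y. block_is_inverse d X Y)"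

definition block_inv :: "nat \<Rightarrow> 'n::finite blockmat \<Rightarrow> 'n blockmat" where
  "block_inv d X = (SOME Y. block_is_inverse d X Y)"

definition Qmat :: "real \<Rightarrow> 'n::finite blockmat" where
  "Qmat z = (\<lambda>i j. if i \<le> j then mat (z ^ (j - i) / fact (j - i)) else 0)"

definition Kmat ::
  "nat \<Rightarrow> real \<Rightarrow> real \<Rightarrow> 'n::finite blockmat \<Rightarrow> 'n blockmat \<Rightarrow> 'n blockmat" where
  "Kmat d a b B C = (\<lambda>i j. B i j + block_mult d C (Qmat (b - a)) i j)"

definition bc_domain ::
  "nat \<Rightarrow> real \<Rightarrow> real \<Rightarrow> 'n::finite blockmat \<Rightarrow> 'n blockmat \<Rightarrow> (real \<Rightarrow> real ^ 'n) set" where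
  "bc_domain d a b B C =
     {u \<in> sobolev d a b. \<forall>i<d.
        (\<Sum>j<d. B i j *v cont_rep a b (wderiv a b j u) a +
                 C i j *v cont_rep a b (wderiv a b j u) b) = 0}"

definition PIE_compatible ::
  "nat \<Rightarrow> real \<Rightarrow> real \<Rightarrow> 'n::finite blockmat \<Rightarrow> 'n blockmat \<Rightarrow> bool" where
  "PIE_compatible d a b B C \<longleftrightarrow> block_invertible d (Kmat d a b B C)"

definition Ghat ::
  "nat \<Rightarrow> real \<Rightarrow> real \<Rightarrow> 'n::finite blockmat \<Rightarrow> 'n blockmat \<Rightarrow> real \<Rightarrow> real \<Rightarrow> 'n blockmat" where
  "Ghat d a b B C s \<theta> =
     (let H = block_mult d (Qmat (s - a))
                (block_mult d (block_inv d (Kmat d a b B C)) (block_mult d C (Qmat (b - \<theta>))))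
      in if \<theta> \<le> s then (\<lambda>i j. Qmat (s - \<theta>) i j - H i j) else (\<lambda>i j. - H i j))"

text \<open>\<open>E\<^sub>1\<^sup>T X E\<^sub>d\<close> is the block of \<open>X\<close> with index \<open>(0, d - 1)\<close>.\<close>

definition Top ::
  "nat \<Rightarrow> real \<Rightarrow> real \<Rightarrow> 'n::finite blockmat \<Rightarrow> 'n blockmat \<Rightarrow> 'n l2op" where
  "Top d a b B C v = (\<lambda>s. LINT \<theta>|lebesgue_on {a..b}. Ghat d a b B C s \<theta> 0 (d - 1) *v v \<theta>)"

definition poly_mat :: "real poly ^ 'n ^ 'n \<Rightarrow> real \<Rightarrow> real ^ 'n ^ 'n::finite" where
  "poly_mat P s = (\<chi> i j. poly (P $ i $ j) s)"

text \<open>Bivariate polynomials are polynomials in \<open>\<theta>\<close> with coefficients in \<open>\<real>[s]\<close>.\<close>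

definition poly_mat2 :: "real poly poly ^ 'n ^ 'n \<Rightarrow> real \<Rightarrow> real \<Rightarrow> real ^ 'n ^ 'n::finite" where
  "poly_mat2 P s \<theta> = (\<chi> i j. poly (poly (P $ i $ j) [:\<theta>:]) s)"

definition diff_op :: "nat \<Rightarrow> real \<Rightarrow> real \<Rightarrow> (nat \<Rightarrow> real poly ^ 'n ^ 'n) \<Rightarrow> 'n::finite l2op" where
  "diff_op d a b A u = (\<lambda>s. \<Sum>k\<le>d. poly_mat (A k) s *v wderiv a b k u s)"

definition PI_operator :: "real \<Rightarrow> real \<Rightarrow> 'n::finite l2op \<Rightarrow> bool" where
  "PI_operator a b R \<longleftrightarrow>
     (\<exists>(P :: real poly ^ 'n ^ 'n) (L :: real poly poly ^ 'n ^ 'n) (U :: real poly poly ^ 'n ^ 'n).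
        \<forall>v\<in>L2 a b. L2_eq a b (R v)
          (\<lambda>s. poly_mat P s *v v s
             + (LINT \<theta>|lebesgue_on {a..s}. poly_mat2 L s \<theta> *v v \<theta>)
             + (LINT \<theta>|lebesgue_on {s..b}. poly_mat2 U s \<theta> *v v \<theta>)))"

definition C0_semigroup :: "real \<Rightarrow> real \<Rightarrow> (real \<Rightarrow> 'n::finite l2op) \<Rightarrow> bool" where
  "C0_semigroup a b S \<longleftrightarrow>
     (\<forall>t\<ge>0. L2_bounded_op a b (S t)) \<and>
     (\<forall>v\<in>L2 a b. L2_eq a b (S 0 v) v) \<and>
     (\<forall>t\<ge>0. \<forall>r\<ge>0. \<forall>v\<in>L2 a b. L2_eq a b (S (t + r) v) (S t (S r v))) \<and>
     (\<forall>v\<in>L2 a b. L2_tendsto a b (\<lambda>t. S t v) v (at_right 0))"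

definition is_generator ::
  "real \<Rightarrow> real \<Rightarrow> (real \<Rightarrow> 'n::finite l2op) \<Rightarrow> (real \<Rightarrow> real ^ 'n) set \<Rightarrow> 'n l2op \<Rightarrow> bool" where
  "is_generator a b S D A \<longleftrightarrow>
     D = {u \<in> L2 a b. \<exists>v\<in>L2 a b.
            L2_tendsto a b (\<lambda>t s. (1 / t) *\<^sub>R (S t u s - u s)) v (at_right 0)} \<and>
     (\<forall>u\<in>D. A u \<in> L2 a b \<and>
            L2_tendsto a b (\<lambda>t s. (1 / t) *\<^sub>R (S t u s - u s)) (A u) (at_right 0))"

definition has_growth :: "real \<Rightarrow> real \<Rightarrow> (real \<Rightarrow> 'n::finite l2op) \<Rightarrow> real \<Rightarrow> real \<Rightarrow> bool" where
  "has_growth a b S \<omega> M \<longleftrightarrow> 1 \<le> M \<and> (\<forall>t\<ge>0. L2_onorm a b (S t) \<le> M * exp (\<omega> * t))"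

end

theory Submission imports Defs begin

text \<open>
  Every \<open>u\<close> in \<open>D\<close> is \<open>\<T> v\<close> with \<open>v = \<partial>\<^sup>d u\<close>: by the lemma of du Bois-Reymond \<open>u\<close> is its Taylor
  polynomial at \<open>a\<close> plus an iterated integral of \<open>v\<close>, and the boundary conditions are a linear system
  for the Taylor coefficients whose matrix is \<open>K\<close>. The second operator inequality then says that
  \<open>A - \<omega>\<close> is dissipative for the inner product \<open>\<langle>u, \<P> v\<rangle>\<close>. The third makes \<open>R R\<^sup>*\<close> coercive for
  \<open>R = \<lambda>\<T> - \<A>\<close>, so \<open>R\<close> is onto by Lax-Milgram, that is, \<open>\<lambda> - A\<close> maps \<open>D\<close> onto \<open>L\<^sub>2\<close>. This is the
  situation of the Lumer-Phillips theorem, whose semigroup is a limit of exponentials of the Yosida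
  approximations; it is a contraction semigroup, up to the factor \<open>exp (\<omega>t)\<close>, in the \<open>\<P>\<close>-norm, which lies
  between \<open>\<epsilon>\<^sub>1\<close> and \<open>sqrt \<parallel>\<P>\<parallel>\<close> times the \<open>L\<^sub>2\<close>-norm.
\<close>

section \<open>Bounded operators on Hilbert spaces\<close>

text \<open>The inequalities speak of bounded operators only, whereas the generator is unbounded and
  given by weak derivatives and boundary values. The substitution \<open>u = T v\<close> passes
  between the two: it turns the pairing of \<open>u\<close> with \<open>P (A u)\<close> into that of
  \<open>v\<close> with \<open>T' (P (AT v))\<close>, which is why the second inequality has
  \<open>T\<close> or \<open>AT\<close> on either side of \<open>P\<close>, and it turns
  \<open>l u - A u\<close> into \<open>(l T - AT) v\<close>. In the third inequality the order of
  the factors matters: coercivity of \<open>R\<close> after its adjoint yields preimages under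
  \<open>R\<close>, namely images under the adjoint, while the opposite order would only bound
  \<open>R\<close> from below. Surjectivity at the single point \<open>l\<close> spreads to all
  larger points by dissipativity, and density of the domain follows as well. Two encodings shape the
  rest. Adjoints are obtained by choice, so their existence has to be shown before the hypotheses
  can be exploited. And the interval is a term, so Banach space arguments run on a fixed type of
  square-integrable classes to which everything is carried by an isometry; there \<open>P\<close>
  supplies a second inner product, kept as a form throughout.\<close>

lemma lax_milgram:
  fixes N :: "'a::{real_inner,banach} \<Rightarrow> 'a"
  assumes N: "bounded_linear N" and \<alpha>: "\<alpha> > 0"
    and coercive: "\<And>x. \<alpha> * (norm x)\<^sup>2 \<le> inner x (N x)"
  shows "\<exists>x. N x = y"
proof -
  interpret bounded_linear N by fact
  obtain K0 where K0: "\<And>x. norm (N x) \<le> norm x * K0" using bounded by blast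
  \<comment> \<open>The maximum with \<open>\<alpha>\<close> makes \<open>K\<close> positive and
    keeps the contraction factor \<open>c\<close> below nonnegative.\<close>
  define K where "K = max K0 \<alpha>"
  have K: "norm (N x) \<le> norm x * K" for x
    using K0[of x] mult_left_mono[of K0 K "norm x"] by (simp add: K_def)
  have "K > 0" "\<alpha> \<le> K" using \<alpha> by (auto simp: K_def)
  \<comment> \<open>This \<open>\<rho>\<close> minimises the factor
    \<open>1 - 2 \<rho> \<alpha> + \<rho>^2 K^2\<close> that bounds the squared norm of
    \<open>x - \<rho> N x\<close>; the minimum is \<open>c\<close>.\<close>
  define \<rho> where "\<rho> = \<alpha> / K\<^sup>2"
  define c where "c = 1 - \<alpha>\<^sup>2 / K\<^sup>2"
  have "\<rho> > 0" using \<alpha> \<open>K > 0\<close> by (simp add: \<rho>_def)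
  have "\<alpha>\<^sup>2 \<le> K\<^sup>2" using \<open>\<alpha> \<le> K\<close> \<alpha> by (intro power_mono) auto
  then have c: "0 \<le> c" "c < 1" using \<open>K > 0\<close> \<alpha> by (auto simp: c_def)
  have contr: "(norm (x - \<rho> *\<^sub>R N x))\<^sup>2 \<le> c * (norm x)\<^sup>2" for x
  proof -
    have "(norm (x - \<rho> *\<^sub>R N x))\<^sup>2 = (norm x)\<^sup>2 - 2 * \<rho> * inner x (N x) + \<rho>\<^sup>2 * (norm (N x))\<^sup>2"
      by (simp add: power2_norm_eq_inner inner_diff inner_commute power2_eq_square[of \<rho>])
    also have "\<dots> \<le> (norm x)\<^sup>2 - 2 * \<rho> * (\<alpha> * (norm x)\<^sup>2) + \<rho>\<^sup>2 * (norm x * K)\<^sup>2"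
    proof -
      have "2 * \<rho> * (\<alpha> * (norm x)\<^sup>2) \<le> 2 * \<rho> * inner x (N x)"
        using coercive[of x] \<open>\<rho> > 0\<close> by (intro mult_left_mono) auto
      moreover have "\<rho>\<^sup>2 * (norm (N x))\<^sup>2 \<le> \<rho>\<^sup>2 * (norm x * K)\<^sup>2"
        using K[of x] by (intro mult_left_mono power_mono) auto
      ultimately show ?thesis by linarith
    qed
    also have "\<dots> = (1 - 2 * \<rho> * \<alpha> + \<rho>\<^sup>2 * K\<^sup>2) * (norm x)\<^sup>2"
      by (simp add: algebra_simps power_mult_distrib)
    also have "1 - 2 * \<rho> * \<alpha> + \<rho>\<^sup>2 * K\<^sup>2 = c"
      using \<open>K > 0\<close> by (simp add: \<rho>_def c_def field_simps power2_eq_square)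
    finally show ?thesis .
  qed
  \<comment> \<open>The fixed points of \<open>f\<close> are the solutions of
    \<open>N x = y\<close>, and \<open>f\<close> contracts because its linear part is
    \<open>1 - \<rho> N\<close>.\<close>
  define f where "f x = x - \<rho> *\<^sub>R (N x - y)" for x
  have "dist (f u) (f v) \<le> sqrt c * dist u v" for u v
  proof -
    have "f u - f v = (u - v) - \<rho> *\<^sub>R N (u - v)"
      by (simp add: f_def diff algebra_simps)
    then have "(dist (f u) (f v))\<^sup>2 \<le> c * (dist u v)\<^sup>2"
      using contr[of "u - v"] by (simp add: dist_norm)
    from real_sqrt_le_mono[OF this] show ?thesis by (simp add: real_sqrt_mult)
  qed
  moreover have "0 \<le> sqrt c" "sqrt c < 1" using c by auto
  ultimately obtain x where "f x = x" using banach_fix_type[of "sqrt c" f] by auto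
  then show ?thesis using \<open>\<rho> > 0\<close> by (auto simp: f_def)
qed

section \<open>Orthogonality, Riesz representation and adjoints\<close>

lemma subspace_closure:
  assumes "subspace (Y :: 'a::real_normed_vector set)" shows "subspace (closure Y)"
proof (rule subspaceI)
  show "0 \<in> closure Y"
    using subspace_0[OF assms] closure_subset by auto
next
  fix x y assume "x \<in> closure Y" "y \<in> closure Y"
  then obtain f g where "\<forall>n. f n \<in> Y" "f \<longlonglongrightarrow> x" "\<forall>n. g n \<in> Y" "g \<longlonglongrightarrow> y"
    by (auto simp: closure_sequential)
  then show "x + y \<in> closure Y"
    using assms unfolding closure_sequential
    by (intro exI[of _ "\<lambda>n. f n + g n"]) (auto intro: subspace_add tendsto_add)
next
  fix x and c :: real assume "x \<in> closure Y"
  then obtain f where "\<forall>n. f n \<in> Y" "f \<longlonglongrightarrow> x"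
    by (auto simp: closure_sequential)
  then show "c *\<^sub>R x \<in> closure Y"
    using assms unfolding closure_sequential
    by (intro exI[of _ "\<lambda>n. c *\<^sub>R f n"]) (auto intro: subspace_scale tendsto_scaleR)
qed

text \<open>The residual of the best approximation in \<open>Y\<close> to a point outside
  \<open>Y\<close> serves as \<open>w\<close>. The best approximation exists by completeness, since
  the parallelogram law makes every minimising sequence Cauchy.\<close>

lemma closed_subspace_orthogonal:
  fixes Y :: "'a::{real_inner,banach} set"
  assumes sub: "subspace Y" and cl: "closed Y" and "Y \<noteq> UNIV"
  shows "\<exists>w. w \<noteq> 0 \<and> (\<forall>y\<in>Y. inner w y = 0)"
proof -
  obtain x where x: "x \<notin> Y" using assms(3) by auto
  have Y0: "0 \<in> Y" using sub by (simp add: subspace_0)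
  define \<delta> where "\<delta> = (INF y\<in>Y. (norm (x - y))\<^sup>2)"
  have bdd: "bdd_below ((\<lambda>y. (norm (x - y))\<^sup>2) ` Y)" by (rule bdd_belowI2[of _ 0]) simp
  have low: "\<delta> \<le> (norm (x - y))\<^sup>2" if "y \<in> Y" for y
    unfolding \<delta>_def by (rule cINF_lower[OF bdd that])
  have "\<exists>y\<in>Y. (norm (x - y))\<^sup>2 < \<delta> + inverse (Suc n)" for n
    using cINF_less_iff[OF _ bdd, of "\<delta> + inverse (Suc n)"] Y0 unfolding \<delta>_def[symmetric] by auto
  then obtain g where gY: "\<And>n. g n \<in> Y" and g: "\<And>n. (norm (x - g n))\<^sup>2 < \<delta> + inverse (Suc n)"
    by metis
  \<comment> \<open>Parallelogram law for \<open>x - g m\<close> and \<open>x - g n\<close>; the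
    midpoint of \<open>g m\<close> and \<open>g n\<close> lies in \<open>Y\<close>, so its squared
    distance from \<open>x\<close> is at least \<open>\<delta>\<close>.\<close>
  have par: "(norm (g m - g n))\<^sup>2 \<le> 2 * (inverse (Suc m) + inverse (Suc n))" for m n
  proof -
    have "(1/2) *\<^sub>R (g m + g n) \<in> Y" using sub gY by (intro subspace_scale subspace_add) auto
    from low[OF this] have "4 * \<delta> \<le> 4 * (norm (x - (1/2) *\<^sub>R (g m + g n)))\<^sup>2" by simp
    also have "\<dots> = (norm (2 *\<^sub>R (x - (1/2) *\<^sub>R (g m + g n))))\<^sup>2" by (simp add: power_mult_distrib)
    also have "2 *\<^sub>R (x - (1/2) *\<^sub>R (g m + g n)) = (x - g m) + (x - g n)"
      by (simp add: algebra_simps scaleR_2)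
    also have "(norm \<dots>)\<^sup>2 = 2 * (norm (x - g m))\<^sup>2 + 2 * (norm (x - g n))\<^sup>2 - (norm (g m - g n))\<^sup>2"
      by (simp add: power2_norm_eq_inner inner_diff inner_add inner_commute)
    finally show ?thesis using g[of m] g[of n] unfolding distrib_left by linarith
  qed
  have "Cauchy g"
  proof (rule metric_CauchyI)
    fix e :: real assume "e > 0"
    then obtain N where N: "inverse (Suc N) < e\<^sup>2 / 4"
      using reals_Archimedean[of "e\<^sup>2 / 4"] by auto
    have "dist (g m) (g n) < e" if "m \<ge> N" "n \<ge> N" for m n
    proof -
      have "inverse (real (Suc m)) \<le> inverse (Suc N)" "inverse (real (Suc n)) \<le> inverse (Suc N)"
        using that by (auto intro!: le_imp_inverse_le)
      then have "(norm (g m - g n))\<^sup>2 < e\<^sup>2" using par[of m n] N unfolding distrib_left by linarith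
      then show ?thesis using \<open>e > 0\<close> by (simp add: dist_norm power2_less_imp_less)
    qed
    then show "\<exists>M. \<forall>m\<ge>M. \<forall>n\<ge>M. dist (g m) (g n) < e" by blast
  qed
  then obtain y where y: "g \<longlonglongrightarrow> y" using Cauchy_convergent convergent_def by blast
  have "y \<in> Y" using cl gY y by (meson closed_sequentially)
  have "(\<lambda>n. (norm (x - g n))\<^sup>2) \<longlonglongrightarrow> (norm (x - y))\<^sup>2" by (intro tendsto_intros y)
  moreover have "(\<lambda>n. \<delta> + inverse (Suc n)) \<longlonglongrightarrow> \<delta> + 0"
    by (intro tendsto_intros LIMSEQ_inverse_real_of_nat)
  ultimately have le: "(norm (x - y))\<^sup>2 \<le> \<delta>"
    using g by (intro LIMSEQ_le[of _ _ "\<lambda>n. \<delta> + inverse (Suc n)"]) (auto intro: less_imp_le)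
  define w where "w = x - y"
  have "w \<noteq> 0" using x \<open>y \<in> Y\<close> by (auto simp: w_def)
  moreover have "inner w z = 0" if "z \<in> Y" for z
  proof (cases "z = 0")
    case False
    \<comment> \<open>\<open>t z\<close> is the multiple of \<open>z\<close> nearest to
      \<open>w\<close>. For this \<open>t\<close>, minimality of \<open>w\<close> says that
      \<open>(inner w z)^2 / (norm z)^2\<close> is at most 0.\<close>
    define t where "t = inner w z / (norm z)\<^sup>2"
    have mem: "y + t *\<^sub>R z \<in> Y" using sub \<open>y \<in> Y\<close> that by (intro subspace_add subspace_scale)
    have "(norm w)\<^sup>2 \<le> (norm (w - t *\<^sub>R z))\<^sup>2"
      using order_trans[OF le low[OF mem]] by (simp add: w_def diff_diff_eq)
    also have "\<dots> = (norm w)\<^sup>2 - 2 * t * inner w z + t\<^sup>2 * (norm z)\<^sup>2"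
      by (simp add: power2_norm_eq_inner inner_diff inner_commute power2_eq_square[of t])
    also have "t\<^sup>2 * (norm z)\<^sup>2 = t * inner w z"
      using False by (simp add: t_def power2_eq_square)
    also have "t * inner w z = (inner w z)\<^sup>2 / (norm z)\<^sup>2" by (simp add: t_def power2_eq_square)
    finally have "(inner w z)\<^sup>2 / (norm z)\<^sup>2 \<le> 0" by (simp add: t_def power2_eq_square)
    then show ?thesis using False by (simp add: divide_le_0_iff)
  qed simp
  ultimately show ?thesis by blast
qed

text \<open>The kernel of a nonzero \<open>f\<close> is a proper closed subspace. Every
  \<open>x\<close> differs from a multiple of a normal vector \<open>w\<close> by an element of the
  kernel, so \<open>w\<close> represents \<open>f\<close> once it is scaled to be correct at
  \<open>w\<close> itself.\<close>

lemma riesz_representation: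
  fixes f :: "'a::{real_inner,banach} \<Rightarrow> real"
  assumes f: "bounded_linear f"
  shows "\<exists>w. \<forall>x. f x = inner x w"
proof (cases "\<forall>x. f x = 0")
  case False
  interpret bounded_linear f by fact
  define Y where "Y = {x. f x = 0}"
  have "subspace Y" by (auto simp: Y_def subspace_def zero add scale)
  moreover have "closed Y" unfolding Y_def
    by (intro closed_Collect_eq continuous_intros continuous_on continuous_on_const)
  moreover have "Y \<noteq> UNIV" using False by (auto simp: Y_def)
  ultimately obtain w where w: "w \<noteq> 0" "\<And>y. y \<in> Y \<Longrightarrow> inner w y = 0"
    using closed_subspace_orthogonal by blast
  have fw: "f w \<noteq> 0" using w(1) w(2)[of w] by (auto simp: Y_def)
  have "f x = inner x ((f w / (norm w)\<^sup>2) *\<^sub>R w)" for x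
  proof -
    have "x - (f x / f w) *\<^sub>R w \<in> Y" using fw by (simp add: Y_def diff scale)
    then have "inner w x = f x / f w * inner w w" using w(2) by (fastforce simp: inner_diff)
    then show ?thesis using fw w(1) by (simp add: inner_commute power2_norm_eq_inner)
  qed
  then show ?thesis by blast
qed (auto intro: exI[of _ 0])

text \<open>Riesz representation for each fixed \<open>y\<close>. This existence statement is what
  gives content to \<open>L2_adjoint\<close>, which is defined by choice.\<close>

lemma adjoint_exists:
  fixes R :: "'a::{real_inner,banach} \<Rightarrow> 'a"
  assumes R: "bounded_linear R"
  shows "\<exists>R'. bounded_linear R' \<and> (\<forall>x y. inner (R x) y = inner x (R' y))"
proof -
  interpret bounded_linear R by fact
  have "\<exists>w. \<forall>x. inner (R x) y = inner x w" for y
    by (intro riesz_representation bounded_linear_inner_left_comp R)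
  then obtain R' where R': "\<And>x y. inner (R x) y = inner x (R' y)" by metis
  obtain K where K: "\<And>x. norm (R x) \<le> norm x * K" using bounded by blast
  have "bounded_linear R'"
  proof (rule bounded_linear_intro[of _ K])
    fix x y r
    have "\<forall>z. inner z (R' (x + y)) = inner z (R' x + R' y)"
      by (simp add: R'[symmetric] inner_add_right)
    then show "R' (x + y) = R' x + R' y" using vector_eq_rdot by (metis inner_commute)
    have "\<forall>z. inner z (R' (r *\<^sub>R x)) = inner z (r *\<^sub>R R' x)"
      by (simp add: R'[symmetric])
    then show "R' (r *\<^sub>R x) = r *\<^sub>R R' x" using vector_eq_rdot by (metis inner_commute)
    show "norm (R' x) \<le> norm x * K"
    \<comment> \<open>The main estimate cancels a factor \<open>norm (R' x)\<close>. If that is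
      zero, what remains is nonnegativity of \<open>norm x * K\<close>, which the bound on
      \<open>R\<close> at \<open>x\<close> provides.\<close>
    proof (cases "R' x = 0")
      case False
      have "(norm (R' x))\<^sup>2 = inner (R (R' x)) x" by (simp add: R' power2_norm_eq_inner)
      also have "\<dots> \<le> norm (R (R' x)) * norm x" by (rule norm_cauchy_schwarz)
      also have "\<dots> \<le> (norm (R' x) * K) * norm x" by (intro mult_right_mono K) auto
      finally show ?thesis using False by (simp add: power2_eq_square mult.commute)
    next
      case True
      have "0 \<le> norm (R x)" by simp
      also have "\<dots> \<le> norm x * K" by (rule K)
      finally show ?thesis using True by simp
    qed
  qed
  with R' show ?thesis by blast
qed

section \<open>Exponentials of bounded operators\<close>

text \<open>Endomorphisms form a separate type because \<^const>\<open>exp\<close> needs the class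
  \<^class>\<open>real_normed_algebra_1\<close>, of which bounded linear maps are not an instance.\<close>

typedef (overloaded) 'a endo = "UNIV :: ('a::{banach,perfect_space} \<Rightarrow>\<^sub>L 'a) set"
  morphisms blinfun_of_endo Endo by simp

setup_lifting type_definition_endo

instantiation endo :: ("{banach,perfect_space}") real_normed_algebra_1
begin

lift_definition zero_endo :: "'a endo" is "0" .
lift_definition one_endo :: "'a endo" is "id_blinfun" .
lift_definition plus_endo :: "'a endo \<Rightarrow> 'a endo \<Rightarrow> 'a endo" is "(+)" .
lift_definition minus_endo :: "'a endo \<Rightarrow> 'a endo \<Rightarrow> 'a endo" is "(-)" .
lift_definition uminus_endo :: "'a endo \<Rightarrow> 'a endo" is "uminus" .
lift_definition scaleR_endo :: "real \<Rightarrow> 'a endo \<Rightarrow> 'a endo" is "scaleR" .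
lift_definition times_endo :: "'a endo \<Rightarrow> 'a endo \<Rightarrow> 'a endo" is "(o\<^sub>L)" .
lift_definition norm_endo :: "'a endo \<Rightarrow> real" is "norm" .
definition dist_endo :: "'a endo \<Rightarrow> 'a endo \<Rightarrow> real" where "dist_endo x y = norm (x - y)"
definition sgn_endo :: "'a endo \<Rightarrow> 'a endo" where "sgn_endo x = inverse (norm x) *\<^sub>R x"
definition uniformity_endo :: "('a endo \<times> 'a endo) filter"
  where "uniformity_endo = (INF e\<in>{0<..}. principal {(x, y). dist x y < e})"
definition open_endo :: "'a endo set \<Rightarrow> bool"
  where "open_endo U = (\<forall>x\<in>U. eventually (\<lambda>(x', y). x' = x \<longrightarrow> y \<in> U) uniformity)"

instance
proof
  fix x y z :: "'a endo" and r s :: real and U :: "'a endo set"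
  show "dist x y = norm (x - y)" by (rule dist_endo_def)
  show "sgn x = inverse (norm x) *\<^sub>R x" by (rule sgn_endo_def)
  show "uniformity = (INF e\<in>{0<..}. principal {(x, y :: 'a endo). dist x y < e})"
    by (rule uniformity_endo_def)
  show "open U = (\<forall>x\<in>U. eventually (\<lambda>(x', y). x' = x \<longrightarrow> y \<in> U) uniformity)"
    by (rule open_endo_def)
  show "(x + y) + z = x + (y + z)" by transfer simp
  show "x + y = y + x" by transfer simp
  show "0 + x = x" by transfer simp
  show "- x + x = 0" by transfer simp
  show "x - y = x + - y" by transfer simp
  show "r *\<^sub>R (x + y) = r *\<^sub>R x + r *\<^sub>R y" by transfer (simp add: scaleR_add_right)
  show "(r + s) *\<^sub>R x = r *\<^sub>R x + s *\<^sub>R x" by transfer (simp add: scaleR_add_left)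
  show "r *\<^sub>R s *\<^sub>R x = (r * s) *\<^sub>R x" by transfer simp
  show "1 *\<^sub>R x = x" by transfer simp
  show "(x * y) * z = x * (y * z)" by transfer (auto intro: blinfun_eqI)
  show "1 * x = x" by transfer (auto intro: blinfun_eqI)
  show "x * 1 = x" by transfer (auto intro: blinfun_eqI)
  show "(x + y) * z = x * z + y * z" by transfer (auto intro: blinfun_eqI simp: blinfun.bilinear_simps)
  show "x * (y + z) = x * y + x * z" by transfer (auto intro: blinfun_eqI simp: blinfun.bilinear_simps)
  show "r *\<^sub>R x * y = r *\<^sub>R (x * y)" by transfer (auto intro: blinfun_eqI simp: blinfun.bilinear_simps)
  show "x * r *\<^sub>R y = r *\<^sub>R (x * y)" by transfer (auto intro: blinfun_eqI simp: blinfun.bilinear_simps)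
  \<comment> \<open>The identity has norm 1 only on a nontrivial space; the sort
    \<open>perfect_space\<close> excludes the zero space.\<close>
  show "norm (1 :: 'a endo) = 1" by transfer simp
  show "(0 :: 'a endo) \<noteq> 1"
  proof transfer
    have "norm (id_blinfun :: 'a \<Rightarrow>\<^sub>L 'a) = 1" by simp
    then show "(0 :: 'a \<Rightarrow>\<^sub>L 'a) \<noteq> id_blinfun" by (metis norm_zero zero_neq_one)
  qed
  show "norm x = 0 \<longleftrightarrow> x = 0" by transfer simp
  show "norm (x + y) \<le> norm x + norm y" by transfer (rule norm_triangle_ineq)
  show "norm (r *\<^sub>R x) = \<bar>r\<bar> * norm x" by transfer simp
  show "norm (x * y) \<le> norm x * norm y" by transfer (rule norm_blinfun_compose)
qed

end

instance endo :: ("{banach,perfect_space}") banach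
proof
  fix X :: "nat \<Rightarrow> 'a endo" assume "Cauchy X"
  have eq: "dist x y = dist (blinfun_of_endo x) (blinfun_of_endo y)" for x y :: "'a endo"
    unfolding dist_norm by transfer simp
  have "Cauchy (\<lambda>n. blinfun_of_endo (X n))" using \<open>Cauchy X\<close> unfolding Cauchy_def eq .
  then obtain L where L: "(\<lambda>n. blinfun_of_endo (X n)) \<longlonglongrightarrow> L"
    using Cauchy_convergent convergent_def by blast
  then have "X \<longlonglongrightarrow> Endo L" unfolding tendsto_iff eq by (simp add: Endo_inverse)
  then show "convergent X" by (auto simp: convergent_def)
qed

lift_definition app :: "'a::{banach,perfect_space} endo \<Rightarrow> 'a \<Rightarrow> 'a" is blinfun_apply .

lemma bounded_linear_app: "bounded_linear (app G)"
  by transfer (rule blinfun.bounded_linear_right)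

lemma bounded_linear_app_left: "bounded_linear (\<lambda>G. app G x)"
proof (rule bounded_linear_intro[of _ "norm x"])
  fix G H :: "'a endo" and r
  show "app (G + H) x = app G x + app H x" by transfer (simp add: blinfun.bilinear_simps)
  show "app (r *\<^sub>R G) x = r *\<^sub>R app G x" by transfer (simp add: blinfun.bilinear_simps)
  show "norm (app G x) \<le> norm G * norm x" by transfer (rule norm_blinfun)
qed

lemma app_mult: "app (G * H) x = app G (app H x)"
  by transfer simp

lemma app_one: "app 1 x = x"
  by transfer simp

lemma endo_eqI: "(\<And>x. app G x = app H x) \<Longrightarrow> G = H"
  by transfer (rule blinfun_eqI)

lemma bounded_linear_endo:
  assumes "bounded_linear f"
  obtains G where "app G = f"
proof
  show "app (Endo (Blinfun f)) = f"
    using assms by (simp add: app.rep_eq Endo_inverse bounded_linear_Blinfun_apply)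
qed

lemma app_diff: "app (G - H) x = app G x - app H x"
  by (rule bounded_linear.linear[OF bounded_linear_app_left, THEN linear_diff])

lemma app_exp_add: "app (exp ((s + t) *\<^sub>R G)) x = app (exp (s *\<^sub>R G)) (app (exp (t *\<^sub>R G)) x)"
  by (simp add: scaleR_add_left exp_add_commuting flip: app_mult)

lemma app_exp_derivative:
  "((\<lambda>t. app (exp (t *\<^sub>R G)) x) has_vector_derivative app (exp (t *\<^sub>R G)) (app G x)) (at t within T)"
  unfolding app_mult[symmetric]
  by (rule bounded_linear.has_vector_derivative[OF bounded_linear_app_left
        exp_scaleR_has_vector_derivative_right])

lemma exp_scaleR_commute:
  assumes "G * H = H * (G :: 'a::{real_normed_algebra_1,banach})"
  shows "exp (t *\<^sub>R G) * H = H * exp (t *\<^sub>R G)"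
proof -
  have "summable (\<lambda>n. (t *\<^sub>R G) ^ n /\<^sub>R fact n)" by (rule summable_exp_generic)
  moreover have "G ^ n * H = H * G ^ n" for n
    by (induction n) (auto simp: assms mult.assoc, simp add: assms flip: mult.assoc)
  ultimately show ?thesis
    by (simp add: exp_def suminf_mult[symmetric] suminf_mult2)
qed

text \<open>Interpolation along \<open>exp ((t - s) H) exp (s G)\<close> for \<open>s\<close> from 0
  to \<open>t\<close>. Commutation allows the factor \<open>G - H\<close> in the derivative to be
  moved next to \<open>x\<close>, so only the difference at the vector \<open>x\<close> enters and
  not an operator norm. Strong convergence of generators is then enough for convergence of the
  exponentials.\<close>

lemma exp_diff_bound:
  fixes G H :: "'a::{banach,perfect_space} endo"
  assumes comm: "G * H = H * G" and t: "0 \<le> t" and M: "0 \<le> M"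
    and bG: "\<And>s x. 0 \<le> s \<Longrightarrow> norm (app (exp (s *\<^sub>R G)) x) \<le> M * norm x"
    and bH: "\<And>s x. 0 \<le> s \<Longrightarrow> norm (app (exp (s *\<^sub>R H)) x) \<le> M * norm x"
  shows "norm (app (exp (t *\<^sub>R G)) x - app (exp (t *\<^sub>R H)) x) \<le> t * (M * (M * norm (app G x - app H x)))"
proof (cases "t = 0")
  case False
  define f where "f s = app (exp ((t - s) *\<^sub>R H) * exp (s *\<^sub>R G)) x" for s
  define f' where "f' s = app (exp ((t - s) *\<^sub>R H) * (exp (s *\<^sub>R G) * (G - H))) x" for s
  have der: "(f has_vector_derivative f' s) (at s within T)" for s T
  proof -
    have "((\<lambda>s. t - s) has_vector_derivative - 1) (at s within T)"
      by (auto intro!: derivative_eq_intros)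
    then have "((\<lambda>s. exp ((t - s) *\<^sub>R H)) has_vector_derivative (-1) *\<^sub>R (exp ((t - s) *\<^sub>R H) * H)) (at s within T)"
      using vector_diff_chain_within[of "\<lambda>s. t - s" "-1" s T "\<lambda>r. exp (r *\<^sub>R H)" "exp ((t - s) *\<^sub>R H) * H"]
        exp_scaleR_has_vector_derivative_right[of H "t - s"]
      by (simp add: o_def)
    from bounded_bilinear.has_vector_derivative[OF bounded_bilinear_mult this
        exp_scaleR_has_vector_derivative_right[of G s]]
    have "((\<lambda>s. exp ((t - s) *\<^sub>R H) * exp (s *\<^sub>R G)) has_vector_derivative
        exp ((t - s) *\<^sub>R H) * (exp (s *\<^sub>R G) * (G - H))) (at s within T)"
      using exp_scaleR_commute[OF comm, of s] by (simp add: algebra_simps)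
    from bounded_linear.has_vector_derivative[OF bounded_linear_app_left this]
    show ?thesis unfolding f_def f'_def .
  qed
  define c where "c = M * (M * norm (app G x - app H x))"
  have "norm (f t - f 0) \<le> (\<lambda>s. c * s) t - (\<lambda>s. c * s) 0"
  proof (rule differentiable_bound_general[where f' = f' and \<phi>' = "\<lambda>_. c"])
    show "0 < t" using t False by simp
    show "continuous_on {0..t} f"
      using der by (intro continuous_on_vector_derivative) auto
    fix s assume s: "0 < s" "s < t"
    have "norm (f' s) \<le> M * norm (app (exp (s *\<^sub>R G)) (app (G - H) x))"
      using bH[of "t - s"] s by (simp add: f'_def app_mult)
    also have "\<dots> \<le> M * (M * norm (app (G - H) x))" using s by (intro mult_left_mono bG M) auto
    finally show "norm (f' s) \<le> c" by (simp add: c_def app_diff)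
  qed (auto intro!: continuous_intros der derivative_eq_intros)
  then show ?thesis by (simp add: f_def c_def app_one mult.commute)
qed (simp add: app_one)

section \<open>The Lumer-Phillips theorem for an equivalent inner product\<close>

lemma norm_add_diff_le:
  fixes x y z :: "'a::real_normed_vector"
  shows "norm (x + y - z) \<le> norm x + norm y + norm z"
  using norm_triangle_ineq4[of "x + y" z] norm_triangle_ineq[of x y] by linarith

text \<open>The growth rate is shifted to 0 here. A type carries only one \<open>real_inner\<close>
  structure, so the equivalent inner product appears as the form of \<open>P\<close>. The range
  condition is imposed at a single point \<open>\<mu>0\<close>.\<close>

locale dissipative =
  fixes P :: "'a::{real_inner,banach,perfect_space} \<Rightarrow> 'a" and \<epsilon> :: real
    and D :: "'a set" and A :: "'a \<Rightarrow> 'a" and \<mu>0 :: real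
  assumes P: "bounded_linear P" and P_sym: "\<And>x y. inner x (P y) = inner (P x) y"
    and \<epsilon>: "\<epsilon> > 0" and P_coercive: "\<And>x. \<epsilon>\<^sup>2 * (norm x)\<^sup>2 \<le> inner x (P x)"
    and D: "subspace D"
    and A_add: "\<And>x y. x \<in> D \<Longrightarrow> y \<in> D \<Longrightarrow> A (x + y) = A x + A y"
    and A_scale: "\<And>c x. x \<in> D \<Longrightarrow> A (c *\<^sub>R x) = c *\<^sub>R A x"
    and diss: "\<And>x. x \<in> D \<Longrightarrow> inner x (P (A x)) \<le> 0"
    and \<mu>0: "\<mu>0 > 0" and range0: "\<And>y. \<exists>x\<in>D. \<mu>0 *\<^sub>R x - A x = y"
begin

sublocale P: bounded_linear P by (rule P)

section \<open>The squared norm of the equivalent inner product\<close>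

definition q :: "'a \<Rightarrow> real" where "q x = inner x (P x)"
definition M :: real where "M = sqrt (onorm P) / \<epsilon>"

lemma A_diff: "x \<in> D \<Longrightarrow> y \<in> D \<Longrightarrow> A (x - y) = A x - A y"
  using A_add[of x "(-1) *\<^sub>R y"] A_scale[of y "-1"] subspace_scale[OF D, of y "-1"] by simp

lemma q_nonneg: "0 \<le> q x"
  using P_coercive[of x] \<epsilon> unfolding q_def by (meson order_trans zero_le_mult_iff zero_le_power2)

lemma q_pos: "x \<noteq> 0 \<Longrightarrow> 0 < q x"
  using P_coercive[of x] \<epsilon> unfolding q_def
  by (meson less_le_trans mult_pos_pos zero_less_norm_iff zero_less_power)

lemma q_eq_0: "q x \<le> 0 \<Longrightarrow> x = 0"
  using q_pos[of x] by force

lemma P_inj: "P x = P y \<Longrightarrow> x = y"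
  using q_eq_0[of "x - y"] by (simp add: q_def P.diff)

lemma q_scale: "q (c *\<^sub>R x) = c\<^sup>2 * q x"
  by (simp add: q_def P.scale power2_eq_square)

lemma q_cauchy_schwarz: "(inner x (P y))\<^sup>2 \<le> q x * q y"
proof (cases "y = 0")
  case False
  \<comment> \<open>The minimiser of \<open>q (x - t y)\<close> over \<open>t\<close>.\<close>
  define t where "t = inner x (P y) / q y"
  have "q y > 0" using False by (rule q_pos)
  have "0 \<le> q (x - t *\<^sub>R y)" by (rule q_nonneg)
  also have "\<dots> = q x - 2 * t * inner x (P y) + t\<^sup>2 * q y"
    using P_sym[of y x]
    by (simp add: q_def P.diff P.scale inner_diff inner_commute power2_eq_square[of t] algebra_simps)
  also have "\<dots> = q x - (inner x (P y))\<^sup>2 / q y"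
    using \<open>q y > 0\<close> by (simp add: t_def power2_eq_square)
  finally show ?thesis using \<open>q y > 0\<close> by (simp add: divide_le_eq)
qed (simp add: q_def P.zero)

lemma q_upper: "q x \<le> onorm P * (norm x)\<^sup>2"
proof -
  have "q x \<le> norm x * norm (P x)" unfolding q_def by (rule norm_cauchy_schwarz)
  also have "\<dots> \<le> norm x * (onorm P * norm x)" by (intro mult_left_mono onorm[OF P]) auto
  finally show ?thesis by (simp add: power2_eq_square mult.left_commute)
qed

lemma M_nonneg: "0 \<le> M"
  using \<epsilon> onorm_pos_le[OF P] by (simp add: M_def)

text \<open>The origin of the gain: \<open>\<epsilon> norm x\<close> is at most
  \<open>sqrt (q x)\<close>, and \<open>sqrt (q y)\<close> is at most
  \<open>sqrt (onorm P) norm y\<close>. Every contraction for \<open>q\<close> is therefore bounded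
  by the same constant \<open>M\<close> in the original norm.\<close>

lemma norm_le_if_q_le:
  assumes "q x \<le> q y" shows "norm x \<le> M * norm y"
proof -
  have "(\<epsilon> * norm x)\<^sup>2 \<le> q x" using P_coercive by (simp add: q_def power_mult_distrib)
  also have "\<dots> \<le> (sqrt (onorm P) * norm y)\<^sup>2"
    using assms q_upper[of y] onorm_pos_le[OF P] by (simp add: power_mult_distrib)
  finally have "\<epsilon> * norm x \<le> sqrt (onorm P) * norm y"
    by (rule power2_le_imp_le) (simp add: onorm_pos_le[OF P])
  then show ?thesis using \<epsilon> by (simp add: M_def field_simps)
qed

section \<open>Resolvents of a dissipative operator\<close>

lemma resolvent_bound:
  assumes "x \<in> D" "\<mu> > 0"
  shows "q (\<mu> *\<^sub>R x) \<le> q (\<mu> *\<^sub>R x - A x)"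
proof (cases "x = 0")
  case False
  let ?z = "\<mu> *\<^sub>R x - A x"
  \<comment> \<open>Dissipativity gives this lower bound for the pairing of \<open>x\<close> with
    \<open>?z\<close>; Cauchy-Schwarz gives an upper bound, and a factor \<open>q x\<close>
    cancels.\<close>
  have "\<mu> * q x \<le> inner x (P ?z)"
    using diss[OF assms(1)] by (simp add: q_def P.diff P.scale inner_diff)
  moreover have "0 \<le> \<mu> * q x" using assms q_nonneg by simp
  ultimately have "(\<mu> * q x)\<^sup>2 \<le> (inner x (P ?z))\<^sup>2" by (rule power_mono)
  also have "\<dots> \<le> q x * q ?z" by (rule q_cauchy_schwarz)
  finally have "q x * q (\<mu> *\<^sub>R x) \<le> q x * q ?z"
    by (simp add: power2_eq_square q_scale mult_ac)
  then show ?thesis using q_pos[OF False] by simp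
next
  case True
  then have "q (\<mu> *\<^sub>R x) = 0" by (simp add: q_def)
  then show ?thesis using q_nonneg by simp
qed

lemma resolvent_unique:
  assumes "x \<in> D" "y \<in> D" "\<mu> > 0" "\<mu> *\<^sub>R x - A x = \<mu> *\<^sub>R y - A y"
  shows "x = y"
proof -
  have "q (\<mu> *\<^sub>R (x - y)) \<le> q (\<mu> *\<^sub>R (x - y) - A (x - y))"
    using assms D by (intro resolvent_bound subspace_diff)
  also have "\<mu> *\<^sub>R (x - y) - A (x - y) = 0"
    using assms by (simp add: A_diff algebra_simps)
  finally have "\<mu> *\<^sub>R (x - y) = 0" by (intro q_eq_0) (simp add: q_def)
  then show ?thesis using assms by simp
qed

definition R :: "real \<Rightarrow> 'a \<Rightarrow> 'a" where
  "R \<mu> y = (SOME x. x \<in> D \<and> \<mu> *\<^sub>R x - A x = y)"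

text \<open>For positive \<open>\<mu>\<close>, surjectivity of \<open>\<mu> - A\<close> alone puts
  \<open>\<mu>\<close> into the resolvent set: \<open>resolvent_bound\<close> supplies injectivity
  and the bound on the inverse.\<close>

definition regular :: "real \<Rightarrow> bool" where
  "regular \<mu> \<longleftrightarrow> 0 < \<mu> \<and> (\<forall>y. \<exists>x\<in>D. \<mu> *\<^sub>R x - A x = y)"

lemma R_props:
  assumes "regular \<mu>" shows "R \<mu> y \<in> D" "\<mu> *\<^sub>R R \<mu> y - A (R \<mu> y) = y"
proof -
  have "\<exists>x. x \<in> D \<and> \<mu> *\<^sub>R x - A x = y" using assms by (auto simp: regular_def)
  from someI_ex[OF this] show "R \<mu> y \<in> D" "\<mu> *\<^sub>R R \<mu> y - A (R \<mu> y) = y" unfolding R_def by auto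
qed

lemma A_R: "regular \<mu> \<Longrightarrow> A (R \<mu> y) = \<mu> *\<^sub>R R \<mu> y - y"
  using R_props(2)[of \<mu> y] by (simp add: algebra_simps)

lemma R_eqI: "regular \<mu> \<Longrightarrow> x \<in> D \<Longrightarrow> \<mu> *\<^sub>R x - A x = y \<Longrightarrow> R \<mu> y = x"
  using resolvent_unique[of "R \<mu> y" x \<mu>] R_props[of \<mu> y] by (auto simp: regular_def)

lemma q_R: "regular \<mu> \<Longrightarrow> q (\<mu> *\<^sub>R R \<mu> y) \<le> q y"
  using resolvent_bound[of "R \<mu> y" \<mu>] R_props[of \<mu> y] by (auto simp: regular_def)

lemma norm_R: "regular \<mu> \<Longrightarrow> norm (R \<mu> y) \<le> M / \<mu> * norm y"
  using norm_le_if_q_le[OF q_R[of \<mu> y]] by (simp add: regular_def field_simps)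

lemma bounded_linear_R:
  assumes "regular \<mu>" shows "bounded_linear (R \<mu>)"
proof (rule bounded_linear_intro[of _ "M / \<mu>"])
  fix x y c
  note r = R_props[OF assms]
  show "R \<mu> (x + y) = R \<mu> x + R \<mu> y"
    using r(2)[of x] r(2)[of y] assms r(1) D
    by (intro R_eqI) (auto simp: A_add subspace_add algebra_simps A_R)
  show "R \<mu> (c *\<^sub>R x) = c *\<^sub>R R \<mu> x"
    using assms r(1) D
    by (intro R_eqI) (auto simp: A_scale subspace_scale A_R algebra_simps)
  show "norm (R \<mu> x) \<le> norm x * (M / \<mu>)"
    using norm_R[OF assms, of x] by (simp add: mult.commute)
qed

text \<open>The bounded resolvent at \<open>\<mu>0\<close> is accretive for the \<open>P\<close>-inner product, so \<open>1 + (\<mu> - \<mu>0) R\<close>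
  is coercive and Lax-Milgram replaces the usual Neumann series.\<close>

lemma regular_ge:
  assumes "\<mu>0 \<le> \<mu>" shows "regular \<mu>"
proof -
  have r0: "regular \<mu>0" using \<mu>0 range0 by (simp add: regular_def)
  interpret R0: bounded_linear "R \<mu>0" by (rule bounded_linear_R[OF r0])
  define c where "c = \<mu> - \<mu>0"
  have "c \<ge> 0" using assms by (simp add: c_def)
  have "\<exists>x\<in>D. \<mu> *\<^sub>R x - A x = z" for z
  proof -
    \<comment> \<open>The equation is multiplied by \<open>P\<close> because coercivity holds for
      the \<open>P\<close>-form; injectivity of \<open>P\<close> removes the factor again.\<close>
    have "\<exists>x. (\<lambda>x. P (x + c *\<^sub>R R \<mu>0 x)) x = P z"
    proof (rule lax_milgram[of _ "\<epsilon>\<^sup>2"])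
      show "bounded_linear (\<lambda>x. P (x + c *\<^sub>R R \<mu>0 x))"
        by (intro P.bounded_linear bounded_linear_compose[OF P] bounded_linear_add
            bounded_linear_ident bounded_linear_const_scaleR R0.bounded_linear)
      show "0 < \<epsilon>\<^sup>2" using \<epsilon> by simp
      fix x
      let ?y = "R \<mu>0 x"
      have "inner ?y (P (A ?y)) \<le> 0" by (intro diss R_props r0)
      then have "0 \<le> inner ?y (P x)"
        using q_nonneg[of ?y] \<mu>0 by (simp add: A_R[OF r0] P.diff P.scale inner_diff q_def)
          (smt (verit) mult_nonneg_nonneg)
      then have "0 \<le> c * inner x (P ?y)"
        using \<open>c \<ge> 0\<close> P_sym[of ?y x] by (simp add: inner_commute)
      then show "\<epsilon>\<^sup>2 * (norm x)\<^sup>2 \<le> inner x (P (x + c *\<^sub>R ?y))"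
        using P_coercive[of x] by (simp add: P.add P.scale inner_add)
    qed
    then obtain x where "P (x + c *\<^sub>R R \<mu>0 x) = P z" by blast
    then have "x + c *\<^sub>R R \<mu>0 x = z" by (rule P_inj)
    \<comment> \<open>Here \<open>\<mu> - A\<close> is written as \<open>(\<mu>0 - A) + c\<close>
      and applied to \<open>R \<mu>0 x\<close>.\<close>
    then have "\<mu> *\<^sub>R R \<mu>0 x - A (R \<mu>0 x) = z"
      by (simp add: A_R[OF r0] c_def algebra_simps)
    then show ?thesis using R_props(1)[OF r0] by blast
  qed
  then show ?thesis using assms \<mu>0 by (simp add: regular_def)
qed

text \<open>The resolvent identity, written once for each order of the two parameters, expresses the
  same difference up to sign by the two products. Distinct parameters allow division by their
  difference, and equal ones are trivial.\<close>

lemma R_commute: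
  assumes m: "regular \<mu>" and n: "regular \<nu>"
  shows "R \<mu> (R \<nu> y) = R \<nu> (R \<mu> y)"
proof -
  have res: "R \<mu> y - R \<nu> y = (\<nu> - \<mu>) *\<^sub>R R \<mu> (R \<nu> y)" if "regular \<mu>" "regular \<nu>" for \<mu> \<nu>
  proof -
    interpret Rm: bounded_linear "R \<mu>" using that by (intro bounded_linear_R)
    define u v where "u = R \<nu> y" and "v = (\<nu> - \<mu>) *\<^sub>R R \<mu> (R \<nu> y)"
    have uv: "u \<in> D" "v \<in> D" using that R_props(1) D by (auto simp: u_def v_def subspace_scale)
    have Auv: "A u = \<nu> *\<^sub>R u - y" "A v = \<mu> *\<^sub>R v - (\<nu> - \<mu>) *\<^sub>R u"
      using that A_scale[OF R_props(1), of \<mu> "\<nu> - \<mu>" u]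
      by (auto simp: u_def v_def A_R scaleR_diff_right mult.commute)
    have "\<mu> *\<^sub>R (u + v) - A (u + v) = y"
      unfolding A_add[OF uv] Auv by (simp add: algebra_simps)
    then have "R \<mu> y = u + v"
      using that uv D by (intro R_eqI subspace_add) auto
    then show ?thesis by (simp add: u_def v_def)
  qed
  have "(\<nu> - \<mu>) *\<^sub>R R \<mu> (R \<nu> y) = (\<nu> - \<mu>) *\<^sub>R R \<nu> (R \<mu> y)"
    using res[OF m n] res[OF n m] by (metis minus_diff_eq scaleR_minus_left)
  then show ?thesis by (cases "\<mu> = \<nu>") auto
qed

text \<open>A vector orthogonal to \<open>D\<close> has the form \<open>P z\<close> by Lax-Milgram,
  and \<open>z = \<mu>0 x - A x\<close> for some \<open>x\<close> in \<open>D\<close> by the range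
  condition. Testing orthogonality with this same \<open>x\<close> forces \<open>q x\<close> to
  vanish.\<close>

lemma D_dense: "closure D = UNIV"
proof (rule ccontr)
  assume "closure D \<noteq> UNIV"
  then obtain w where w: "w \<noteq> 0" "\<And>y. y \<in> closure D \<Longrightarrow> inner w y = 0"
    using closed_subspace_orthogonal[of "closure D"] D by (auto simp: subspace_closure closed_closure)
  have "\<exists>z. P z = w"
    using \<epsilon> by (intro lax_milgram[of P "\<epsilon>\<^sup>2"] P P_coercive) auto
  then obtain z where z: "P z = w" by blast
  obtain x where x: "x \<in> D" "\<mu>0 *\<^sub>R x - A x = z" using range0 by blast
  have "0 = inner x (P z)" using w(2)[of x] x(1) closure_subset z by (auto simp: inner_commute)
  also have "\<dots> = \<mu>0 * q x - inner x (P (A x))"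
    by (simp add: q_def P.diff P.scale inner_diff flip: x(2))
  finally have "\<mu>0 * q x \<le> 0" using diss[OF x(1)] by linarith
  then have "x = 0" using \<mu>0 by (intro q_eq_0) (simp add: mult_le_0_iff)
  then have "z = 0" using x A_scale[of x 0] by simp
  then show False using w(1) z by (simp add: P.zero)
qed

lemma D_approx:
  assumes "0 < e" obtains z where "z \<in> D" "norm (y - z) < e"
proof -
  have "y \<in> closure D" by (simp add: D_dense)
  then show ?thesis using that assms by (auto simp: closure_approachable dist_norm norm_minus_commute)
qed

section \<open>Yosida approximations and their exponentials\<close>

definition \<nu> :: "nat \<Rightarrow> real" where "\<nu> n = \<mu>0 + real n"

lemma \<nu>: "0 < \<nu> n" "regular (\<nu> n)"
  using \<mu>0 by (auto simp: \<nu>_def regular_ge)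

lemma inverse_\<nu>_tendsto: "(\<lambda>n. c / \<nu> n) \<longlonglongrightarrow> 0"
  unfolding \<nu>_def
  by (intro tendsto_divide_0[OF tendsto_const] filterlim_at_top_imp_at_infinity
      filterlim_tendsto_add_at_top[OF tendsto_const] filterlim_real_sequentially)

definition J :: "nat \<Rightarrow> 'a \<Rightarrow> 'a" where "J n x = \<nu> n *\<^sub>R R (\<nu> n) x"

text \<open>The Yosida approximation: bounded, equal to \<open>A\<close> after \<open>J n\<close>
  everywhere and to \<open>J n\<close> after \<open>A\<close> on \<open>D\<close>.\<close>

definition Y :: "nat \<Rightarrow> 'a \<Rightarrow> 'a" where "Y n x = \<nu> n *\<^sub>R (J n x - x)"

lemma bounded_linear_J: "bounded_linear (J n)"
  unfolding J_def by (intro bounded_linear_const_scaleR bounded_linear_R \<nu>)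

lemma bounded_linear_Y: "bounded_linear (Y n)"
  unfolding Y_def by (intro bounded_linear_const_scaleR bounded_linear_sub bounded_linear_J
      bounded_linear_ident)

lemma norm_J: "norm (J n x) \<le> M * norm x"
  using norm_R[OF \<nu>(2), of n x] \<nu>(1)[of n] by (simp add: J_def field_simps)

lemma J_in_D: "J n x \<in> D"
  unfolding J_def using D by (intro subspace_scale R_props \<nu>)

lemma A_J: "A (J n x) = Y n x"
  unfolding J_def Y_def using \<nu>[of n] by (simp add: A_scale R_props(1) A_R)

lemma J_A: "x \<in> D \<Longrightarrow> J n (A x) = Y n x"
proof -
  assume x: "x \<in> D"
  interpret R: bounded_linear "R (\<nu> n)" by (intro bounded_linear_R \<nu>)
  have "R (\<nu> n) (\<nu> n *\<^sub>R x - A x) = x" using x by (intro R_eqI \<nu>) auto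
  then have "R (\<nu> n) (A x) = J n x - x" by (simp add: J_def R.diff R.scale algebra_simps)
  then show ?thesis by (simp add: J_def Y_def)
qed

text \<open>For \<open>z\<close> in \<open>D\<close> the error \<open>J n z - z\<close> is
  \<open>R (\<nu> n) (A z)\<close>, of order \<open>1 / \<nu> n\<close>. The uniform bound on
  \<open>J n\<close> extends this from \<open>D\<close> to its closure; replacing \<open>x\<close>
  by \<open>z\<close> costs \<open>M\<close> once through \<open>J n\<close> and 1 once directly,
  hence the factor \<open>M + 1\<close>.\<close>

lemma J_tendsto: "(\<lambda>n. J n x) \<longlonglongrightarrow> x"
proof (rule tendstoI)
  fix e :: real assume "0 < e"
  then obtain z where z: "z \<in> D" "norm (x - z) < e / (2 * (M + 1))"
    using D_approx[of "e / (2 * (M + 1))"] M_nonneg by (auto simp: field_simps)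
  have "(\<lambda>n. M * norm (A z) / \<nu> n) \<longlonglongrightarrow> 0" by (rule inverse_\<nu>_tendsto)
  then have "\<forall>\<^sub>F n in sequentially. M * norm (A z) / \<nu> n < e / 2"
    by (rule order_tendstoD) (use \<open>0 < e\<close> in simp)
  then show "\<forall>\<^sub>F n in sequentially. dist (J n x) x < e"
  proof eventually_elim
    case (elim n)
    interpret J: bounded_linear "J n" by (rule bounded_linear_J)
    have "J n z - z = R (\<nu> n) (A z)"
      using J_A[OF z(1), of n] \<nu>(1)[of n] by (simp add: J_def Y_def)
    then have "norm (J n z - z) \<le> M * norm (A z) / \<nu> n"
      using norm_R[OF \<nu>(2), of n "A z"] by simp
    moreover have "J n x - x = J n (x - z) + (J n z - z) - (x - z)" by (simp add: J.diff)
    then have "norm (J n x - x) \<le> norm (J n (x - z)) + norm (J n z - z) + norm (x - z)"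
      by (simp only: norm_add_diff_le)
    moreover have "norm (J n (x - z)) \<le> M * norm (x - z)" by (rule norm_J)
    moreover have "(M + 1) * norm (x - z) < e / 2"
      using z(2) M_nonneg by (simp add: field_simps)
    ultimately show ?case using elim by (simp add: dist_norm algebra_simps)
  qed
qed

lemma Y_tendsto: "x \<in> D \<Longrightarrow> (\<lambda>n. Y n x) \<longlonglongrightarrow> A x"
  using J_tendsto[of "A x"] by (simp add: J_A)

text \<open>Replacing the left argument \<open>x\<close> by
  \<open>J n x - (1 / \<nu> n) Y n x\<close> leaves the pairing for \<open>A\<close> at the point
  \<open>J n x\<close> of \<open>D\<close>, and subtracts a nonnegative multiple of
  \<open>q (Y n x)\<close>.\<close>

lemma Y_diss: "inner x (P (Y n x)) \<le> 0"
proof -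
  have "inner (J n x) (P (Y n x)) \<le> 0" using diss[OF J_in_D] by (simp add: A_J)
  moreover have "x = J n x - (1 / \<nu> n) *\<^sub>R Y n x" using \<nu>(1)[of n] by (simp add: Y_def)
  then have "inner x (P (Y n x)) = inner (J n x) (P (Y n x)) - (1 / \<nu> n) * q (Y n x)"
    by (metis inner_diff_left inner_scaleR_left q_def)
  moreover have "0 \<le> (1 / \<nu> n) * q (Y n x)"
    using q_nonneg[of "Y n x"] \<nu>(1)[of n] by simp
  ultimately show ?thesis by linarith
qed

text \<open>The copy of \<open>Y n\<close> in the Banach algebra of endomorphisms, where
  \<open>exp\<close> is available.\<close>

definition G :: "nat \<Rightarrow> 'a endo" where "G n = (SOME G. app G = Y n)"

lemma app_G: "app (G n) = Y n"
  unfolding G_def by (rule someI_ex) (use bounded_linear_endo[OF bounded_linear_Y] in metis)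

lemma G_commute: "G m * G n = G n * G m"
proof (rule endo_eqI)
  fix x
  interpret Rm: bounded_linear "R (\<nu> m)" by (intro bounded_linear_R \<nu>)
  interpret Rn: bounded_linear "R (\<nu> n)" by (intro bounded_linear_R \<nu>)
  show "app (G m * G n) x = app (G n * G m) x"
    by (simp add: app_mult app_G Y_def J_def Rm.diff Rn.diff Rm.scale Rn.scale
        R_commute[OF \<nu>(2) \<nu>(2), of m n] algebra_simps)
qed

definition U :: "nat \<Rightarrow> real \<Rightarrow> 'a \<Rightarrow> 'a" where "U n t x = app (exp (t *\<^sub>R G n)) x"

sublocale U: bounded_linear "U n t" for n t
  unfolding U_def by (rule bounded_linear_app)

lemma U_0: "U n 0 x = x"
  by (simp add: U_def app_one)

lemma U_add: "U n (s + t) x = U n s (U n t x)"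
  by (simp add: U_def app_exp_add)

lemma Y_U: "Y n (U n t x) = U n t (Y n x)"
  unfolding U_def app_G[symmetric] app_mult[symmetric] by (simp add: exp_times_scaleR_commute)

lemma U_derivative: "((\<lambda>t. U n t x) has_vector_derivative U n t (Y n x)) (at t within T)"
  using app_exp_derivative[of "G n"] by (simp add: U_def app_G)

text \<open>The derivative of \<open>q\<close> along an orbit is twice the pairing in
  \<open>Y_diss\<close>. The resulting bound is uniform in \<open>n\<close>, although the norms of
  the operators \<open>Y n\<close> may grow with \<open>n\<close>.\<close>

lemma q_U:
  assumes "0 \<le> t" shows "q (U n t x) \<le> q x"
proof -
  have "((\<lambda>t. q (U n t x)) has_real_derivative 2 * inner (U n t x) (P (Y n (U n t x)))) (at t)" for t
  proof -
    have d: "((\<lambda>t. U n t x) has_vector_derivative U n t (Y n x)) (at t)" by (rule U_derivative)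
    show ?thesis
      using bounded_bilinear.has_vector_derivative[OF bounded_bilinear_inner d
          bounded_linear.has_vector_derivative[OF P d]] P_sym[of "Y n (U n t x)" "U n t x"]
      by (simp add: q_def has_real_derivative_iff_has_vector_derivative Y_U inner_commute)
  qed
  moreover have "2 * inner (U n s x) (P (Y n (U n s x))) \<le> 0" for s
    using Y_diss[of "U n s x" n] by simp
  ultimately have "q (U n t x) \<le> q (U n 0 x)"
    using assms by (intro DERIV_nonpos_imp_nonincreasing[of 0 t "\<lambda>t. q (U n t x)"]) blast+
  then show ?thesis by (simp add: U_0)
qed

lemma norm_U: "0 \<le> t \<Longrightarrow> norm (U n t x) \<le> M * norm x"
  by (intro norm_le_if_q_le q_U)

lemma U_diff:
  "0 \<le> t \<Longrightarrow> norm (U m t x - U n t x) \<le> t * (M * (M * norm (Y m x - Y n x)))"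
  using exp_diff_bound[OF G_commute[of m n], where t = t and M = M and x = x] norm_U M_nonneg by (simp add: U_def app_G)

text \<open>Mean value inequality for \<open>U n s x - s y\<close>. With \<open>y = 0\<close> it
  yields Lipschitz continuity of orbits starting in \<open>D\<close>, with \<open>y = A x\<close>
  their derivative at 0; both estimates survive the limit in \<open>n\<close>.\<close>

lemma U_taylor:
  assumes t: "0 \<le> t" and c: "\<And>s. 0 \<le> s \<Longrightarrow> s \<le> t \<Longrightarrow> norm (U n s (Y n x) - y) \<le> c"
  shows "norm (U n t x - x - t *\<^sub>R y) \<le> c * t"
proof (cases "t = 0")
  case False
  define f where "f s = U n s x - s *\<^sub>R y" for s
  have der: "(f has_vector_derivative U n s (Y n x) - y) (at s within T)" for s T
    unfolding f_def by (auto intro!: derivative_eq_intros U_derivative)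
  have "norm (f t - f 0) \<le> (\<lambda>s. c * s) t - (\<lambda>s. c * s) 0"
    using t False c
    by (intro differentiable_bound_general[where f' = "\<lambda>s. U n s (Y n x) - y" and \<phi>' = "\<lambda>_. c"])
      (auto intro!: continuous_intros der derivative_eq_intros continuous_on_vector_derivative)
  then show ?thesis by (simp add: f_def U_0 algebra_simps)
qed (simp add: U_0)

section \<open>The limit semigroup and its generator\<close>

definition S :: "real \<Rightarrow> 'a \<Rightarrow> 'a" where "S t x = lim (\<lambda>n. U n t x)"

text \<open>For \<open>z\<close> in \<open>D\<close> the sequence \<open>Y n z\<close> converges, so
  \<open>U_diff\<close> makes the orbits of \<open>z\<close> Cauchy. A general \<open>x\<close> is
  replaced by a nearby \<open>z\<close>, at a cost that \<open>M\<close> controls uniformly in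
  \<open>n\<close>.\<close>

lemma U_tendsto:
  assumes t: "0 \<le> t" shows "(\<lambda>n. U n t x) \<longlonglongrightarrow> S t x"
proof -
  have "Cauchy (\<lambda>n. U n t x)"
  proof (rule metric_CauchyI)
    fix e :: real assume "0 < e"
    then obtain z where z: "z \<in> D" "norm (x - z) < e / (4 * (M + 1))"
      using D_approx[of "e / (4 * (M + 1))"] M_nonneg by (auto simp: field_simps)
    have "M * norm (x - z) \<le> (M + 1) * norm (x - z)" by (simp add: algebra_simps)
    also have "\<dots> < e / 4" using z(2) M_nonneg by (simp add: field_simps)
    finally have xz: "M * norm (x - z) < e / 4" .
    \<comment> \<open>The summand 1 makes \<open>C\<close> positive even for \<open>t = 0\<close>,
      so that one may divide by it.\<close>
    define C where "C = t * (M * M) + 1"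
    have C: "0 < C" using t M_nonneg by (simp add: C_def add_nonneg_pos)
    have "Cauchy (\<lambda>n. Y n z)" using Y_tendsto[OF z(1)] by (rule LIMSEQ_imp_Cauchy)
    then obtain N where N: "\<And>m n. m \<ge> N \<Longrightarrow> n \<ge> N \<Longrightarrow> norm (Y m z - Y n z) < e / (2 * C)"
      using metric_CauchyD[of "\<lambda>n. Y n z" "e / (2 * C)"] \<open>0 < e\<close> C by (auto simp: dist_norm)
    have "dist (U m t x) (U n t x) < e" if "m \<ge> N" "n \<ge> N" for m n
    proof -
      have "norm (U m t z - U n t z) \<le> t * (M * (M * norm (Y m z - Y n z)))" by (rule U_diff[OF t])
      also have "\<dots> \<le> C * norm (Y m z - Y n z)" by (simp add: C_def algebra_simps)
      also have "\<dots> < e / 2" using N[OF that] C by (simp add: field_simps)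
      finally have "norm (U m t z - U n t z) < e / 2" .
      moreover have "U m t x - U n t x = U m t (x - z) + (U m t z - U n t z) - U n t (x - z)"
        by (simp add: U.diff)
      then have "norm (U m t x - U n t x) \<le> norm (U m t (x - z)) + norm (U m t z - U n t z) + norm (U n t (x - z))"
        by (simp only: norm_add_diff_le)
      moreover have "norm (U m t (x - z)) < e / 4" "norm (U n t (x - z)) < e / 4"
        using norm_U[OF t, of _ "x - z"] xz by (meson le_less_trans)+
      ultimately show ?thesis by (simp add: dist_norm)
    qed
    then show "\<exists>N. \<forall>m\<ge>N. \<forall>n\<ge>N. dist (U m t x) (U n t x) < e" by blast
  qed
  then show ?thesis unfolding S_def by (simp add: Cauchy_convergent convergent_LIMSEQ_iff[symmetric])
qed

lemma norm_S: "0 \<le> t \<Longrightarrow> norm (S t x) \<le> M * norm x"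
  by (rule tendsto_upperbound[OF tendsto_norm[OF U_tendsto]]) (auto simp: norm_U)

lemma q_S:
  assumes "0 \<le> t" shows "q (S t x) \<le> q x"
proof -
  have "(\<lambda>n. q (U n t x)) \<longlonglongrightarrow> q (S t x)"
    unfolding q_def by (intro tendsto_inner U_tendsto assms P.tendsto)
  then show ?thesis by (rule tendsto_upperbound) (auto simp: q_U assms)
qed

lemma bounded_linear_S:
  assumes t: "0 \<le> t" shows "bounded_linear (S t)"
proof (rule bounded_linear_intro[of _ M])
  fix x y c
  show "S t (x + y) = S t x + S t y"
    using tendsto_add[OF U_tendsto[OF t, of x] U_tendsto[OF t, of y]] U_tendsto[OF t, of "x + y"]
    by (simp add: U.add LIMSEQ_unique)
  show "S t (c *\<^sub>R x) = c *\<^sub>R S t x"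
    using tendsto_scaleR[OF tendsto_const U_tendsto[OF t, of x]] U_tendsto[OF t, of "c *\<^sub>R x"]
    by (simp add: U.scale LIMSEQ_unique)
  show "norm (S t x) \<le> norm x * M" using norm_S[OF t, of x] by (simp add: mult.commute)
qed

lemma S_0: "S 0 x = x"
  using U_tendsto[of 0 x] by (simp add: U_0 LIMSEQ_const_iff)

text \<open>In \<open>U n t (U n r x)\<close> the inner argument varies with \<open>n\<close> as
  well; the uniform bound on \<open>U n t\<close> absorbs its distance from
  \<open>S r x\<close>.\<close>

lemma S_add:
  assumes t: "0 \<le> t" and r: "0 \<le> r" shows "S (t + r) x = S t (S r x)"
proof (rule LIMSEQ_unique)
  show "(\<lambda>n. U n (t + r) x) \<longlonglongrightarrow> S (t + r) x" using assms by (intro U_tendsto) auto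
  have "(\<lambda>n. M * norm (U n r x - S r x)) \<longlonglongrightarrow> M * norm (S r x - S r x)"
    by (intro tendsto_intros U_tendsto r)
  then have g: "(\<lambda>n. M * norm (U n r x - S r x)) \<longlonglongrightarrow> 0" by simp
  have "(\<lambda>n. U n t (U n r x - S r x)) \<longlonglongrightarrow> 0"
    by (rule Lim_null_comparison[OF _ g]) (auto simp: norm_U[OF t])
  from tendsto_add[OF this U_tendsto[OF t, of "S r x"]]
  show "(\<lambda>n. U n (t + r) x) \<longlonglongrightarrow> S t (S r x)" by (simp add: U_add U.diff)
qed

lemma S_lipschitz:
  assumes "x \<in> D" "0 \<le> t" shows "norm (S t x - x) \<le> M * norm (A x) * t"
proof (rule LIMSEQ_le)
  show "(\<lambda>n. norm (U n t x - x - t *\<^sub>R 0)) \<longlonglongrightarrow> norm (S t x - x)"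
    by (auto intro!: tendsto_intros U_tendsto assms)
  show "(\<lambda>n. M * norm (Y n x) * t) \<longlonglongrightarrow> M * norm (A x) * t"
    by (intro tendsto_intros Y_tendsto assms)
  show "\<exists>N. \<forall>n\<ge>N. norm (U n t x - x - t *\<^sub>R 0) \<le> M * norm (Y n x) * t"
    using U_taylor[OF assms(2), of _ x 0] norm_U by auto
qed

text \<open>\<open>A x\<close> need not lie in \<open>D\<close>, so its orbit need not be Lipschitz.
  An element \<open>z\<close> of \<open>D\<close> takes its place: the error is then small relative
  to \<open>t\<close> by the choice of \<open>z\<close>, up to a term of order
  \<open>t^2\<close>.\<close>

lemma S_taylor:
  assumes x: "x \<in> D" and z: "z \<in> D" and t: "0 \<le> t"
  shows "norm (S t x - x - t *\<^sub>R A x) \<le> ((M + 1) * norm (A x - z) + t * (M * norm (A z))) * t"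
proof (rule LIMSEQ_le)
  show "(\<lambda>n. norm (U n t x - x - t *\<^sub>R A x)) \<longlonglongrightarrow> norm (S t x - x - t *\<^sub>R A x)"
    by (intro tendsto_intros U_tendsto t)
  show "(\<lambda>n. (M * norm (Y n x - A x) + (M + 1) * norm (A x - z) + t * (M * norm (Y n z))) * t)
      \<longlonglongrightarrow> ((M + 1) * norm (A x - z) + t * (M * norm (A z))) * t"
    by (rule tendsto_eq_intros Y_tendsto x z refl)+ simp
  have "norm (U n s (Y n x) - A x) \<le> M * norm (Y n x - A x) + (M + 1) * norm (A x - z) + t * (M * norm (Y n z))"
    if s: "0 \<le> s" "s \<le> t" for n s
  proof -
    have "norm (U n s z - z - s *\<^sub>R 0) \<le> M * norm (Y n z) * s"
      using norm_U s by (intro U_taylor) auto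
    also have "\<dots> \<le> M * norm (Y n z) * t" using s M_nonneg by (intro mult_left_mono) auto
    finally have 1: "norm (U n s z - z) \<le> t * (M * norm (Y n z))" by (simp add: mult_ac)
    have 2: "norm (U n s (Y n x - A x)) \<le> M * norm (Y n x - A x)"
      "norm (U n s (A x - z)) \<le> M * norm (A x - z)" using s by (auto intro: norm_U)
    have "U n s (Y n x) - A x = (U n s (Y n x - A x) + U n s (A x - z)) + (U n s z - z) - (A x - z)"
      by (simp add: U.diff)
    then have "norm (U n s (Y n x) - A x)
      \<le> norm (U n s (Y n x - A x)) + norm (U n s (A x - z)) + norm (U n s z - z) + norm (A x - z)"
      using norm_add_diff_le[of "U n s (Y n x - A x) + U n s (A x - z)" "U n s z - z" "A x - z"]
        norm_triangle_ineq[of "U n s (Y n x - A x)" "U n s (A x - z)"] by (simp only:)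
    with 1 2 show ?thesis by (simp add: distrib_right)
  qed
  then show "\<exists>N. \<forall>n\<ge>N. norm (U n t x - x - t *\<^sub>R A x)
      \<le> (M * norm (Y n x - A x) + (M + 1) * norm (A x - z) + t * (M * norm (Y n z))) * t"
    using U_taylor[OF t] by blast
qed

lemma S_generator:
  assumes x: "x \<in> D"
  shows "((\<lambda>t. (1 / t) *\<^sub>R (S t x - x)) \<longlongrightarrow> A x) (at_right 0)"
proof (rule tendstoI)
  fix e :: real assume "0 < e"
  then obtain z where z: "z \<in> D" "norm (A x - z) < e / (2 * (M + 1))"
    using D_approx[of "e / (2 * (M + 1))"] M_nonneg by (auto simp: field_simps)
  have 1: "(M + 1) * norm (A x - z) < e / 2" using z(2) M_nonneg by (simp add: field_simps)
  have "((\<lambda>t. t * (M * norm (A z))) \<longlongrightarrow> 0 * (M * norm (A z))) (at_right 0)"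
    by (intro tendsto_intros)
  then have "\<forall>\<^sub>F t in at_right 0. t * (M * norm (A z)) < e / 2"
    by (rule order_tendstoD) (use \<open>0 < e\<close> in simp)
  then show "\<forall>\<^sub>F t in at_right 0. dist ((1 / t) *\<^sub>R (S t x - x)) (A x) < e"
    using eventually_at_right_less[of "0::real"]
  proof eventually_elim
    case (elim t)
    have "(1 / t) *\<^sub>R (S t x - x) - A x = (1 / t) *\<^sub>R (S t x - x - t *\<^sub>R A x)"
      using elim by (simp add: algebra_simps)
    then have "norm ((1 / t) *\<^sub>R (S t x - x) - A x) = norm (S t x - x - t *\<^sub>R A x) / t"
      using elim by simp
    also have "\<dots> \<le> (M + 1) * norm (A x - z) + t * (M * norm (A z))"
      using S_taylor[OF x z(1), of t] elim by (simp add: divide_le_eq)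
    finally show ?case using elim 1 by (simp add: dist_norm)
  qed
qed

lemma S_continuous: "((\<lambda>t. S t x) \<longlongrightarrow> x) (at_right 0)"
proof (rule tendstoI)
  fix e :: real assume "0 < e"
  then obtain z where z: "z \<in> D" "norm (x - z) < e / (2 * (M + 1))"
    using D_approx[of "e / (2 * (M + 1))"] M_nonneg by (auto simp: field_simps)
  have 1: "(M + 1) * norm (x - z) < e / 2" using z(2) M_nonneg by (simp add: field_simps)
  have "((\<lambda>t. M * norm (A z) * t) \<longlongrightarrow> M * norm (A z) * 0) (at_right 0)"
    by (intro tendsto_intros)
  then have "\<forall>\<^sub>F t in at_right 0. M * norm (A z) * t < e / 2"
    by (rule order_tendstoD) (use \<open>0 < e\<close> in simp)
  then show "\<forall>\<^sub>F t in at_right 0. dist (S t x) x < e"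
    using eventually_at_right_less[of "0::real"]
  proof eventually_elim
    case (elim t)
    then interpret St: bounded_linear "S t" by (intro bounded_linear_S) auto
    have "S t x - x = S t (x - z) + (S t z - z) - (x - z)" by (simp add: St.diff)
    then have "norm (S t x - x) \<le> norm (S t (x - z)) + norm (S t z - z) + norm (x - z)"
      by (simp only: norm_add_diff_le)
    moreover have "norm (S t (x - z)) \<le> M * norm (x - z)" using elim by (intro norm_S) auto
    moreover have "norm (S t z - z) \<le> M * norm (A z) * t" using elim z by (intro S_lipschitz) auto
    ultimately show ?case using elim 1 by (simp add: dist_norm algebra_simps)
  qed
qed

text \<open>Compare \<open>x\<close> with the solution \<open>x'\<close> in \<open>D\<close> of
  \<open>\<mu>0 x' - A x' = \<mu>0 x - y\<close>. The difference \<open>w\<close> has derivative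
  \<open>\<mu>0 w\<close> at time 0, that is, it would grow at a positive rate; since
  \<open>S\<close> contracts \<open>q\<close>, it must be zero.\<close>

lemma S_generator_domain:
  assumes lim: "((\<lambda>t. (1 / t) *\<^sub>R (S t x - x)) \<longlongrightarrow> y) (at_right 0)"
  shows "x \<in> D"
proof -
  obtain x' where x': "x' \<in> D" "\<mu>0 *\<^sub>R x' - A x' = \<mu>0 *\<^sub>R x - y" using range0 by blast
  define w where "w = x - x'"
  have yA: "y - A x' = \<mu>0 *\<^sub>R w" using x'(2) by (simp add: w_def algebra_simps)
  have "((\<lambda>t. (1 / t) *\<^sub>R (S t x - x) - (1 / t) *\<^sub>R (S t x' - x')) \<longlongrightarrow> \<mu>0 *\<^sub>R w) (at_right 0)"
    unfolding yA[symmetric] by (intro tendsto_diff lim S_generator x')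
  moreover have "\<forall>\<^sub>F t in at_right 0. (1 / t) *\<^sub>R (S t x - x) - (1 / t) *\<^sub>R (S t x' - x') = (1 / t) *\<^sub>R (S t w - w)"
    using eventually_at_right_less[of "0::real"]
  proof eventually_elim
    case (elim t)
    then interpret St: bounded_linear "S t" by (intro bounded_linear_S) auto
    show ?case by (simp add: w_def St.diff algebra_simps)
  qed
  ultimately have "((\<lambda>t. (1 / t) *\<^sub>R (S t w - w)) \<longlongrightarrow> \<mu>0 *\<^sub>R w) (at_right 0)"
    by (rule Lim_transform_eventually)
  then have "((\<lambda>t. inner w (P ((1 / t) *\<^sub>R (S t w - w)))) \<longlongrightarrow> inner w (P (\<mu>0 *\<^sub>R w))) (at_right 0)"
    by (rule tendsto_inner[OF tendsto_const P.tendsto])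
  moreover have "\<forall>\<^sub>F t in at_right 0. inner w (P ((1 / t) *\<^sub>R (S t w - w))) \<le> 0"
    using eventually_at_right_less[of "0::real"]
  proof eventually_elim
    case (elim t)
    have "(inner w (P (S t w)))\<^sup>2 \<le> q w * q (S t w)" by (rule q_cauchy_schwarz)
    also have "\<dots> \<le> q w * q w" using elim by (intro mult_left_mono q_S q_nonneg) auto
    finally have "inner w (P (S t w)) \<le> q w"
      using q_nonneg[of w] by (simp add: abs_le_square_iff[symmetric] flip: power2_eq_square)
    then show ?case using elim
      by (simp add: P.scale P.diff inner_diff_right q_def divide_nonpos_pos)
  qed
  ultimately have "inner w (P (\<mu>0 *\<^sub>R w)) \<le> 0"
    by (intro tendsto_upperbound[where F = "at_right (0::real)"]) (auto simp: trivial_limit_at_right_real)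
  then have "\<mu>0 * q w \<le> 0" by (simp add: P.scale q_def)
  then have "w = 0" using \<mu>0 by (intro q_eq_0) (simp add: mult_le_0_iff)
  then show ?thesis using x'(1) by (simp add: w_def)
qed

end

text \<open>Product rule at 0. It serves with \<open>\<omega>\<close> to pass from the shifted
  operator to \<open>A\<close>, and with \<open>- \<omega>\<close> for the way back when the domain
  is determined.\<close>

lemma rescaled_difference_quotient:
  fixes S :: "real \<Rightarrow> 'a::real_normed_vector"
  assumes "((\<lambda>t. (1 / t) *\<^sub>R (S t - x)) \<longlongrightarrow> y) (at_right 0)"
  shows "((\<lambda>t. (1 / t) *\<^sub>R (exp (\<omega> * t) *\<^sub>R S t - x)) \<longlongrightarrow> y + \<omega> *\<^sub>R x) (at_right 0)"
proof -
  have "((\<lambda>t. exp (\<omega> * t)) has_real_derivative \<omega>) (at 0)"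
    by (auto intro!: derivative_eq_intros)
  then have "((\<lambda>t. (exp (\<omega> * t) - 1) / t) \<longlongrightarrow> \<omega>) (at_right 0)"
    by (auto simp: has_field_derivative_iff intro: tendsto_within_subset)
  moreover have "((\<lambda>t. exp (\<omega> * t)) \<longlongrightarrow> exp (\<omega> * 0)) (at_right 0)"
    by (intro tendsto_intros)
  ultimately have "((\<lambda>t. exp (\<omega> * t) *\<^sub>R ((1 / t) *\<^sub>R (S t - x)) + ((exp (\<omega> * t) - 1) / t) *\<^sub>R x)
      \<longlongrightarrow> exp (\<omega> * 0) *\<^sub>R y + \<omega> *\<^sub>R x) (at_right 0)"
    by (intro tendsto_intros assms)
  then show ?thesis
    by (simp add: algebra_simps diff_divide_distrib) 
qed

theorem lumer_phillips:
  fixes P A :: "'a::{real_inner,banach,perfect_space} \<Rightarrow> 'a"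
  assumes P: "bounded_linear P" "\<And>x y. inner x (P y) = inner (P x) y"
    and \<epsilon>: "\<epsilon> > 0" "\<And>x. \<epsilon>\<^sup>2 * (norm x)\<^sup>2 \<le> inner x (P x)"
    and D: "subspace D"
    and A_add: "\<And>x y. x \<in> D \<Longrightarrow> y \<in> D \<Longrightarrow> A (x + y) = A x + A y"
    and A_scale: "\<And>c x. x \<in> D \<Longrightarrow> A (c *\<^sub>R x) = c *\<^sub>R A x"
    and diss: "\<And>x. x \<in> D \<Longrightarrow> inner x (P (A x)) \<le> \<omega> * inner x (P x)"
    and "\<omega> < l" "\<And>y. \<exists>x\<in>D. l *\<^sub>R x - A x = y"
  obtains S where "\<And>t. 0 \<le> t \<Longrightarrow> bounded_linear (S t)"
    "\<And>x. S 0 x = x" "\<And>t r x. 0 \<le> t \<Longrightarrow> 0 \<le> r \<Longrightarrow> S (t + r) x = S t (S r x)"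
    "\<And>x. ((\<lambda>t. S t x) \<longlongrightarrow> x) (at_right 0)"
    "\<And>x. x \<in> D \<Longrightarrow> ((\<lambda>t. (1 / t) *\<^sub>R (S t x - x)) \<longlongrightarrow> A x) (at_right 0)"
    "\<And>x y. ((\<lambda>t. (1 / t) *\<^sub>R (S t x - x)) \<longlongrightarrow> y) (at_right 0) \<Longrightarrow> x \<in> D"
    "\<And>t x. 0 \<le> t \<Longrightarrow> norm (S t x) \<le> sqrt (onorm P) / \<epsilon> * exp (\<omega> * t) * norm x"
proof -
  interpret P: bounded_linear P by fact
  \<comment> \<open>Subtracting \<open>\<omega>\<close> makes the operator dissipative and moves the
    point of full range to \<open>l - \<omega>\<close>, which is positive; the factor
    \<open>exp (\<omega> t)\<close> undoes the shift afterwards.\<close>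
  interpret d: dissipative P \<epsilon> D "\<lambda>x. A x - \<omega> *\<^sub>R x" "l - \<omega>"
  proof
    fix x assume "x \<in> D"
    then show "inner x (P (A x - \<omega> *\<^sub>R x)) \<le> 0"
      using diss[of x] by (simp add: P.diff P.scale inner_diff)
  next
    fix y obtain x where "x \<in> D" "l *\<^sub>R x - A x = y" using assms by blast
    then show "\<exists>x\<in>D. (l - \<omega>) *\<^sub>R x - (A x - \<omega> *\<^sub>R x) = y"
      by (intro bexI[of _ x]) (auto simp: algebra_simps)
  qed (use assms in \<open>auto simp: algebra_simps\<close>)
  define S where "S t x = exp (\<omega> * t) *\<^sub>R d.S t x" for t x
  show thesis
  proof
    show "bounded_linear (S t)" if "0 \<le> t" for t
      unfolding S_def by (intro bounded_linear_const_scaleR d.bounded_linear_S that)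
    show "S 0 x = x" for x by (simp add: S_def d.S_0)
    show "S (t + r) x = S t (S r x)" if "0 \<le> t" "0 \<le> r" for t r x
      using linear_scale[OF bounded_linear.linear[OF d.bounded_linear_S[OF that(1)]]]
      by (simp add: S_def d.S_add[OF that] exp_add distrib_left)
    have "((\<lambda>t. S t x) \<longlongrightarrow> exp (\<omega> * 0) *\<^sub>R x) (at_right 0)" for x
      unfolding S_def by (intro tendsto_intros d.S_continuous)
    then show "((\<lambda>t. S t x) \<longlongrightarrow> x) (at_right 0)" for x by simp
    show "((\<lambda>t. (1 / t) *\<^sub>R (S t x - x)) \<longlongrightarrow> A x) (at_right 0)" if "x \<in> D" for x
      using rescaled_difference_quotient[OF d.S_generator[OF that], of \<omega>] by (simp add: S_def)
    show "x \<in> D" if "((\<lambda>t. (1 / t) *\<^sub>R (S t x - x)) \<longlongrightarrow> y) (at_right 0)" for x y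
      using rescaled_difference_quotient[OF that, of "- \<omega>"]
      by (intro d.S_generator_domain[of _ "y - \<omega> *\<^sub>R x"]) (simp add: S_def exp_minus)
    show "norm (S t x) \<le> sqrt (onorm P) / \<epsilon> * exp (\<omega> * t) * norm x" if "0 \<le> t" for t x
      using mult_left_mono[OF d.norm_S[OF that, of x], of "exp (\<omega> * t)"]
      by (simp add: S_def d.M_def mult_ac)
  qed
qed

section \<open>The Hilbert space of square-integrable functions\<close>

lemma L2_D:
  assumes "u \<in> L2 a b"
  shows "u \<in> borel_measurable (lebesgue_on {a..b})"
    "integrable (lebesgue_on {a..b}) (\<lambda>s. (norm (u s))\<^sup>2)"
  using assms by (auto simp: L2_def)

lemma L2_inner_integrable:
  assumes "u \<in> L2 a b" "v \<in> L2 a b"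
  shows "integrable (lebesgue_on {a..b}) (\<lambda>s. u s \<bullet> v s)"
proof (rule Bochner_Integration.integrable_bound)
  show "integrable (lebesgue_on {a..b}) (\<lambda>s. (norm (u s))\<^sup>2 + (norm (v s))\<^sup>2)"
    using assms by (intro Bochner_Integration.integrable_add L2_D)
  show "(\<lambda>s. u s \<bullet> v s) \<in> borel_measurable (lebesgue_on {a..b})"
    using assms by (intro borel_measurable_inner L2_D)
  have "\<bar>u s \<bullet> v s\<bar> \<le> (norm (u s))\<^sup>2 + (norm (v s))\<^sup>2" for s
    using Cauchy_Schwarz_ineq2[of "u s" "v s"] sum_squares_bound[of "norm (u s)" "norm (v s)"]
      mult_nonneg_nonneg[OF norm_ge_zero[of "u s"] norm_ge_zero[of "v s"]] by linarith
  then show "AE s in lebesgue_on {a..b}. norm (u s \<bullet> v s) \<le> norm ((norm (u s))\<^sup>2 + (norm (v s))\<^sup>2)"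
    by auto
qed

lemma L2_integrable:
  assumes "u \<in> L2 a b" shows "integrable (lebesgue_on {a..b}) u"
proof (rule Bochner_Integration.integrable_bound)
  show "integrable (lebesgue_on {a..b}) (\<lambda>s. 1 + (norm (u s))\<^sup>2)"
    using assms by (intro Bochner_Integration.integrable_add L2_D) auto
  show "u \<in> borel_measurable (lebesgue_on {a..b})" using assms by (rule L2_D)
  have "norm (u s) \<le> 1 + (norm (u s))\<^sup>2" for s
    using sum_squares_bound[of 1 "norm (u s)"] norm_ge_zero[of "u s"] by (simp, linarith)
  then show "AE s in lebesgue_on {a..b}. norm (u s) \<le> norm (1 + (norm (u s))\<^sup>2)" by auto
qed

lemma L2_add:
  assumes "u \<in> L2 a b" "v \<in> L2 a b" shows "(\<lambda>s. u s + v s) \<in> L2 a b"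
proof -
  have "integrable (lebesgue_on {a..b}) (\<lambda>s. (norm (u s))\<^sup>2 + 2 * (u s \<bullet> v s) + (norm (v s))\<^sup>2)"
    using assms by (intro Bochner_Integration.integrable_add integrable_mult_right L2_D L2_inner_integrable)
  also have "(\<lambda>s. (norm (u s))\<^sup>2 + 2 * (u s \<bullet> v s) + (norm (v s))\<^sup>2) = (\<lambda>s. (norm (u s + v s))\<^sup>2)"
    by (simp add: power2_norm_eq_inner inner_add inner_commute fun_eq_iff)
  finally show ?thesis using assms by (auto simp: L2_def intro: borel_measurable_add)
qed

lemma L2_scale: "u \<in> L2 a b \<Longrightarrow> (\<lambda>s. c *\<^sub>R u s) \<in> L2 a b"
  by (auto simp: L2_def power_mult_distrib intro: borel_measurable_scaleR)

lemma L2_uminus: "u \<in> L2 a b \<Longrightarrow> (\<lambda>s. - u s) \<in> L2 a b"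
  using L2_scale[of u a b "-1"] by simp

lemma L2_diff: "u \<in> L2 a b \<Longrightarrow> v \<in> L2 a b \<Longrightarrow> (\<lambda>s. u s - v s) \<in> L2 a b"
  using L2_add[OF _ L2_uminus, of u a b v] by simp

lemma L2_const: "(\<lambda>s. c) \<in> L2 a b"
  by (auto simp: L2_def)

lemma L2_sum: "(\<And>i. i \<in> I \<Longrightarrow> u i \<in> L2 a b) \<Longrightarrow> (\<lambda>s. \<Sum>i\<in>I. u i s) \<in> L2 a b"
  by (induction I rule: infinite_finite_induct) (auto intro: L2_add L2_const)

lemma L2_inner_cong:
  assumes "u \<in> L2 a b" "u' \<in> L2 a b" "v \<in> L2 a b" "v' \<in> L2 a b" "L2_eq a b u u'" "L2_eq a b v v'"
  shows "L2_inner a b u v = L2_inner a b u' v'"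
  unfolding L2_inner_def
proof (rule integral_cong_AE)
  show "AE s in lebesgue_on {a..b}. u s \<bullet> v s = u' s \<bullet> v' s"
    using assms(5,6) unfolding L2_eq_def by eventually_elim simp
qed (use assms in \<open>auto intro: borel_measurable_inner L2_D\<close>)

lemma L2_inner_add_left:
  "u \<in> L2 a b \<Longrightarrow> v \<in> L2 a b \<Longrightarrow> w \<in> L2 a b \<Longrightarrow>
    L2_inner a b (\<lambda>s. u s + v s) w = L2_inner a b u w + L2_inner a b v w"
  by (simp add: L2_inner_def inner_add_left L2_inner_integrable)

lemma L2_inner_scale_left: "L2_inner a b (\<lambda>s. c *\<^sub>R u s) v = c * L2_inner a b u v"
  by (simp add: L2_inner_def)

lemma L2_inner_commute: "L2_inner a b u v = L2_inner a b v u"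
  by (simp add: L2_inner_def inner_commute)

lemma L2_inner_nonneg: "0 \<le> L2_inner a b u u"
  by (simp add: L2_inner_def)

lemma L2_inner_eq_0_iff:
  assumes "u \<in> L2 a b" shows "L2_inner a b u u = 0 \<longleftrightarrow> L2_eq a b u (\<lambda>_. 0)"
  unfolding L2_inner_def L2_eq_def
  using integral_nonneg_eq_0_iff_AE[OF L2_inner_integrable[OF assms assms]] by simp

lemma L2_norm_square: "(L2_norm a b u)\<^sup>2 = L2_inner a b u u"
  by (simp add: L2_norm_def L2_inner_nonneg)

lemma L2_norm_nonneg: "0 \<le> L2_norm a b u"
  by (simp add: L2_norm_def L2_inner_nonneg)

text \<open>Integrates the pointwise bound of \<open>r\<close> by \<open>c + r^2 / c\<close>. The
  parameter \<open>c\<close> stays free: completeness uses a \<open>c\<close> adapted to the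
  tolerance, \<open>L2_norm_ge_L1\<close> the norm itself, and together they stand in for
  Cauchy-Schwarz against the constant 1.\<close>

lemma L2_norm_L1_bound:
  assumes u: "u \<in> L2 a b" and "c > 0"
  shows "(LINT s|lebesgue_on {a..b}. norm (u s))
    \<le> c * measure lebesgue {a..b} + (L2_norm a b u)\<^sup>2 / c"
proof -
  have "(LINT s|lebesgue_on {a..b}. norm (u s)) \<le> (LINT s|lebesgue_on {a..b}. c + (norm (u s))\<^sup>2 / c)"
  proof (rule integral_mono)
    fix s
    show "norm (u s) \<le> c + (norm (u s))\<^sup>2 / c"
    proof (cases "norm (u s) \<le> c")
      case False
      then have "c * norm (u s) \<le> (norm (u s))\<^sup>2" using \<open>c > 0\<close> by (simp add: power2_eq_square mult_right_mono)
      then have "norm (u s) \<le> (norm (u s))\<^sup>2 / c" using \<open>c > 0\<close> by (simp add: field_simps)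
      then show ?thesis using \<open>c > 0\<close> by linarith
    qed (use \<open>c > 0\<close> in \<open>simp add: add_increasing2\<close>)
  qed (use u in \<open>auto intro!: integrable_norm L2_integrable Bochner_Integration.integrable_add
        integrable_divide L2_D\<close>)
  also have "\<dots> = c * measure lebesgue {a..b} + (L2_norm a b u)\<^sup>2 / c"
    using u by (simp add: L2_D L2_norm_square L2_inner_def power2_norm_eq_inner
        measure_restrict_space L2_inner_integrable mult.commute)
  finally show ?thesis .
qed

text \<open>Riesz-Fischer. On a bounded interval an L2-Cauchy sequence is L1-Cauchy, so a
  subsequence converges almost everywhere; Fatou's lemma along it bounds the L2 distance of each
  late \<open>f n\<close> from the limit.\<close>

lemma L2_complete:
  fixes f :: "nat \<Rightarrow> real \<Rightarrow> real ^ 'n::finite"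
  assumes f: "\<And>n. f n \<in> L2 a b"
    and cauchy: "\<And>e. e > 0 \<Longrightarrow> \<exists>N. \<forall>m\<ge>N. \<forall>n\<ge>N. L2_norm a b (\<lambda>s. f m s - f n s) < e"
  obtains g where "g \<in> L2 a b" "(\<lambda>n. L2_norm a b (\<lambda>s. f n s - g s)) \<longlonglongrightarrow> 0"
proof -
  let ?M = "lebesgue_on {a..b}"
  define \<mu> where "\<mu> = measure lebesgue {a..b} + 1"
  have \<mu>: "\<mu> > 0" by (simp add: \<mu>_def add_nonneg_pos)
  have L1: "\<exists>N. \<forall>i\<ge>N. \<forall>j\<ge>N. (LINT x|?M. norm (f i x - f j x)) < e" if "e > 0" for e
  proof -
    \<comment> \<open>Chosen so that the first term of \<open>L2_norm_L1_bound\<close> is at most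
      \<open>e / 2\<close>; the threshold \<open>sqrt (c * e / 2)\<close> below then handles the
      second.\<close>
    define c where "c = e / (2 * \<mu>)"
    have c: "c > 0" using that \<mu> by (simp add: c_def)
    have "0 < sqrt (c * e / 2)" using c that by simp
    from cauchy[OF this] obtain N
      where N: "\<And>m n. m \<ge> N \<Longrightarrow> n \<ge> N \<Longrightarrow> L2_norm a b (\<lambda>s. f m s - f n s) < sqrt (c * e / 2)"
      by blast
    have "(LINT x|?M. norm (f i x - f j x)) < e" if "i \<ge> N" "j \<ge> N" for i j
    proof -
      have "(L2_norm a b (\<lambda>s. f i s - f j s))\<^sup>2 < (sqrt (c * e / 2))\<^sup>2"
        using N[OF that] by (intro power_strict_mono L2_norm_nonneg) auto
      then have "(L2_norm a b (\<lambda>s. f i s - f j s))\<^sup>2 / c < e / 2"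
        using c \<open>e > 0\<close> by (simp add: field_simps)
      moreover have "c * measure lebesgue {a..b} \<le> c * \<mu>" using c by (simp add: \<mu>_def)
      moreover have "c * \<mu> = e / 2" using \<mu> by (simp add: c_def)
      ultimately show ?thesis using L2_norm_L1_bound[OF L2_diff[OF f f] c, of i j] by linarith
    qed
    then show ?thesis by blast
  qed
  obtain r where r: "strict_mono r" and ae: "AE x in ?M. Cauchy (\<lambda>i. f (r i) x)"
    using cauchy_L1_AE_cauchy_subseq[of ?M f] L1 L2_integrable[OF f] by blast
  define g where "g x = lim (\<lambda>i. f (r i) x)" for x
  have meas [measurable]: "f n \<in> borel_measurable ?M" for n using f by (rule L2_D)
  have [measurable]: "g \<in> borel_measurable ?M"
    unfolding g_def by (intro borel_measurable_lim_metric meas)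
  have lim: "AE x in ?M. (\<lambda>i. f (r i) x) \<longlonglongrightarrow> g x"
    using ae by eventually_elim (simp add: g_def Cauchy_convergent convergent_LIMSEQ_iff[symmetric])
  have nn: "(\<integral>\<^sup>+ x. ennreal ((norm (u x))\<^sup>2) \<partial>?M) = ennreal ((L2_norm a b u)\<^sup>2)" if "u \<in> L2 a b" for u :: "real \<Rightarrow> real ^ 'n"
    using that by (subst nn_integral_eq_integral) (auto simp: L2_norm_square L2_inner_def L2_inner_integrable power2_norm_eq_inner)
  have fatou: "(\<integral>\<^sup>+ x. ennreal ((norm (f n x - g x))\<^sup>2) \<partial>?M) \<le> ennreal (e\<^sup>2)"
    if N: "\<And>m n. m \<ge> N \<Longrightarrow> n \<ge> N \<Longrightarrow> L2_norm a b (\<lambda>s. f m s - f n s) < e" and n: "n \<ge> N" for n N e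
  proof -
    have "(\<integral>\<^sup>+ x. ennreal ((norm (f n x - g x))\<^sup>2) \<partial>?M)
      = (\<integral>\<^sup>+ x. liminf (\<lambda>i. ennreal ((norm (f n x - f (r i) x))\<^sup>2)) \<partial>?M)"
    proof (rule nn_integral_cong_AE)
      show "AE x in ?M. ennreal ((norm (f n x - g x))\<^sup>2) = liminf (\<lambda>i. ennreal ((norm (f n x - f (r i) x))\<^sup>2))"
        using lim
      proof eventually_elim
        case (elim x)
        then have "(\<lambda>i. ennreal ((norm (f n x - f (r i) x))\<^sup>2)) \<longlonglongrightarrow> ennreal ((norm (f n x - g x))\<^sup>2)"
          by (intro tendsto_ennrealI tendsto_intros)
        then show ?case by (intro lim_imp_Liminf[symmetric]) auto
      qed
    qed
    also have "\<dots> \<le> liminf (\<lambda>i. \<integral>\<^sup>+ x. ennreal ((norm (f n x - f (r i) x))\<^sup>2) \<partial>?M)"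
      by (rule nn_integral_liminf) measurable
    also have "\<dots> \<le> ennreal (e\<^sup>2)"
    proof (rule Liminf_le)
      show "\<forall>\<^sub>F i in sequentially. (\<integral>\<^sup>+ x. ennreal ((norm (f n x - f (r i) x))\<^sup>2) \<partial>?M) \<le> ennreal (e\<^sup>2)"
      proof (rule eventually_sequentiallyI)
        fix i assume "N \<le> i"
        then have "N \<le> r i" using seq_suble[OF r, of i] by simp
        from N[OF n this] show "(\<integral>\<^sup>+ x. ennreal ((norm (f n x - f (r i) x))\<^sup>2) \<partial>?M) \<le> ennreal (e\<^sup>2)"
          unfolding nn[OF L2_diff[OF f f]] by (intro ennreal_leI power_mono L2_norm_nonneg) auto
      qed
    qed auto
    finally show ?thesis .
  qed
  have mem: "(\<lambda>s. f n s - g s) \<in> L2 a b"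
    if N: "\<And>m n. m \<ge> N \<Longrightarrow> n \<ge> N \<Longrightarrow> L2_norm a b (\<lambda>s. f m s - f n s) < e" and n: "n \<ge> N" for n N e
  proof -
    have "(\<integral>\<^sup>+ x. ennreal (norm ((norm (f n x - g x))\<^sup>2)) \<partial>?M) < \<infinity>"
      using fatou[OF N n] by (simp add: le_less_trans)
    then show ?thesis by (auto simp: L2_def integrable_iff_bounded)
  qed
  from cauchy[OF zero_less_one] obtain N1
    where N1: "\<And>m n. m \<ge> N1 \<Longrightarrow> n \<ge> N1 \<Longrightarrow> L2_norm a b (\<lambda>s. f m s - f n s) < 1"
    by blast
  have "(\<lambda>s. f N1 s - g s) \<in> L2 a b" using mem[OF N1] by blast
  from L2_diff[OF f this, of N1] have g: "g \<in> L2 a b" by simp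
  moreover have "(\<lambda>n. L2_norm a b (\<lambda>s. f n s - g s)) \<longlonglongrightarrow> 0"
  proof (rule LIMSEQ_I)
    fix e :: real assume "0 < e"
    then have "0 < e / 2" by simp
    from cauchy[OF this] obtain N
      where N: "\<And>m n. m \<ge> N \<Longrightarrow> n \<ge> N \<Longrightarrow> L2_norm a b (\<lambda>s. f m s - f n s) < e / 2"
      by blast
    have "norm (L2_norm a b (\<lambda>s. f n s - g s) - 0) < e" if "n \<ge> N" for n
    proof -
      have "ennreal ((L2_norm a b (\<lambda>s. f n s - g s))\<^sup>2) \<le> ennreal ((e / 2)\<^sup>2)"
        unfolding nn[OF L2_diff[OF f g], symmetric] by (rule fatou[OF N that])
      then have "(L2_norm a b (\<lambda>s. f n s - g s))\<^sup>2 \<le> (e / 2)\<^sup>2"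
        unfolding ennreal_le_iff[OF zero_le_power2] .
      then have "L2_norm a b (\<lambda>s. f n s - g s) \<le> e / 2"
        by (rule power2_le_imp_le) (use \<open>0 < e\<close> in simp)
      then show ?thesis using \<open>0 < e\<close> by (simp add: L2_norm_nonneg)
    qed
    then show "\<exists>N. \<forall>n\<ge>N. norm (L2_norm a b (\<lambda>s. f n s - g s) - 0) < e" by blast
  qed
  ultimately show ?thesis using that by blast
qed

\<comment> \<open>A partial quotient, as only members of \<open>L2 0 1\<close> represent an element.
  Passing to classes makes the inner product definite, as \<open>real_inner\<close>
  requires.\<close>
quotient_type (overloaded) 'n ltwo = "real \<Rightarrow> real ^ 'n::finite" /
  partial: "\<lambda>f g. f \<in> L2 0 1 \<and> g \<in> L2 0 1 \<and> L2_eq 0 1 f g"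
  morphisms rep_ltwo abs_ltwo
proof (rule part_equivpI)
  show "\<exists>x :: real \<Rightarrow> real ^ 'n. x \<in> L2 0 1 \<and> x \<in> L2 0 1 \<and> L2_eq 0 1 x x"
    by (intro exI[of _ "\<lambda>_. 0"]) (auto simp: L2_const L2_eq_def)
  show "symp (\<lambda>f g :: real \<Rightarrow> real ^ 'n. f \<in> L2 0 1 \<and> g \<in> L2 0 1 \<and> L2_eq 0 1 f g)"
    by (auto simp: symp_def L2_eq_def eq_commute)
  show "transp (\<lambda>f g :: real \<Rightarrow> real ^ 'n. f \<in> L2 0 1 \<and> g \<in> L2 0 1 \<and> L2_eq 0 1 f g)"
    unfolding transp_def L2_eq_def by (auto elim: eventually_elim2)
qed

instantiation ltwo :: (finite) real_inner
begin

lift_definition zero_ltwo :: "'a ltwo" is "\<lambda>_. 0" by (simp add: L2_const L2_eq_def)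
lift_definition plus_ltwo :: "'a ltwo \<Rightarrow> 'a ltwo \<Rightarrow> 'a ltwo" is "\<lambda>u v s. u s + v s"
  by (auto simp: L2_add L2_eq_def elim: eventually_elim2)
lift_definition minus_ltwo :: "'a ltwo \<Rightarrow> 'a ltwo \<Rightarrow> 'a ltwo" is "\<lambda>u v s. u s - v s"
  by (auto simp: L2_diff L2_eq_def elim: eventually_elim2)
lift_definition uminus_ltwo :: "'a ltwo \<Rightarrow> 'a ltwo" is "\<lambda>u s. - u s"
  by (auto simp: L2_uminus L2_eq_def elim: eventually_mono)
lift_definition scaleR_ltwo :: "real \<Rightarrow> 'a ltwo \<Rightarrow> 'a ltwo" is "\<lambda>c u s. c *\<^sub>R u s"
  by (auto simp: L2_scale L2_eq_def elim: eventually_mono)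
lift_definition inner_ltwo :: "'a ltwo \<Rightarrow> 'a ltwo \<Rightarrow> real" is "L2_inner 0 1"
  by (auto intro: L2_inner_cong)
definition norm_ltwo :: "'a ltwo \<Rightarrow> real" where "norm_ltwo x = sqrt (inner x x)"
definition dist_ltwo :: "'a ltwo \<Rightarrow> 'a ltwo \<Rightarrow> real" where "dist_ltwo x y = norm (x - y)"
definition sgn_ltwo :: "'a ltwo \<Rightarrow> 'a ltwo" where "sgn_ltwo x = inverse (norm x) *\<^sub>R x"
definition uniformity_ltwo :: "('a ltwo \<times> 'a ltwo) filter"
  where "uniformity_ltwo = (INF e\<in>{0<..}. principal {(x, y). dist x y < e})"
definition open_ltwo :: "'a ltwo set \<Rightarrow> bool"
  where "open_ltwo U = (\<forall>x\<in>U. eventually (\<lambda>(x', y). x' = x \<longrightarrow> y \<in> U) uniformity)"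

instance
proof
  fix x y z :: "'a ltwo" and r s :: real and U :: "'a ltwo set"
  show "dist x y = norm (x - y)" by (rule dist_ltwo_def)
  show "sgn x = inverse (norm x) *\<^sub>R x" by (rule sgn_ltwo_def)
  show "uniformity = (INF e\<in>{0<..}. principal {(x, y :: 'a ltwo). dist x y < e})"
    by (rule uniformity_ltwo_def)
  show "open U = (\<forall>x\<in>U. eventually (\<lambda>(x', y). x' = x \<longrightarrow> y \<in> U) uniformity)"
    by (rule open_ltwo_def)
  show "norm x = sqrt (inner x x)" by (rule norm_ltwo_def)
  show "(x + y) + z = x + (y + z)" by transfer (simp add: L2_add L2_eq_def add.assoc)
  show "x + y = y + x" by transfer (auto simp: L2_add L2_eq_def add.commute)
  show "0 + x = x" by transfer (simp add: L2_eq_def)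
  show "- x + x = 0" by transfer (simp add: L2_const L2_eq_def)
  show "x - y = x + - y" by transfer (simp add: L2_diff L2_eq_def)
  show "r *\<^sub>R (x + y) = r *\<^sub>R x + r *\<^sub>R y"
    by transfer (simp add: L2_add L2_scale L2_eq_def scaleR_add_right)
  show "(r + s) *\<^sub>R x = r *\<^sub>R x + s *\<^sub>R x"
    by transfer (auto simp: L2_add L2_scale L2_eq_def scaleR_add_left)
  show "r *\<^sub>R s *\<^sub>R x = (r * s) *\<^sub>R x" by transfer (simp add: L2_scale L2_eq_def)
  show "1 *\<^sub>R x = x" by transfer (simp add: L2_eq_def)
  show "inner x y = inner y x" by transfer (rule L2_inner_commute)
  show "inner (x + y) z = inner x z + inner y z" by transfer (simp add: L2_inner_add_left)
  show "inner (r *\<^sub>R x) y = r * inner x y" by transfer (rule L2_inner_scale_left)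
  show "0 \<le> inner x x" by transfer (rule L2_inner_nonneg)
  show "inner x x = 0 \<longleftrightarrow> x = 0" by transfer (simp add: L2_inner_eq_0_iff L2_const)
qed

end

lemma rep_ltwo_L2: "rep_ltwo h \<in> L2 0 1"
  using Quotient_rep_reflp[OF Quotient_ltwo, of h] by auto

lemma abs_rep_ltwo: "abs_ltwo (rep_ltwo h) = h"
  by (rule Quotient_abs_rep[OF Quotient_ltwo])

lemma inner_abs_ltwo:
  "u \<in> L2 0 1 \<Longrightarrow> v \<in> L2 0 1 \<Longrightarrow> inner (abs_ltwo u) (abs_ltwo v) = L2_inner 0 1 u v"
  by (simp add: inner_ltwo.abs_eq L2_eq_def)

lemma abs_ltwo_add:
  "u \<in> L2 0 1 \<Longrightarrow> v \<in> L2 0 1 \<Longrightarrow> abs_ltwo (\<lambda>s. u s + v s) = abs_ltwo u + abs_ltwo v"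
  by (simp add: plus_ltwo.abs_eq L2_eq_def)

lemma abs_ltwo_diff:
  "u \<in> L2 0 1 \<Longrightarrow> v \<in> L2 0 1 \<Longrightarrow> abs_ltwo (\<lambda>s. u s - v s) = abs_ltwo u - abs_ltwo v"
  by (simp add: minus_ltwo.abs_eq L2_eq_def)

lemma abs_ltwo_scale: "u \<in> L2 0 1 \<Longrightarrow> abs_ltwo (\<lambda>s. c *\<^sub>R u s) = c *\<^sub>R abs_ltwo u"
  by (simp add: scaleR_ltwo.abs_eq L2_eq_def)

lemma norm_abs_ltwo: "u \<in> L2 0 1 \<Longrightarrow> norm (abs_ltwo u) = L2_norm 0 1 u"
  by (simp add: norm_eq_sqrt_inner inner_abs_ltwo L2_norm_def)

instance ltwo :: (finite) banach
proof
  fix X :: "nat \<Rightarrow> 'a ltwo" assume X: "Cauchy X"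
  have d: "norm (X m - abs_ltwo g) = L2_norm 0 1 (\<lambda>s. rep_ltwo (X m) s - g s)" if "g \<in> L2 0 1" for m g
    using that by (simp add: norm_abs_ltwo[symmetric] L2_diff rep_ltwo_L2 abs_ltwo_diff abs_rep_ltwo)
  have d2: "norm (X m - X n) = L2_norm 0 1 (\<lambda>s. rep_ltwo (X m) s - rep_ltwo (X n) s)" for m n
    using d[OF rep_ltwo_L2, of m "X n"] by (simp add: abs_rep_ltwo)
  have c: "\<exists>N. \<forall>m\<ge>N. \<forall>n\<ge>N. L2_norm 0 1 (\<lambda>s. rep_ltwo (X m) s - rep_ltwo (X n) s) < e"
    if "e > 0" for e
    using metric_CauchyD[OF X that] by (simp add: dist_norm d2)
  obtain g where g: "g \<in> L2 0 1" "(\<lambda>n. L2_norm 0 1 (\<lambda>s. rep_ltwo (X n) s - g s)) \<longlonglongrightarrow> 0"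
    using L2_complete[of "\<lambda>n. rep_ltwo (X n)", OF rep_ltwo_L2 c] by blast
  then have "(\<lambda>n. norm (X n - abs_ltwo g)) \<longlonglongrightarrow> 0" using d by simp
  then have "X \<longlonglongrightarrow> abs_ltwo g" by (simp add: tendsto_norm_zero_iff LIM_zero_iff)
  then show "convergent X" by (auto simp: convergent_def)
qed

text \<open>The exponential of endomorphisms is available only over this sort. Small multiples of a
  nonzero constant function show that no point is isolated.\<close>

instance ltwo :: (finite) perfect_space
proof
  fix x :: "'a ltwo"
  define c :: "real ^ 'a" where "c = 1"
  define v where "v = abs_ltwo (\<lambda>_. c)"
  have "c \<noteq> 0" by (simp add: c_def)
  then have "L2_inner 0 1 (\<lambda>_. c) (\<lambda>_. c) \<noteq> 0"
    by (simp add: L2_inner_def measure_restrict_space)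
  then have "v \<noteq> 0" unfolding v_def
    by (auto simp flip: inner_abs_ltwo[OF L2_const L2_const])
  show "\<not> open {x}"
  proof
    assume "open {x}"
    then obtain e where e: "e > 0" "\<And>y. dist y x < e \<Longrightarrow> y = x" by (auto simp: open_dist)
    have "x + (e / (2 * norm v)) *\<^sub>R v = x"
      using \<open>v \<noteq> 0\<close> \<open>e > 0\<close> by (intro e) (simp add: dist_norm)
    then show False using \<open>v \<noteq> 0\<close> \<open>e > 0\<close> by simp
  qed
qed

section \<open>The isometry onto the space over the unit interval\<close>

lemma
  fixes f :: "real \<Rightarrow> 'a::euclidean_space"
  assumes "a < b"
  shows integrable_lebesgue_on_affine:
      "integrable (lebesgue_on {0..1}) (\<lambda>s. f (a + (b - a) * s)) \<longleftrightarrow> integrable (lebesgue_on {a..b}) f"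
    and integral_lebesgue_on_affine:
      "(LINT x|lebesgue_on {a..b}. f x) = (b - a) *\<^sub>R (LINT s|lebesgue_on {0..1}. f (a + (b - a) * s))"
proof -
  have "indicat_real {a..b} (a + (b - a) * s) = indicat_real {0..1} s" for s
  proof -
    have "a \<le> a + (b - a) * s \<longleftrightarrow> 0 \<le> s" using assms by (simp add: zero_le_mult_iff)
    moreover have "a + (b - a) * s \<le> b \<longleftrightarrow> (b - a) * s \<le> (b - a) * 1"
      by (simp only: le_diff_eq mult_1_right add.commute)
    then have "a + (b - a) * s \<le> b \<longleftrightarrow> s \<le> 1"
      using assms mult_le_cancel_left_pos[of "b - a" s 1] by simp
    ultimately show ?thesis by (simp add: indicator_def)
  qed
  then have eq: "(\<lambda>s. indicat_real {0..1} s *\<^sub>R f (a + (b - a) * s))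
      = (\<lambda>s. (\<lambda>x. indicat_real {a..b} x *\<^sub>R f x) (a + (b - a) * s))"
    by simp
  show "integrable (lebesgue_on {0..1}) (\<lambda>s. f (a + (b - a) * s)) \<longleftrightarrow> integrable (lebesgue_on {a..b}) f"
    using assms lebesgue_integrable_real_affine_iff[of "b - a" "\<lambda>x. indicat_real {a..b} x *\<^sub>R f x" a]
    by (simp add: integrable_restrict_space eq)
  show "(LINT x|lebesgue_on {a..b}. f x) = (b - a) *\<^sub>R (LINT s|lebesgue_on {0..1}. f (a + (b - a) * s))"
    using lebesgue_integral_real_affine[of "b - a" "\<lambda>x. indicat_real {a..b} x *\<^sub>R f x" a] assms
    by (simp add: integral_restrict_space eq)
qed

text \<open>The factor \<open>sqrt (b - a)\<close> compensates the Jacobian of the substitution in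
  inner products.\<close>

definition pull :: "real \<Rightarrow> real \<Rightarrow> (real \<Rightarrow> real ^ 'n::finite) \<Rightarrow> real \<Rightarrow> real ^ 'n" where
  "pull a b u = (\<lambda>s. sqrt (b - a) *\<^sub>R u (a + (b - a) * s))"

text \<open>An isometry of \<open>L\<^sub>2\<^sup>n[a,b]\<close> onto a Hilbert space that is a type, with right inverse \<open>unemb\<close>;
  the type cannot depend on \<open>a\<close> and \<open>b\<close>, whence the rescaling to \<open>[0,1]\<close>.\<close>

definition emb :: "real \<Rightarrow> real \<Rightarrow> (real \<Rightarrow> real ^ 'n::finite) \<Rightarrow> 'n ltwo" where
  "emb a b u = abs_ltwo (pull a b u)"

definition unemb :: "real \<Rightarrow> real \<Rightarrow> 'n::finite ltwo \<Rightarrow> real \<Rightarrow> real ^ 'n" where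
  "unemb a b h = (\<lambda>x. (1 / sqrt (b - a)) *\<^sub>R rep_ltwo h ((x - a) / (b - a)))"

lemma pull_L2:
  assumes "a < b" "u \<in> L2 a b" shows "pull a b u \<in> L2 0 1"
proof -
  have "integrable (lebesgue_on {0..1}) (\<lambda>s. u (a + (b - a) * s))"
    using assms integrable_lebesgue_on_affine L2_integrable by blast
  then have 1: "pull a b u \<in> borel_measurable (lebesgue_on {0..1})"
    unfolding pull_def by (intro borel_measurable_scaleR borel_measurable_const borel_measurable_integrable)
  have "integrable (lebesgue_on {0..1}) (\<lambda>s. (norm (u (a + (b - a) * s)))\<^sup>2)"
    using assms integrable_lebesgue_on_affine[of a b "\<lambda>x. (norm (u x))\<^sup>2"] L2_D(2)[of u a b] by simp
  then have "integrable (lebesgue_on {0..1}) (\<lambda>s. (norm (pull a b u s))\<^sup>2)"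
    by (simp add: pull_def power_mult_distrib)
  with 1 show ?thesis by (simp add: L2_def)
qed

lemma unemb_L2:
  assumes "a < b" shows "unemb a b h \<in> L2 a b"
proof -
  have aff: "unemb a b h (a + (b - a) * s) = (1 / sqrt (b - a)) *\<^sub>R rep_ltwo h s" for s
    using assms by (simp add: unemb_def)
  have "integrable (lebesgue_on {a..b}) (unemb a b h)"
    by (subst integrable_lebesgue_on_affine[OF assms, symmetric])
      (simp only: aff integrable_scaleR_right L2_integrable[OF rep_ltwo_L2])
  moreover have "integrable (lebesgue_on {a..b}) (\<lambda>s. (norm (unemb a b h s))\<^sup>2)"
    by (subst integrable_lebesgue_on_affine[OF assms, symmetric])
      (simp add: aff power_mult_distrib power_divide L2_D(2)[OF rep_ltwo_L2])
  ultimately show ?thesis by (simp add: L2_def borel_measurable_integrable)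
qed

lemma emb_unemb: "a < b \<Longrightarrow> emb a b (unemb a b h) = h"
  by (simp add: emb_def pull_def unemb_def abs_rep_ltwo)

lemma inner_emb:
  assumes "a < b" "u \<in> L2 a b" "v \<in> L2 a b"
  shows "inner (emb a b u) (emb a b v) = L2_inner a b u v"
  unfolding emb_def inner_abs_ltwo[OF pull_L2[OF assms(1,2)] pull_L2[OF assms(1,3)]]
  using integral_lebesgue_on_affine[OF assms(1), of "\<lambda>s. u s \<bullet> v s"] assms(1)
  by (simp add: L2_inner_def pull_def)

lemma norm_emb: "a < b \<Longrightarrow> u \<in> L2 a b \<Longrightarrow> norm (emb a b u) = L2_norm a b u"
  by (simp add: norm_eq_sqrt_inner inner_emb L2_norm_def)

lemma emb_add:
  "a < b \<Longrightarrow> u \<in> L2 a b \<Longrightarrow> v \<in> L2 a b \<Longrightarrow> emb a b (\<lambda>s. u s + v s) = emb a b u + emb a b v"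
  using abs_ltwo_add[OF pull_L2 pull_L2, of a b u a b v]
  by (simp add: emb_def pull_def scaleR_add_right)

lemma emb_scale: "a < b \<Longrightarrow> u \<in> L2 a b \<Longrightarrow> emb a b (\<lambda>s. c *\<^sub>R u s) = c *\<^sub>R emb a b u"
  using abs_ltwo_scale[OF pull_L2, of a b u c] by (simp add: emb_def pull_def mult.commute)

lemma emb_diff:
  "a < b \<Longrightarrow> u \<in> L2 a b \<Longrightarrow> v \<in> L2 a b \<Longrightarrow> emb a b (\<lambda>s. u s - v s) = emb a b u - emb a b v"
  using emb_add[of a b u "\<lambda>s. (-1) *\<^sub>R v s"] emb_scale[of a b v "-1"] L2_scale[of v a b "-1"] by simp

lemma emb_eq_iff:
  assumes "a < b" "u \<in> L2 a b" "v \<in> L2 a b"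
  shows "emb a b u = emb a b v \<longleftrightarrow> L2_eq a b u v"
proof -
  have "emb a b u = emb a b v \<longleftrightarrow> (norm (emb a b (\<lambda>s. u s - v s)))\<^sup>2 = 0"
    using assms by (simp add: emb_diff)
  also have "\<dots> \<longleftrightarrow> L2_inner a b (\<lambda>s. u s - v s) (\<lambda>s. u s - v s) = 0"
    using assms by (simp only: norm_emb L2_diff L2_norm_square)
  also have "\<dots> \<longleftrightarrow> L2_eq a b u v"
    using assms by (simp add: L2_inner_eq_0_iff L2_diff) (simp add: L2_eq_def)
  finally show ?thesis .
qed

lemma L2_eq_unemb_emb: "a < b \<Longrightarrow> u \<in> L2 a b \<Longrightarrow> L2_eq a b (unemb a b (emb a b u)) u"
  by (simp add: unemb_L2 emb_unemb flip: emb_eq_iff)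

lemma emb_sum:
  assumes "a < b" "\<And>i. i \<in> I \<Longrightarrow> u i \<in> L2 a b"
  shows "emb a b (\<lambda>s. \<Sum>i\<in>I. u i s) = (\<Sum>i\<in>I. emb a b (u i))"
  using assms(2)
proof (induction I rule: infinite_finite_induct)
  case (insert i I)
  then show ?case using assms(1) by (simp add: emb_add L2_sum)
qed (use emb_scale[OF assms(1) L2_const, of 0 0] in auto)

section \<open>Transport of operators along the isometry\<close>

definition op_emb :: "real \<Rightarrow> real \<Rightarrow> 'n::finite l2op \<Rightarrow> 'n ltwo \<Rightarrow> 'n ltwo" where
  "op_emb a b R h = emb a b (R (unemb a b h))"

lemma L2_bounded_opD:
  assumes "L2_bounded_op a b R"
  shows "\<And>v. v \<in> L2 a b \<Longrightarrow> R v \<in> L2 a b"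
    and "\<And>u v. u \<in> L2 a b \<Longrightarrow> v \<in> L2 a b \<Longrightarrow> L2_eq a b (R (\<lambda>s. u s + v s)) (\<lambda>s. R u s + R v s)"
    and "\<And>c v. v \<in> L2 a b \<Longrightarrow> L2_eq a b (R (\<lambda>s. c *\<^sub>R v s)) (\<lambda>s. c *\<^sub>R R v s)"
    and "\<exists>k. \<forall>v\<in>L2 a b. L2_norm a b (R v) \<le> k * L2_norm a b v"
  using assms by (auto simp: L2_bounded_op_def)

text \<open>Independence of the representative: two representatives of a class differ by a null
  function \<open>w\<close>, and boundedness of \<open>R\<close> makes \<open>R w\<close> null as
  well.\<close>

lemma op_emb:
  assumes ab: "a < b" and R: "L2_bounded_op a b R" and u: "u \<in> L2 a b"
  shows "op_emb a b R (emb a b u) = emb a b (R u)"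
proof -
  note m = L2_bounded_opD(1)[OF R]
  obtain k where k: "\<And>v. v \<in> L2 a b \<Longrightarrow> L2_norm a b (R v) \<le> k * L2_norm a b v"
    using L2_bounded_opD(4)[OF R] by blast
  define w where "w = (\<lambda>s. unemb a b (emb a b u) s - u s)"
  have w: "w \<in> L2 a b" unfolding w_def by (intro L2_diff unemb_L2 ab u)
  have "emb a b w = 0" using ab u by (simp add: w_def emb_diff unemb_L2 emb_unemb)
  then have "L2_norm a b w = 0" using norm_emb[OF ab w] by simp
  then have "norm (emb a b (R w)) \<le> 0" using k[OF w] norm_emb[OF ab m[OF w]] by simp
  moreover have "emb a b (R (\<lambda>s. u s + w s)) = emb a b (\<lambda>s. R u s + R w s)"
    using L2_bounded_opD(2)[OF R u w] ab u w by (subst emb_eq_iff) (auto intro!: m L2_add)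
  ultimately have "emb a b (R (\<lambda>s. u s + w s)) = emb a b (R u)"
    using ab u w m by (simp add: emb_add)
  then show ?thesis by (simp add: op_emb_def w_def)
qed

lemma bounded_linear_op_emb:
  assumes ab: "a < b" and R: "L2_bounded_op a b R"
  shows "bounded_linear (op_emb a b R)"
proof -
  note m = L2_bounded_opD(1)[OF R]
  obtain k where k: "\<And>v. v \<in> L2 a b \<Longrightarrow> L2_norm a b (R v) \<le> k * L2_norm a b v"
    using L2_bounded_opD(4)[OF R] by blast
  note un = unemb_L2[OF ab]
  show ?thesis
  proof (rule bounded_linear_intro[of _ k])
    fix x y :: "'a ltwo" and c
    let ?x = "unemb a b x" and ?y = "unemb a b y"
    have "op_emb a b R (x + y) = op_emb a b R (emb a b (\<lambda>s. ?x s + ?y s))"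
      using ab by (simp add: emb_add un emb_unemb)
    also have "\<dots> = emb a b (R (\<lambda>s. ?x s + ?y s))" by (intro op_emb ab R L2_add un)
    also have "\<dots> = emb a b (\<lambda>s. R ?x s + R ?y s)"
      using L2_bounded_opD(2)[OF R un un] by (subst emb_eq_iff) (auto intro!: ab m L2_add un)
    also have "\<dots> = op_emb a b R x + op_emb a b R y"
      unfolding op_emb_def by (intro emb_add ab m un)
    finally show "op_emb a b R (x + y) = op_emb a b R x + op_emb a b R y" .
    have "op_emb a b R (c *\<^sub>R x) = op_emb a b R (emb a b (\<lambda>s. c *\<^sub>R ?x s))"
      using ab by (simp add: emb_scale un emb_unemb)
    also have "\<dots> = emb a b (R (\<lambda>s. c *\<^sub>R ?x s))" by (intro op_emb ab R L2_scale un)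
    also have "\<dots> = emb a b (\<lambda>s. c *\<^sub>R R ?x s)"
      using L2_bounded_opD(3)[OF R un] by (subst emb_eq_iff) (auto intro!: ab m L2_scale un)
    also have "\<dots> = c *\<^sub>R op_emb a b R x" unfolding op_emb_def by (intro emb_scale ab m un)
    finally show "op_emb a b R (c *\<^sub>R x) = c *\<^sub>R op_emb a b R x" .
    show "norm (op_emb a b R x) \<le> norm x * k"
      using k[OF un] norm_emb[OF ab m[OF un]] norm_emb[OF ab un, of x]
      by (simp add: op_emb_def emb_unemb[OF ab] mult.commute)
  qed
qed

text \<open>For operators whose values are known only up to null sets, as with those built from
  chosen weak derivatives: it suffices to identify their classes with those of a bounded operator on
  the Hilbert space type.\<close>

lemma L2_bounded_opI_emb:
  assumes ab: "a < b" and R: "\<And>v. v \<in> L2 a b \<Longrightarrow> R v \<in> L2 a b" and F: "bounded_linear F"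
    and eq: "\<And>v. v \<in> L2 a b \<Longrightarrow> emb a b (R v) = F (emb a b v)"
  shows "L2_bounded_op a b R"
proof -
  interpret bounded_linear F by (rule F)
  obtain K where K: "\<And>x. norm (F x) \<le> norm x * K" using bounded by blast
  have "L2_norm a b (R v) \<le> K * L2_norm a b v" if "v \<in> L2 a b" for v
    using K[of "emb a b v"] that by (simp add: norm_emb[OF ab] R mult.commute flip: eq)
  then show ?thesis using ab
    by (auto simp: L2_bounded_op_def R L2_add L2_scale eq emb_add emb_scale add scale
        simp flip: emb_eq_iff)
qed

definition op_unemb :: "real \<Rightarrow> real \<Rightarrow> ('n::finite ltwo \<Rightarrow> 'n ltwo) \<Rightarrow> 'n l2op" where
  "op_unemb a b F v = unemb a b (F (emb a b v))"

lemma emb_op_unemb: "a < b \<Longrightarrow> emb a b (op_unemb a b F v) = F (emb a b v)"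
  by (simp add: op_unemb_def emb_unemb)

lemma op_unemb_L2: "a < b \<Longrightarrow> op_unemb a b F v \<in> L2 a b"
  by (simp add: op_unemb_def unemb_L2)

lemma L2_bounded_op_op_unemb:
  "a < b \<Longrightarrow> bounded_linear F \<Longrightarrow> L2_bounded_op a b (op_unemb a b F)"
  by (rule L2_bounded_opI_emb) (auto simp: op_unemb_L2 emb_op_unemb)

text \<open>Both sides are suprema over the same set of quotients. Null functions are included; they
  contribute 0 on either side because division by 0 gives 0.\<close>

lemma L2_onorm_eq_onorm:
  assumes ab: "a < b" and R: "L2_bounded_op a b R"
  shows "L2_onorm a b R = onorm (op_emb a b R)"
proof -
  have "range (\<lambda>h. norm (op_emb a b R h) / norm h) = (\<lambda>v. L2_norm a b (R v) / L2_norm a b v) ` L2 a b"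
  proof (intro equalityI subsetI)
    fix x assume "x \<in> range (\<lambda>h. norm (op_emb a b R h) / norm h)"
    then obtain h where "x = norm (op_emb a b R h) / norm h" by auto
    then have "x = L2_norm a b (R (unemb a b h)) / L2_norm a b (unemb a b h)"
      using ab by (simp add: op_emb_def emb_unemb unemb_L2 L2_bounded_opD(1)[OF R] flip: norm_emb)
    then show "x \<in> (\<lambda>v. L2_norm a b (R v) / L2_norm a b v) ` L2 a b" using unemb_L2[OF ab] by blast
  next
    fix x assume "x \<in> (\<lambda>v. L2_norm a b (R v) / L2_norm a b v) ` L2 a b"
    then obtain v where v: "v \<in> L2 a b" "x = L2_norm a b (R v) / L2_norm a b v" by auto
    then have "x = norm (op_emb a b R (emb a b v)) / norm (emb a b v)"
      using ab by (simp add: op_emb[OF ab R] norm_emb L2_bounded_opD(1)[OF R])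
    then show "x \<in> range (\<lambda>h. norm (op_emb a b R h) / norm h)" by blast
  qed
  then show ?thesis by (simp add: L2_onorm_def onorm_def)
qed

lemma L2_adjoint:
  assumes ab: "a < b" and R: "L2_bounded_op a b R"
  shows L2_bounded_op_adjoint: "L2_bounded_op a b (L2_adjoint a b R)"
    and L2_inner_adjoint: "\<And>u v. u \<in> L2 a b \<Longrightarrow> v \<in> L2 a b \<Longrightarrow>
      L2_inner a b (R u) v = L2_inner a b u (L2_adjoint a b R v)"
proof -
  obtain F where F: "bounded_linear F" "\<And>x y. inner (op_emb a b R x) y = inner x (F y)"
    using adjoint_exists[OF bounded_linear_op_emb[OF ab R]] by blast
  have "L2_bounded_op a b (op_unemb a b F) \<and>
     (\<forall>u\<in>L2 a b. \<forall>v\<in>L2 a b. L2_inner a b (R u) v = L2_inner a b u (op_unemb a b F v))"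
    using ab F(2) L2_bounded_opD(1)[OF R]
    by (simp add: L2_bounded_op_op_unemb[OF ab F(1)] op_unemb_L2 emb_op_unemb op_emb[OF ab R, symmetric]
        flip: inner_emb)
  from someI[where P = "\<lambda>R'. L2_bounded_op a b R' \<and>
     (\<forall>u\<in>L2 a b. \<forall>v\<in>L2 a b. L2_inner a b (R u) v = L2_inner a b u (R' v))", OF this]
  show "L2_bounded_op a b (L2_adjoint a b R)"
    "\<And>u v. u \<in> L2 a b \<Longrightarrow> v \<in> L2 a b \<Longrightarrow>
      L2_inner a b (R u) v = L2_inner a b u (L2_adjoint a b R v)"
    unfolding L2_adjoint_def by blast+
qed

section \<open>Test functions and the lemma of du Bois-Reymond\<close>

definition smooth :: "(real \<Rightarrow> real) \<Rightarrow> bool" where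
  "smooth f \<longleftrightarrow> (\<forall>k x. (deriv ^^ k) f field_differentiable at x)"

lemma test_fun_iff:
  "test_fun a b \<phi> \<longleftrightarrow> smooth \<phi> \<and> (\<exists>c e. a < c \<and> e < b \<and> (\<forall>x. x \<notin> {c..e} \<longrightarrow> \<phi> x = 0))"
  by (simp add: test_fun_def smooth_def)

lemma smooth_differentiable: "smooth f \<Longrightarrow> f field_differentiable at x"
  unfolding smooth_def by (metis funpow_0)

lemma smooth_deriv: "smooth f \<Longrightarrow> smooth (deriv f)"
  unfolding smooth_def by (metis funpow_Suc_right o_apply)

lemma smooth_has_derivative: "smooth f \<Longrightarrow> (f has_real_derivative deriv f x) (at x)"
  using smooth_differentiable by (simp add: DERIV_deriv_iff_field_differentiable)

lemma smooth_continuous: "smooth f \<Longrightarrow> continuous_on A f"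
  by (meson continuous_at_imp_continuous_on field_differentiable_imp_continuous_at smooth_differentiable)

text \<open>Coinduction on differentiability: it is enough to find a set of functions closed under
  differentiation, and no formula for higher derivatives is needed.\<close>

lemma smooth_coinduct:
  assumes "X f" and step: "\<And>f. X f \<Longrightarrow> (\<exists>f'. X f' \<and> (\<forall>x. (f has_real_derivative f' x) (at x)))"
  shows "smooth f"
proof -
  have "X ((deriv ^^ k) f)" for k
  proof (induction k)
    case (Suc k)
    then obtain f' where "X f'" "\<And>x. ((deriv ^^ k) f has_real_derivative f' x) (at x)"
      using step by blast
    then have "deriv ((deriv ^^ k) f) = f'" by (auto intro: DERIV_imp_deriv)
    then show ?case using \<open>X f'\<close> by simp
  qed (use assms in simp)
  then show ?thesis unfolding smooth_def using step
    by (meson field_differentiable_def)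
qed

text \<open>By the Leibniz rule the derivative of a product is a sum of products, so a set suitable
  for \<open>smooth_coinduct\<close> has to admit finite sums.\<close>

inductive product_sum :: "(real \<Rightarrow> real) \<Rightarrow> bool" where
  product: "smooth f \<Longrightarrow> smooth g \<Longrightarrow> product_sum (\<lambda>x. f x * g x)"
| sum: "product_sum f \<Longrightarrow> product_sum g \<Longrightarrow> product_sum (\<lambda>x. f x + g x)"

lemma smooth_mult:
  assumes "smooth f" "smooth g" shows "smooth (\<lambda>x. f x * g x)"
proof (rule smooth_coinduct[of product_sum])
  show "product_sum (\<lambda>x. f x * g x)" using assms by (rule product)
  fix h assume "product_sum h"
  then show "\<exists>h'. product_sum h' \<and> (\<forall>x. (h has_real_derivative h' x) (at x))"
  proof induction
    case (product f g)
    show ?case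
    proof (intro exI conjI allI)
      show "product_sum (\<lambda>x. deriv f x * g x + deriv g x * f x)"
        using product by (intro product_sum.intros smooth_deriv)
      show "((\<lambda>x. f x * g x) has_real_derivative deriv f x * g x + deriv g x * f x) (at x)" for x
        using product by (intro DERIV_mult smooth_has_derivative)
    qed
  next
    case (sum f g)
    then obtain f' g' where "product_sum f'" "\<And>x. (f has_real_derivative f' x) (at x)"
      "product_sum g'" "\<And>x. (g has_real_derivative g' x) (at x)" by blast
    then show ?case
      by (intro exI[of _ "\<lambda>x. f' x + g' x"] conjI allI product_sum.sum DERIV_add)
  qed
qed

lemma smooth_affine:
  assumes "smooth f" shows "smooth (\<lambda>x. f (c * x + d))"
proof (rule smooth_coinduct[of "\<lambda>h. \<exists>k f. smooth f \<and> h = (\<lambda>x. k * f (c * x + d))"])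
  show "\<exists>k g. smooth g \<and> (\<lambda>x. f (c * x + d)) = (\<lambda>x. k * g (c * x + d))"
    using assms by (intro exI[of _ 1] exI[of _ f]) simp
  fix h assume "\<exists>k f. smooth f \<and> h = (\<lambda>x. k * f (c * x + d))"
  then obtain k f where f: "smooth f" "h = (\<lambda>x. k * f (c * x + d))" by blast
  have "((\<lambda>x. k * f (c * x + d)) has_real_derivative (k * c) * deriv f (c * x + d)) (at x)" for x
  proof -
    have "((\<lambda>x. f (c * x + d)) has_real_derivative deriv f (c * x + d) * c) (at x)"
      by (rule DERIV_chain2[OF smooth_has_derivative[OF f(1)]]) (auto intro!: derivative_eq_intros)
    from DERIV_cmult[OF this, of k] show ?thesis by (simp add: mult_ac)
  qed
  then show "\<exists>h'. (\<exists>k f. smooth f \<and> h' = (\<lambda>x. k * f (c * x + d))) \<and> (\<forall>x. (h has_real_derivative h' x) (at x))"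
    using f by (intro exI[of _ "\<lambda>x. (k * c) * deriv f (c * x + d)"]) (blast intro: smooth_deriv)
qed

lemma smooth_combination:
  assumes "smooth f" "smooth g" shows "smooth (\<lambda>x. f x + c * g x)"
proof (rule smooth_coinduct[of "\<lambda>h. \<exists>f g. smooth f \<and> smooth g \<and> h = (\<lambda>x. f x + c * g x)"])
  fix h assume "\<exists>f g. smooth f \<and> smooth g \<and> h = (\<lambda>x. f x + c * g x)"
  then obtain f g where f: "smooth f" "smooth g" "h = (\<lambda>x. f x + c * g x)" by blast
  then have "(h has_real_derivative deriv f x + c * deriv g x) (at x)" for x
    by (auto intro!: DERIV_add DERIV_cmult smooth_has_derivative)
  then show "\<exists>h'. (\<exists>f g. smooth f \<and> smooth g \<and> h' = (\<lambda>x. f x + c * g x)) \<and> (\<forall>x. (h has_real_derivative h' x) (at x))"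
    using f smooth_deriv by (intro exI[of _ "\<lambda>x. deriv f x + c * deriv g x"]) blast
qed (use assms in blast)

text \<open>\<open>bump 1\<close> is the classical smooth function \<open>exp (- 1 / s)\<close>
  continued by 0. The polynomial factor in \<open>1 / s\<close> makes the family closed under
  differentiation.\<close>

definition bump :: "real poly \<Rightarrow> real \<Rightarrow> real" where
  "bump p s = (if 0 < s then poly p (1 / s) * exp (- (1 / s)) else 0)"

lemma poly_exp_tendsto_0: "((\<lambda>x. poly p x * exp (- x)) \<longlongrightarrow> (0::real)) at_top"
proof -
  have "((\<lambda>x. \<Sum>i\<le>degree p. coeff p i * (x ^ i / exp x)) \<longlongrightarrow> (\<Sum>i\<le>degree p. coeff p i * 0)) at_top"
    by (intro tendsto_intros tendsto_power_div_exp_0)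
  then show ?thesis
    by (simp add: poly_altdef exp_minus sum_distrib_left divide_inverse mult_ac)
qed

text \<open>For positive \<open>s\<close>, the chain rule produces
  \<open>(p - p') (1 / s) / s^2\<close> in front of the exponential, and \<open>[:0, 0, 1:]\<close>
  encodes the division by \<open>s^2\<close>. At 0 the difference quotient is of the same shape with
  one more factor \<open>1 / s\<close>, and exponential decay outweighs any polynomial.\<close>

lemma bump_derivative:
  "(bump p has_real_derivative bump ([:0, 0, 1:] * (p - pderiv p)) s) (at s)"
proof -
  let ?q = "[:0, 0, 1:] * (p - pderiv p)"
  consider "s < 0" | "s = 0" | "s > 0" by linarith
  then show ?thesis
  proof cases
    case 1
    then have "((\<lambda>_. 0) has_real_derivative bump ?q s) (at s)" by (simp add: bump_def)
    then show ?thesis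
      by (rule has_field_derivative_transform_within_open[of _ _ _ "{..<0}"]) (use 1 in \<open>auto simp: bump_def\<close>)
  next
    case 3
    have "((\<lambda>s. poly p (1 / s) * exp (- (1 / s))) has_real_derivative
        poly p (1 / s) * (exp (- (1 / s)) * (1 / s\<^sup>2)) + poly (pderiv p) (1 / s) * (- 1 / s\<^sup>2) * exp (- (1 / s))) (at s)"
      using 3 by (auto intro!: derivative_eq_intros DERIV_chain2[OF poly_DERIV] simp: power2_eq_square)
    also have "poly p (1 / s) * (exp (- (1 / s)) * (1 / s\<^sup>2)) + poly (pderiv p) (1 / s) * (- 1 / s\<^sup>2) * exp (- (1 / s))
        = bump ?q s"
      using 3 by (simp add: bump_def field_simps power2_eq_square)
    finally show ?thesis
      by (rule has_field_derivative_transform_within_open[of _ _ _ "{0<..}"]) (use 3 in \<open>auto simp: bump_def\<close>)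
  next
    case 2
    have "((\<lambda>s. bump p s / s) \<longlongrightarrow> 0) (at_left 0)"
      by (rule tendsto_eventually) (auto simp: bump_def eventually_at_filter)
    moreover have "((\<lambda>s. bump p s / s) \<longlongrightarrow> 0) (at_right 0)"
    proof (rule Lim_transform_eventually)
      show "((\<lambda>s. poly ([:0, 1:] * p) (inverse s) * exp (- (inverse s))) \<longlongrightarrow> 0) (at_right 0)"
        by (rule filterlim_compose[OF poly_exp_tendsto_0 filterlim_inverse_at_top_right])
      show "\<forall>\<^sub>F s in at_right 0. poly ([:0, 1:] * p) (inverse s) * exp (- (inverse s)) = bump p s / s"
        using eventually_at_right_less[of "0::real"]
        by eventually_elim (simp add: bump_def divide_inverse)
    qed
    ultimately have "((\<lambda>s. bump p s / s) \<longlongrightarrow> 0) (at 0)" by (simp add: filterlim_split_at)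
    then show ?thesis using 2 by (simp add: has_field_derivative_iff bump_def)
  qed
qed

lemma smooth_bump: "smooth (bump p)"
  by (rule smooth_coinduct[of "\<lambda>f. \<exists>p. f = bump p"]) (use bump_derivative in blast)+

lemma bump_1_bounds: "0 \<le> bump 1 s" "bump 1 s \<le> 1"
  by (auto simp: bump_def)

lemma bump_1_tendsto:
  assumes "0 < t" shows "(\<lambda>n. bump 1 (real n * t - 1)) \<longlonglongrightarrow> 1"
proof (rule Lim_transform_eventually)
  have "filterlim (\<lambda>n. real n * t) at_top sequentially"
    using assms by (intro filterlim_at_top_mult_tendsto_pos[of _ t] filterlim_real_sequentially) auto
  then have f: "filterlim (\<lambda>n. real n * t - 1) at_top sequentially"
    using filterlim_tendsto_add_at_top[OF tendsto_const, of _ _ "-1::real"] by simp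
  have "(\<lambda>n. exp (- (inverse (real n * t - 1)))) \<longlonglongrightarrow> exp (- 0)"
    by (intro tendsto_exp tendsto_minus tendsto_inverse_0_at_top f)
  then show "(\<lambda>n. exp (- (inverse (real n * t - 1)))) \<longlonglongrightarrow> 1" by simp
  have "\<forall>\<^sub>F n in sequentially. 0 < real n * t - 1"
    using f unfolding filterlim_at_top_dense by blast
  then show "\<forall>\<^sub>F n in sequentially. exp (- (inverse (real n * t - 1))) = bump 1 (real n * t - 1)"
    by eventually_elim (simp add: bump_def divide_inverse)
qed

section \<open>Test functions\<close>

lemma integrable_bounded_scaleR:
  fixes v :: "real \<Rightarrow> 'a::euclidean_space"
  assumes v: "integrable (lebesgue_on {a..b}) v" and k: "k \<in> borel_measurable (lebesgue_on {a..b})"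
    and B: "\<And>s. s \<in> {a..b} \<Longrightarrow> \<bar>k s\<bar> \<le> B"
  shows "integrable (lebesgue_on {a..b}) (\<lambda>s. k s *\<^sub>R v s)"
proof (rule Bochner_Integration.integrable_bound)
  show "integrable (lebesgue_on {a..b}) (\<lambda>s. B *\<^sub>R norm (v s))" using v by simp
  show "(\<lambda>s. k s *\<^sub>R v s) \<in> borel_measurable (lebesgue_on {a..b})"
    using v k by (intro borel_measurable_scaleR) auto
  show "AE s in lebesgue_on {a..b}. norm (k s *\<^sub>R v s) \<le> norm (B *\<^sub>R norm (v s))"
  proof (rule AE_I2)
    fix s assume "s \<in> space (lebesgue_on {a..b})"
    then have "\<bar>k s\<bar> \<le> \<bar>B\<bar>" using B[of s] by (force simp: space_restrict_space)
    then show "norm (k s *\<^sub>R v s) \<le> norm (B *\<^sub>R norm (v s))"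
      by (auto simp: abs_mult intro: mult_right_mono)
  qed
qed

lemma test_fun_continuous: "test_fun a b \<phi> \<Longrightarrow> continuous_on A \<phi>"
  by (auto simp: test_fun_iff intro: smooth_continuous)

lemma test_fun_measurable: "test_fun a b \<phi> \<Longrightarrow> \<phi> \<in> borel_measurable (lebesgue_on {a..b})"
  by (intro continuous_imp_measurable_on_sets_lebesgue test_fun_continuous) auto

lemma test_fun_bounded:
  assumes "test_fun a b \<phi>" obtains B where "\<And>s. s \<in> {a..b} \<Longrightarrow> \<bar>\<phi> s\<bar> \<le> B"
  using compact_imp_bounded[OF compact_continuous_image[OF test_fun_continuous[OF assms] compact_Icc]]
  by (force simp: bounded_iff)

lemma test_fun_integrable:
  fixes u :: "real \<Rightarrow> 'a::euclidean_space"
  assumes "test_fun a b \<phi>" "integrable (lebesgue_on {a..b}) u"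
  shows "integrable (lebesgue_on {a..b}) (\<lambda>s. \<phi> s *\<^sub>R u s)"
  by (rule test_fun_bounded[OF assms(1)]) (use integrable_bounded_scaleR[OF assms(2) test_fun_measurable[OF assms(1)]] in blast)

lemma test_fun_combination:
  assumes "test_fun a b \<phi>" "test_fun a b \<psi>" shows "test_fun a b (\<lambda>x. \<phi> x + k * \<psi> x)"
proof -
  obtain c e where 1: "a < c" "e < b" "\<And>x. x \<notin> {c..e} \<Longrightarrow> \<phi> x = 0"
    using assms(1) by (auto simp: test_fun_iff)
  obtain c' e' where 2: "a < c'" "e' < b" "\<And>x. x \<notin> {c'..e'} \<Longrightarrow> \<psi> x = 0"
    using assms(2) by (auto simp: test_fun_iff)
  have "smooth (\<lambda>x. \<phi> x + k * \<psi> x)" using assms by (intro smooth_combination) (auto simp: test_fun_iff)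
  moreover have "\<phi> x + k * \<psi> x = 0" if "x \<notin> {min c c'..max e e'}" for x
  proof -
    have "x \<notin> {c..e}" "x \<notin> {c'..e'}" using that by auto
    then show ?thesis using 1(3) 2(3) by simp
  qed
  ultimately show ?thesis unfolding test_fun_iff using 1 2
    by (intro conjI exI[of _ "min c c'"] exI[of _ "max e e'"]) auto
qed

lemma test_fun_deriv:
  assumes "test_fun a b \<phi>" shows "test_fun a b (deriv \<phi>)"
proof -
  obtain c e where 1: "a < c" "e < b" "\<And>x. x \<notin> {c..e} \<Longrightarrow> \<phi> x = 0" and s: "smooth \<phi>"
    using assms by (auto simp: test_fun_iff)
  have "deriv \<phi> x = 0" if "x \<notin> {c..e}" for x
  proof -
    have "(\<phi> has_real_derivative 0) (at x)"
      by (rule has_field_derivative_transform_within_open[of "\<lambda>_. 0" 0 x "- {c..e}"]) (use that 1(3) in auto)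
    then show ?thesis by (rule DERIV_imp_deriv)
  qed
  then show ?thesis unfolding test_fun_iff using 1 smooth_deriv[OF s] by blast
qed

text \<open>As \<open>n\<close> grows, these cut-offs tend to the indicator of the open interval
  from \<open>x\<close> to \<open>b\<close>. The subtraction of 1 inside \<open>bump\<close> keeps
  their support at distance \<open>1 / n\<close> from both ends.\<close>

lemma test_fun_bump:
  assumes "a \<le> x" "0 < n"
  shows "test_fun a b (\<lambda>s. bump 1 (real n * (s - x) - 1) * bump 1 (real n * (b - s) - 1))"
proof -
  have "smooth (\<lambda>s. bump 1 (real n * s + (- real n * x - 1)) * bump 1 (- real n * s + (real n * b - 1)))"
    by (intro smooth_mult smooth_affine smooth_bump)
  also have "(\<lambda>s. bump 1 (real n * s + (- real n * x - 1)) * bump 1 (- real n * s + (real n * b - 1)))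
      = (\<lambda>s. bump 1 (real n * (s - x) - 1) * bump 1 (real n * (b - s) - 1))"
    by (simp add: algebra_simps)
  finally have "smooth (\<lambda>s. bump 1 (real n * (s - x) - 1) * bump 1 (real n * (b - s) - 1))" .
  moreover have "bump 1 (real n * (s - x) - 1) * bump 1 (real n * (b - s) - 1) = 0"
    if "s \<notin> {x + 1 / n..b - 1 / n}" for s
  proof -
    have "s - x \<le> 1 / n \<or> b - s \<le> 1 / n" using that by auto
    then have "real n * (s - x) - 1 \<le> 0 \<or> real n * (b - s) - 1 \<le> 0"
      using assms(2) by (auto simp: field_simps)
    then show ?thesis by (auto simp: bump_def)
  qed
  moreover have "0 < 1 / real n" using assms(2) by simp
  then have "a < x + 1 / real n" "b - 1 / real n < b" using assms(1) by linarith+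
  ultimately show ?thesis unfolding test_fun_iff by blast
qed

text \<open>The integral from \<open>a\<close> vanishes to the left of the support of
  \<open>\<psi>\<close> and is constant to the right of it; the zero mean makes that constant
  0.\<close>

lemma test_fun_primitive:
  assumes \<psi>: "test_fun a b \<psi>" and 0: "(LINT s|lebesgue_on {a..b}. \<psi> s) = 0" and ab: "a < b"
  obtains \<phi> where "test_fun a b \<phi>" "deriv \<phi> = \<psi>"
proof -
  obtain c e where c: "a < c" "e < b" "\<And>x. x \<notin> {c..e} \<Longrightarrow> \<psi> x = 0" and s: "smooth \<psi>"
    using \<psi> by (auto simp: test_fun_iff)
  have cont: "continuous_on A \<psi>" for A by (rule smooth_continuous[OF s])
  define \<phi> where "\<phi> x = integral {a..x} \<psi>" for x
  have low: "\<phi> x = 0" if "x < c" for x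
  proof -
    have "integral {a..x} \<psi> = integral {a..x} (\<lambda>_. 0)"
      by (rule integral_cong) (use that c(3) in auto)
    then show ?thesis by (simp add: \<phi>_def)
  qed
  have der: "(\<phi> has_real_derivative \<psi> x) (at x)" for x
  proof (cases "x < c")
    case True
    have "((\<lambda>_. 0) has_real_derivative \<psi> x) (at x)" using True c(3)[of x] by simp
    then show ?thesis
      by (rule has_field_derivative_transform_within_open[of _ _ _ "{..<c}"]) (use True low in auto)
  next
    case False
    have "(\<phi> has_real_derivative \<psi> x) (at x within {a..x + 1})"
      unfolding \<phi>_def using False c(1) by (intro integral_has_real_derivative cont) auto
    then show ?thesis using False c(1) at_within_interior[of x "{a..x + 1}"] by simp
  qed
  have "integral {a..b} \<psi> = 0"
    using 0 lebesgue_integral_eq_integral[of "{a..b}" \<psi>] continuous_imp_integrable_real[OF cont] by simp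
  then have "\<phi> b = 0" by (simp add: \<phi>_def)
  have high: "\<phi> x = 0" if "e < x" for x
  proof -
    have "\<phi> x = \<phi> b"
    proof -
      have "(\<phi> has_real_derivative 0) (at y)" if "y \<in> {e<..}" for y
        using der[of y] c(3)[of y] that by auto
      then have "\<phi> constant_on {e<..}" by (rule has_field_derivative_0_imp_constant_on) auto
      then show ?thesis using that c(2) by (auto simp: constant_on_def)
    qed
    then show ?thesis using \<open>\<phi> b = 0\<close> by simp
  qed
  have deq: "deriv \<phi> = \<psi>" using der by (auto intro: DERIV_imp_deriv)
  have "smooth \<phi>" unfolding smooth_def
  proof (intro allI)
    fix k x show "(deriv ^^ k) \<phi> field_differentiable at x"
    proof (cases k)
      case 0 then show ?thesis using der by (auto simp: field_differentiable_def)
    next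
      case (Suc m)
      then show ?thesis using s deq by (simp add: smooth_def funpow_swap1)
    qed
  qed
  then have "test_fun a b \<phi>" unfolding test_fun_iff using c low high
    by (intro conjI exI[of _ c] exI[of _ e]) auto
  then show ?thesis using deq that by blast
qed

text \<open>The positive and the negative part of \<open>g\<close> are densities of two measures
  that agree on rays and hence coincide. Uniqueness of densities makes the two parts equal almost
  everywhere, and at most one of them is nonzero at each point.\<close>

lemma AE_zero_if_ray_integrals_zero:
  fixes g :: "real \<Rightarrow> real"
  assumes g: "integrable lborel g" and z: "\<And>x. (LINT s|lborel. indicator {x<..} s * g s) = 0"
  shows "AE s in lborel. g s = 0"
proof -
  have [measurable]: "g \<in> borel_measurable lborel" using g by (rule borel_measurable_integrable)
  let ?f = "\<lambda>s. ennreal (max 0 (g s))" and ?h = "\<lambda>s. ennreal (max 0 (- g s))"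
  have int: "integrable lborel (\<lambda>s. max 0 (g s))" "integrable lborel (\<lambda>s. max 0 (- g s))"
    using g by (auto intro: integrable_max)
  have ii: "integrable lborel (\<lambda>s. indicator {x<..} s * max 0 (g s))"
    "integrable lborel (\<lambda>s. indicator {x<..} s * max 0 (- g s))" for x
    using integrable_mult_indicator[OF _ int(1), of "{x<..}"]
      integrable_mult_indicator[OF _ int(2), of "{x<..}"] by simp_all
  have f: "emeasure (density lborel ?f) {x<..} = ennreal (LINT s|lborel. indicator {x<..} s * max 0 (g s))" for x
    by (subst emeasure_density, simp, simp, subst nn_integral_eq_integral[symmetric])
      (auto simp: ii intro!: nn_integral_cong split: split_indicator)
  have h: "emeasure (density lborel ?h) {x<..} = ennreal (LINT s|lborel. indicator {x<..} s * max 0 (- g s))" for x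
    by (subst emeasure_density, simp, simp, subst nn_integral_eq_integral[symmetric])
      (auto simp: ii intro!: nn_integral_cong split: split_indicator)
  have "(LINT s|lborel. indicator {x<..} s * max 0 (g s)) - (LINT s|lborel. indicator {x<..} s * max 0 (- g s)) = 0" for x
  proof -
    have "(\<lambda>s. indicator {x<..} s * max 0 (g s) - indicator {x<..} s * max 0 (- g s)) = (\<lambda>s. indicator {x<..} s * g s)"
      by (auto simp: max_def split: split_indicator)
    then show ?thesis using z[of x] Bochner_Integration.integral_diff[OF ii(1)[of x] ii(2)[of x]] by simp
  qed
  then have "density lborel ?f = density lborel ?h"
    by (intro measure_eqI_lessThan) (auto simp: f h)
  then have "AE s in lborel. ?f s = ?h s"
    by (subst (asm) sigma_finite_measure.density_unique_iff[OF sigma_finite_lborel]) auto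
  then show ?thesis by eventually_elim (auto simp: max_def split: if_splits)
qed

lemma AE_lebesgue_on_neq: "AE s in lebesgue_on {a..b}. s \<noteq> (c::real)"
  using AE_completion[OF AE_lborel_singleton[of c]]
  by (auto simp: AE_restrict_space_iff elim: eventually_mono)

text \<open>Bounded test functions approximate indicators of rays, so dominated convergence turns
  the hypothesis into vanishing ray integrals; the rest is done for each coordinate.\<close>

lemma fundamental_lemma:
  fixes w :: "real \<Rightarrow> 'a::euclidean_space"
  assumes ab: "a < b" and w: "integrable (lebesgue_on {a..b}) w"
    and test: "\<And>\<phi>. test_fun a b \<phi> \<Longrightarrow> (LINT s|lebesgue_on {a..b}. \<phi> s *\<^sub>R w s) = 0"
  shows "AE s in lebesgue_on {a..b}. w s = 0"
proof -
  let ?M = "lebesgue_on {a..b}"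
  have wm: "w \<in> borel_measurable ?M" using w by (rule borel_measurable_integrable)
  have ind: "integrable ?M (\<lambda>s. indicator {x<..} s *\<^sub>R w s)" for x
  proof (rule Bochner_Integration.integrable_bound[OF w])
    show "(\<lambda>s. indicator {x<..} s *\<^sub>R w s) \<in> borel_measurable ?M"
      by (intro borel_measurable_scaleR wm measurable_restrict_space1 borel_measurable_indicator) auto
  qed (auto split: split_indicator)
  have ray: "(LINT s|?M. indicator {x<..} s *\<^sub>R w s) = 0" for x
  proof -
    \<comment> \<open>\<open>test_fun_bump\<close> needs a point not left of \<open>a\<close>.
      Within \<open>{a..b}\<close> this changes the indicator at most at \<open>a\<close>, which is
      a null set.\<close>
    define x' where "x' = max a x"
    define \<psi> where "\<psi> n s = bump 1 (real (Suc n) * (s - x') - 1) * bump 1 (real (Suc n) * (b - s) - 1)" for n s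
    have "(\<lambda>n. LINT s|?M. \<psi> n s *\<^sub>R w s) \<longlonglongrightarrow> (LINT s|?M. indicator {x<..} s *\<^sub>R w s)"
    proof (rule integral_dominated_convergence[where w = "\<lambda>s. norm (w s)"])
      show "AE s in ?M. (\<lambda>n. \<psi> n s *\<^sub>R w s) \<longlonglongrightarrow> indicator {x<..} s *\<^sub>R w s"
        using AE_lebesgue_on_neq[where c = a] AE_lebesgue_on_neq[where c = b] AE_space
      proof eventually_elim
        case (elim s)
        then have s: "a < s" "s < b" by (auto simp: space_restrict_space)
        have "(\<lambda>n. \<psi> n s) \<longlonglongrightarrow> indicator {x<..} s"
        proof (cases "x < s")
          case True
          then have "0 < s - x'" "0 < b - s" using s by (auto simp: x'_def)
          from tendsto_mult[OF this[THEN bump_1_tendsto, THEN LIMSEQ_Suc]]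
          show ?thesis using True by (simp add: \<psi>_def)
        next
          case False
          then have "s - x' \<le> 0" by (auto simp: x'_def)
          then have "real (Suc n) * (s - x') \<le> 0" for n by (rule mult_nonneg_nonpos[OF of_nat_0_le_iff])
          then have "\<psi> n s = 0" for n
            unfolding \<psi>_def bump_def by (smt (verit) mult_eq_0_iff)
          then show ?thesis using False by simp
        qed
        then show ?case by (intro tendsto_scaleR tendsto_const)
      qed
      have "\<bar>\<psi> n s\<bar> \<le> 1" for n s
        using bump_1_bounds by (auto simp: \<psi>_def abs_mult intro!: mult_le_one)
      then show "AE s in ?M. norm (\<psi> n s *\<^sub>R w s) \<le> norm (w s)" for n
        by (auto intro!: mult_left_le_one_le)
      show "(\<lambda>s. \<psi> n s *\<^sub>R w s) \<in> borel_measurable ?M" for n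
      proof (intro borel_measurable_scaleR wm)
        have "test_fun a b (\<psi> n)" unfolding \<psi>_def by (intro test_fun_bump) (auto simp: x'_def)
        then show "\<psi> n \<in> borel_measurable ?M"
          by (intro continuous_imp_measurable_on_sets_lebesgue smooth_continuous) (auto simp: test_fun_iff)
      qed
      show "(\<lambda>s. indicator {x<..} s *\<^sub>R w s) \<in> borel_measurable ?M"
        by (rule borel_measurable_integrable[OF ind])
    qed (use w in simp)
    moreover have "(LINT s|?M. \<psi> n s *\<^sub>R w s) = 0" for n
      unfolding \<psi>_def by (intro test test_fun_bump) (auto simp: x'_def)
    ultimately show ?thesis by (simp add: LIMSEQ_const_iff)
  qed
  have comp: "AE s in ?M. w s \<bullet> i = 0" for i
  proof -
    define f where "f s = indicat_real {a..b} s * (w s \<bullet> i)" for s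
    have f: "integrable lebesgue f"
      using integrable_inner_left[OF w, of i] by (simp add: integrable_restrict_space f_def[abs_def])
    \<comment> \<open>A Borel representative, because the comparison of measures takes place over
      \<open>lborel\<close>.\<close>
    obtain g where g: "g \<in> borel_measurable lborel" and fg: "AE s in lborel. f s = g s"
      using completion_ex_borel_measurable_real[OF borel_measurable_integrable[OF f]] by auto
    have fg': "AE s in lebesgue. f s = g s" using fg by (rule AE_completion)
    have gl: "g \<in> borel_measurable lebesgue" using g by (rule measurable_completion)
    have "integrable lebesgue g" using integrable_cong_AE_imp[OF f gl fg'] .
    then have gi: "integrable lborel g" using g by (simp add: integrable_completion)
    have "(LINT s|lborel. indicator {x<..} s * g s) = 0" for x
    proof -
      have "(LINT s|lborel. indicator {x<..} s * g s) = (LINT s|lebesgue. indicator {x<..} s * g s)"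
        by (intro integral_completion[symmetric] borel_measurable_times borel_measurable_indicator g) auto
      also have "\<dots> = (LINT s|lebesgue. indicator {x<..} s * f s)"
      proof (rule integral_cong_AE)
        show "AE s in lebesgue. indicator {x<..} s * g s = indicator {x<..} s * f s"
          using fg' by eventually_elim simp
      qed (use gl f in \<open>auto intro!: borel_measurable_times borel_measurable_indicator\<close>)
      also have "\<dots> = (LINT s|?M. (indicator {x<..} s *\<^sub>R w s) \<bullet> i)"
        by (simp add: integral_restrict_space f_def mult_ac)
      also have "\<dots> = (LINT s|?M. indicator {x<..} s *\<^sub>R w s) \<bullet> i"
        by (rule integral_inner_left) (rule ind)
      finally show ?thesis by (simp add: ray)
    qed
    from AE_zero_if_ray_integrals_zero[OF gi this]
    have "AE s in lebesgue. g s = 0" by (rule AE_completion)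
    with fg' have "AE s in lebesgue. f s = 0" by eventually_elim simp
    then show ?thesis by (auto simp: AE_restrict_space_iff f_def elim: eventually_mono)
  qed
  have "AE s in ?M. \<forall>i\<in>Basis. w s \<bullet> i = 0"
    using comp by (intro AE_finite_allI) auto
  then show ?thesis by eventually_elim (simp only: euclidean_all_zero_iff)
qed

text \<open>Subtracting a suitable multiple of a fixed \<open>\<psi>0\<close> of nonzero mean turns
  any test function into one of mean zero, hence into the derivative of a test function. The
  constant is accordingly the mean of \<open>w\<close> weighted by \<open>\<psi>0\<close>.\<close>

lemma du_bois_reymond:
  fixes w :: "real \<Rightarrow> 'a::euclidean_space"
  assumes ab: "a < b" and w: "integrable (lebesgue_on {a..b}) w"
    and test: "\<And>\<phi>. test_fun a b \<phi> \<Longrightarrow> (LINT s|lebesgue_on {a..b}. deriv \<phi> s *\<^sub>R w s) = 0"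
  shows "\<exists>c. AE s in lebesgue_on {a..b}. w s = c"
proof -
  let ?M = "lebesgue_on {a..b}"
  have int1: "integrable ?M \<phi>" if "test_fun a b \<phi>" for \<phi>
    using test_fun_integrable[OF that, of "\<lambda>_. 1::real"] by simp
  \<comment> \<open>If every test function had mean zero, the fundamental lemma would make the
    constant 1 vanish almost everywhere.\<close>
  obtain \<psi>0 where \<psi>0: "test_fun a b \<psi>0" "(LINT s|?M. \<psi>0 s) \<noteq> 0"
  proof (rule ccontr)
    assume "\<not> thesis"
    then have "AE s in ?M. (1::real) = 0"
      using that by (intro fundamental_lemma ab) auto
    then show False using ab
      by (simp add: trivial_limit_def[symmetric] ae_filter_eq_bot_iff emeasure_restrict_space
          space_restrict_space)
  qed
  define I where "I = (LINT s|?M. \<psi>0 s)"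
  define c where "c = (1 / I) *\<^sub>R (LINT s|?M. \<psi>0 s *\<^sub>R w s)"
  have "AE s in ?M. w s - c = 0"
  proof (rule fundamental_lemma[OF ab])
    show "integrable ?M (\<lambda>s. w s - c)" using w by (intro Bochner_Integration.integrable_diff) auto
    fix \<phi> assume \<phi>: "test_fun a b \<phi>"
    define k where "k = - (LINT s|?M. \<phi> s) / I"
    have "test_fun a b (\<lambda>s. \<phi> s + k * \<psi>0 s)" using \<phi> \<psi>0 by (intro test_fun_combination)
    moreover have "(LINT s|?M. \<phi> s + k * \<psi>0 s) = 0"
      using \<psi>0(2) int1[OF \<phi>] int1[OF \<psi>0(1)] by (simp add: k_def I_def)
    ultimately obtain \<eta> where "test_fun a b \<eta>" "deriv \<eta> = (\<lambda>s. \<phi> s + k * \<psi>0 s)"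
      using test_fun_primitive ab by metis
    with test have "(LINT s|?M. (\<phi> s + k * \<psi>0 s) *\<^sub>R w s) = 0" by metis
    then have "(LINT s|?M. \<phi> s *\<^sub>R w s) = - (k *\<^sub>R (LINT s|?M. \<psi>0 s *\<^sub>R w s))"
      using test_fun_integrable[OF \<phi> w] test_fun_integrable[OF \<psi>0(1) w]
      by (simp add: scaleR_add_left eq_neg_iff_add_eq_0 flip: scaleR_scaleR)
    also have "\<dots> = (LINT s|?M. \<phi> s) *\<^sub>R c" by (simp add: k_def c_def)
    finally show "(LINT s|?M. \<phi> s *\<^sub>R (w s - c)) = 0"
      using test_fun_integrable[OF \<phi> w] int1[OF \<phi>] by (simp add: scaleR_diff_right)
  qed
  then show ?thesis by (intro exI[of _ c]) (auto elim: eventually_mono)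
qed

section \<open>Volterra operators and weak derivatives\<close>

lemma finite_measure_ivl: "finite_measure (lebesgue_on {a..b::real})"
  by (metis cbox_interval finite_measure_lebesgue_on lmeasurable_cbox)

lemma fubini_kernel:
  fixes v :: "real \<Rightarrow> 'a::euclidean_space"
  assumes v: "integrable (lebesgue_on {a..b}) v"
    and k: "case_prod k \<in> borel_measurable (lebesgue_on {a..b} \<Otimes>\<^sub>M lebesgue_on {a..b})"
    and B: "\<And>s \<theta>. s \<in> {a..b} \<Longrightarrow> \<theta> \<in> {a..b} \<Longrightarrow> \<bar>k s \<theta>\<bar> \<le> B"
  shows "(LINT s|lebesgue_on {a..b}. LINT \<theta>|lebesgue_on {a..b}. k s \<theta> *\<^sub>R v \<theta>)
    = (LINT \<theta>|lebesgue_on {a..b}. (LINT s|lebesgue_on {a..b}. k s \<theta>) *\<^sub>R v \<theta>)"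
proof -
  let ?M = "lebesgue_on {a..b}"
  interpret M: finite_measure ?M by (rule finite_measure_ivl)
  interpret pair_sigma_finite ?M ?M ..
  have vm [measurable]: "v \<in> borel_measurable ?M" using v by (rule borel_measurable_integrable)
  have "integrable (?M \<Otimes>\<^sub>M ?M) (\<lambda>(s, \<theta>). norm (v \<theta>))"
    by (rule Fubini_integrable) (use v in auto)
  then have "integrable (?M \<Otimes>\<^sub>M ?M) (\<lambda>p. B *\<^sub>R (case p of (s, \<theta>) \<Rightarrow> norm (v \<theta>)))" by simp
  then have int: "integrable (?M \<Otimes>\<^sub>M ?M) (\<lambda>(s, \<theta>). k s \<theta> *\<^sub>R v \<theta>)"
  proof (rule Bochner_Integration.integrable_bound)
    have "(\<lambda>p. case_prod k p *\<^sub>R v (snd p)) \<in> borel_measurable (?M \<Otimes>\<^sub>M ?M)"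
      by (intro borel_measurable_scaleR k) measurable
    then show "(\<lambda>(s, \<theta>). k s \<theta> *\<^sub>R v \<theta>) \<in> borel_measurable (?M \<Otimes>\<^sub>M ?M)"
      by (simp add: case_prod_beta)
    show "AE p in ?M \<Otimes>\<^sub>M ?M. norm (case p of (s, \<theta>) \<Rightarrow> k s \<theta> *\<^sub>R v \<theta>)
        \<le> norm (B *\<^sub>R (case p of (s, \<theta>) \<Rightarrow> norm (v \<theta>)))"
    proof (rule AE_I2)
      fix p assume "p \<in> space (?M \<Otimes>\<^sub>M ?M)"
      then obtain s \<theta> where p: "p = (s, \<theta>)" "s \<in> {a..b}" "\<theta> \<in> {a..b}"
        by (auto simp: space_pair_measure space_restrict_space)
      then have "\<bar>k s \<theta>\<bar> \<le> \<bar>B\<bar>" using B[of s \<theta>] by linarith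
      then show "norm (case p of (s, \<theta>) \<Rightarrow> k s \<theta> *\<^sub>R v \<theta>) \<le> norm (B *\<^sub>R (case p of (s, \<theta>) \<Rightarrow> norm (v \<theta>)))"
        by (auto simp: p(1) abs_mult intro: mult_right_mono)
    qed
  qed
  have "(LINT s|?M. k s \<theta> *\<^sub>R v \<theta>) = (LINT s|?M. k s \<theta>) *\<^sub>R v \<theta>" if "\<theta> \<in> {a..b}" for \<theta>
  proof (rule integral_scaleR_left)
    have "(\<lambda>s. case_prod k (s, \<theta>)) \<in> borel_measurable ?M"
      by (rule measurable_compose[OF _ k]) (use that in \<open>simp add: space_restrict_space\<close>)
    then show "integrable ?M (\<lambda>s. k s \<theta>)"
      using integrable_bounded_scaleR[of a b "\<lambda>_. 1::real" "\<lambda>s. k s \<theta>" B] B that by simp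
  qed
  then have "(LINT \<theta>|?M. LINT s|?M. k s \<theta> *\<^sub>R v \<theta>) = (LINT \<theta>|?M. (LINT s|?M. k s \<theta>) *\<^sub>R v \<theta>)"
    by (intro Bochner_Integration.integral_cong refl) (auto simp: space_restrict_space)
  with Fubini_integral[OF int] show ?thesis by simp
qed

lemma integral_indicator_subinterval:
  fixes f :: "real \<Rightarrow> 'a::euclidean_space"
  assumes "a \<le> p" "q \<le> b"
  shows "(LINT r|lebesgue_on {a..b}. indicator {p..q} r *\<^sub>R f r) = (LINT r|lebesgue_on {p..q}. f r)"
proof -
  have "indicat_real {a..b} r *\<^sub>R indicat_real {p..q} r *\<^sub>R f r = indicat_real {p..q} r *\<^sub>R f r" for r
    using assms by (auto split: split_indicator)
  then show ?thesis by (simp add: integral_restrict_space del: scaleR_scaleR)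
qed

text \<open>The kernel of \<open>m + 1\<close> successive integrations from \<open>a\<close>, by
  Cauchy's formula for repeated integration. Continuing it by 0 beyond \<open>s\<close> lets all
  integrals run over \<open>{a..b}\<close>, as in \<open>Top\<close>.\<close>

definition vkernel :: "nat \<Rightarrow> real \<Rightarrow> real \<Rightarrow> real" where
  "vkernel m s \<theta> = (if \<theta> \<le> s then (s - \<theta>) ^ m / fact m else 0)"

definition volterra :: "real \<Rightarrow> real \<Rightarrow> nat \<Rightarrow> (real \<Rightarrow> 'a::euclidean_space) \<Rightarrow> real \<Rightarrow> 'a" where
  "volterra a b m v s = (LINT \<theta>|lebesgue_on {a..b}. vkernel m s \<theta> *\<^sub>R v \<theta>)"

lemma vkernel_bound:
  assumes "s \<in> {a..b}" "\<theta> \<in> {a..b}" shows "\<bar>vkernel m s \<theta>\<bar> \<le> (b - a) ^ m / fact m"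
  using assms by (auto simp: vkernel_def intro!: divide_right_mono power_mono)

lemma vkernel_measurable_pair:
  "(\<lambda>(s, \<theta>). vkernel m s \<theta>) \<in> borel_measurable (lebesgue_on {a..b} \<Otimes>\<^sub>M lebesgue_on {a..b})"
proof -
  have id: "(\<lambda>s::real. s) \<in> borel_measurable (lebesgue_on {a..b})"
    by (intro measurable_restrict_space1 measurable_completion) simp
  note [measurable] = measurable_compose[OF measurable_fst id] measurable_compose[OF measurable_snd id]
  show ?thesis unfolding vkernel_def case_prod_beta by measurable
qed

lemma vkernel_measurable: "vkernel m s \<in> borel_measurable (lebesgue_on {a..b})"
proof -
  have "(\<lambda>\<theta>. if \<theta> \<le> s then (s - \<theta>) ^ m / fact m else 0) \<in> borel_measurable borel" by measurable
  then show ?thesis unfolding vkernel_def by (intro measurable_restrict_space1 measurable_completion) simp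
qed

lemma vkernel_integrable:
  fixes v :: "real \<Rightarrow> 'a::euclidean_space"
  assumes "integrable (lebesgue_on {a..b}) v" "s \<in> {a..b}"
  shows "integrable (lebesgue_on {a..b}) (\<lambda>\<theta>. vkernel m s \<theta> *\<^sub>R v \<theta>)"
  using vkernel_bound[OF assms(2)] by (rule integrable_bounded_scaleR[OF assms(1) vkernel_measurable])

lemma volterra_cong_AE:
  assumes "integrable (lebesgue_on {a..b}) u" "integrable (lebesgue_on {a..b}) v"
    "AE \<theta> in lebesgue_on {a..b}. u \<theta> = v \<theta>"
  shows "volterra a b m u s = volterra a b m v s"
  unfolding volterra_def
proof (rule integral_cong_AE)
  show "AE \<theta> in lebesgue_on {a..b}. vkernel m s \<theta> *\<^sub>R u \<theta> = vkernel m s \<theta> *\<^sub>R v \<theta>"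
    using assms(3) by eventually_elim simp
qed (intro borel_measurable_scaleR vkernel_measurable borel_measurable_integrable[OF assms(1)]
    borel_measurable_integrable[OF assms(2)])+

lemma volterra_add:
  assumes "integrable (lebesgue_on {a..b}) u" "integrable (lebesgue_on {a..b}) v" "s \<in> {a..b}"
  shows "volterra a b m (\<lambda>\<theta>. u \<theta> + v \<theta>) s = volterra a b m u s + volterra a b m v s"
  using vkernel_integrable[OF assms(1,3), of m] vkernel_integrable[OF assms(2,3), of m]
  by (simp add: volterra_def scaleR_add_right)

lemma volterra_scale: "volterra a b m (\<lambda>\<theta>. c *\<^sub>R v \<theta>) s = c *\<^sub>R volterra a b m v s"
proof -
  have "(\<lambda>\<theta>. vkernel m s \<theta> *\<^sub>R c *\<^sub>R v \<theta>) = (\<lambda>\<theta>. c *\<^sub>R vkernel m s \<theta> *\<^sub>R v \<theta>)" by (simp add: mult.commute)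
  then show ?thesis by (simp only: volterra_def integral_scaleR_right)
qed

lemma volterra_sum:
  assumes "\<And>i. i \<in> I \<Longrightarrow> integrable (lebesgue_on {a..b}) (u i)" "s \<in> {a..b}"
  shows "volterra a b m (\<lambda>\<theta>. \<Sum>i\<in>I. u i \<theta>) s = (\<Sum>i\<in>I. volterra a b m (u i) s)"
  using vkernel_integrable[OF assms(1) assms(2), of _ m]
  by (simp add: volterra_def scaleR_sum_right)

lemma volterra_norm_bound:
  assumes "integrable (lebesgue_on {a..b}) v" "s \<in> {a..b}"
  shows "norm (volterra a b m v s) \<le> (b - a) ^ m / fact m * (LINT \<theta>|lebesgue_on {a..b}. norm (v \<theta>))"
proof -
  have "norm (volterra a b m v s) \<le> (LINT \<theta>|lebesgue_on {a..b}. norm (vkernel m s \<theta> *\<^sub>R v \<theta>))"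
    unfolding volterra_def by (rule integral_norm_bound)
  also have "\<dots> \<le> (LINT \<theta>|lebesgue_on {a..b}. (b - a) ^ m / fact m * norm (v \<theta>))"
  proof (rule integral_mono)
    show "norm (vkernel m s \<theta> *\<^sub>R v \<theta>) \<le> (b - a) ^ m / fact m * norm (v \<theta>)"
      if "\<theta> \<in> space (lebesgue_on {a..b})" for \<theta>
      unfolding norm_scaleR using that vkernel_bound[OF assms(2), of \<theta> m]
      by (intro mult_right_mono) (auto simp: space_restrict_space)
  qed (intro integrable_norm vkernel_integrable integrable_mult_right assms)+
  finally show ?thesis by simp
qed

lemma integral_vkernel:
  assumes "s \<in> {a..b}" "\<theta> \<in> {a..b}"
  shows "(LINT r|lebesgue_on {a..b}. vkernel 0 s r * vkernel m r \<theta>) = vkernel (Suc m) s \<theta>"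
proof (cases "\<theta> \<le> s")
  case True
  have "((\<lambda>r. (r - \<theta>) ^ m / fact m) has_integral
      ((s - \<theta>) ^ Suc m / fact (Suc m) - (\<theta> - \<theta>) ^ Suc m / fact (Suc m))) {\<theta>..s}"
  proof (rule fundamental_theorem_of_calculus[OF True])
    fix r
    have "((\<lambda>r. r - \<theta>) has_real_derivative 1) (at r within {\<theta>..s})"
      by (auto intro!: derivative_eq_intros)
    from DERIV_cdivide[OF DERIV_power[OF this, of "Suc m"], of "fact (Suc m)"]
    have "((\<lambda>r. (r - \<theta>) ^ Suc m / fact (Suc m)) has_real_derivative
        (real (Suc m) * (r - \<theta>) ^ m) / fact (Suc m)) (at r within {\<theta>..s})"
      by (simp del: power_Suc of_nat_Suc fact_Suc)
    then show "((\<lambda>r. (r - \<theta>) ^ Suc m / fact (Suc m)) has_vector_derivative (r - \<theta>) ^ m / fact m) (at r within {\<theta>..s})"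
      by (simp add: has_real_derivative_iff_has_vector_derivative del: power_Suc of_nat_Suc)
  qed
  from integral_unique[OF this]
  have hk: "integral {\<theta>..s} (\<lambda>r. (r - \<theta>) ^ m / fact m) = (s - \<theta>) ^ Suc m / fact (Suc m)"
    by (simp del: fact_Suc)
  have "(\<lambda>r. vkernel 0 s r * vkernel m r \<theta>) = (\<lambda>r. indicator {\<theta>..s} r *\<^sub>R ((r - \<theta>) ^ m / fact m))"
    by (auto simp: vkernel_def split: split_indicator)
  then have "(LINT r|lebesgue_on {a..b}. vkernel 0 s r * vkernel m r \<theta>)
      = (LINT r|lebesgue_on {a..b}. indicator {\<theta>..s} r *\<^sub>R ((r - \<theta>) ^ m / fact m))"
    by (simp only:)
  also have "\<dots> = (LINT r|lebesgue_on {\<theta>..s}. (r - \<theta>) ^ m / fact m)"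
    using assms by (intro integral_indicator_subinterval) auto
  also have "\<dots> = integral {\<theta>..s} (\<lambda>r. (r - \<theta>) ^ m / fact m)"
    by (rule lebesgue_integral_eq_integral)
      (auto intro!: continuous_imp_integrable_real continuous_intros)
  finally have "(LINT r|lebesgue_on {a..b}. vkernel 0 s r * vkernel m r \<theta>) = (s - \<theta>) ^ Suc m / fact (Suc m)"
    unfolding hk .
  then show ?thesis using True by (simp only: vkernel_def if_True)
next
  case False
  then have "(\<lambda>r. vkernel 0 s r * vkernel m r \<theta>) = (\<lambda>_. 0)" by (auto simp: vkernel_def)
  then show ?thesis using False by (simp add: vkernel_def)
qed

lemma volterra_volterra:
  assumes v: "integrable (lebesgue_on {a..b}) v" and s: "s \<in> {a..b}"
  shows "volterra a b 0 (volterra a b m v) s = volterra a b (Suc m) v s"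
proof -
  let ?M = "lebesgue_on {a..b}"
  have "volterra a b 0 (volterra a b m v) s = (LINT r|?M. LINT \<theta>|?M. (vkernel 0 s r * vkernel m r \<theta>) *\<^sub>R v \<theta>)"
    by (simp add: volterra_def flip: scaleR_scaleR)
  also have "\<dots> = (LINT \<theta>|?M. (LINT r|?M. vkernel 0 s r * vkernel m r \<theta>) *\<^sub>R v \<theta>)"
  proof (rule fubini_kernel[OF v])
    have "(\<lambda>p. vkernel 0 s (fst p) * case_prod (vkernel m) p) \<in> borel_measurable (?M \<Otimes>\<^sub>M ?M)"
      using measurable_compose[OF measurable_fst vkernel_measurable] vkernel_measurable_pair
      by (intro borel_measurable_times) auto
    then show "(\<lambda>(r, \<theta>). vkernel 0 s r * vkernel m r \<theta>) \<in> borel_measurable (?M \<Otimes>\<^sub>M ?M)"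
      by (simp add: case_prod_beta)
    show "\<bar>vkernel 0 s r * vkernel m r \<theta>\<bar> \<le> (b - a) ^ 0 / fact 0 * ((b - a) ^ m / fact m)"
      if "r \<in> {a..b}" "\<theta> \<in> {a..b}" for r \<theta>
      unfolding abs_mult using that s by (intro mult_mono vkernel_bound) auto
  qed
  also have "\<dots> = volterra a b (Suc m) v s"
    unfolding volterra_def using s
    by (intro Bochner_Integration.integral_cong refl) (simp add: integral_vkernel space_restrict_space)
  finally show ?thesis .
qed

lemma volterra_monomial:
  assumes "s \<in> {a..b}"
  shows "volterra a b 0 (\<lambda>r. ((r - a) ^ m / fact m) *\<^sub>R c) s = ((s - a) ^ Suc m / fact (Suc m)) *\<^sub>R c"
proof -
  have a: "a \<in> {a..b}" using assms by auto
  have "volterra a b 0 (\<lambda>r. ((r - a) ^ m / fact m) *\<^sub>R c) s = (LINT r|lebesgue_on {a..b}. (vkernel 0 s r * vkernel m r a) *\<^sub>R c)"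
    unfolding volterra_def by (intro Bochner_Integration.integral_cong) (auto simp: space_restrict_space vkernel_def)
  also have "\<dots> = (LINT r|lebesgue_on {a..b}. vkernel 0 s r * vkernel m r a) *\<^sub>R c"
  proof (rule integral_scaleR_left)
    have "continuous_on {a..b} (\<lambda>r. (r - a) ^ m / fact m)" by (auto intro!: continuous_intros)
    then have "integrable (lebesgue_on {a..b}) (\<lambda>r. (r - a) ^ m / fact m)" by (rule continuous_imp_integrable_real)
    from vkernel_integrable[OF this assms, of 0]
    have "integrable (lebesgue_on {a..b}) (\<lambda>r. vkernel 0 s r *\<^sub>R ((r - a) ^ m / fact m))" .
    also have "?this \<longleftrightarrow> integrable (lebesgue_on {a..b}) (\<lambda>r. vkernel 0 s r * vkernel m r a)"
      by (intro Bochner_Integration.integrable_cong) (auto simp: space_restrict_space vkernel_def)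
    finally show "integrable (lebesgue_on {a..b}) (\<lambda>r. vkernel 0 s r * vkernel m r a)" .
  qed
  also have "\<dots> = ((s - a) ^ Suc m / fact (Suc m)) *\<^sub>R c"
    using assms by (simp only: integral_vkernel[OF assms a]) (simp add: vkernel_def)
  finally show ?thesis .
qed

lemma volterra_0_eq_integral:
  assumes v: "integrable (lebesgue_on {a..b}) v" and s: "s \<in> {a..b}"
  shows "volterra a b 0 v s = integral {a..s} v"
proof -
  have "volterra a b 0 v s = (LINT r|lebesgue_on {a..b}. indicator {a..s} r *\<^sub>R v r)"
    unfolding volterra_def
    by (intro Bochner_Integration.integral_cong) (auto simp: vkernel_def space_restrict_space split: split_indicator)
  also have "\<dots> = (LINT r|lebesgue_on {a..s}. v r)" using s by (intro integral_indicator_subinterval) auto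
  also have "\<dots> = integral {a..s} v"
  proof (rule lebesgue_integral_eq_integral)
    have "integrable lebesgue (\<lambda>r. indicat_real {a..s} r *\<^sub>R indicat_real {a..b} r *\<^sub>R v r)"
      using v by (intro integrable_mult_indicator[of _ lebesgue "\<lambda>r. indicat_real {a..b} r *\<^sub>R v r"])
        (auto simp: integrable_restrict_space)
    also have "(\<lambda>r. indicat_real {a..s} r *\<^sub>R indicat_real {a..b} r *\<^sub>R v r) = (\<lambda>r. indicat_real {a..s} r *\<^sub>R v r)"
      using s by (auto split: split_indicator)
    finally show "integrable (lebesgue_on {a..s}) v" by (simp add: integrable_restrict_space)
  qed simp
  finally show ?thesis .
qed

lemma volterra_at_left:
  assumes "a \<le> b" shows "volterra a b m v a = 0"
proof -
  have "AE \<theta> in lebesgue_on {a..b}. vkernel m a \<theta> *\<^sub>R v \<theta> = 0"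
    using AE_lebesgue_on_neq[where c = a] AE_space by eventually_elim (auto simp: vkernel_def space_restrict_space)
  then show ?thesis unfolding volterra_def by (rule integral_eq_zero_AE)
qed

lemma continuous_volterra_0:
  assumes v: "integrable (lebesgue_on {a..b}) v"
  shows "continuous_on {a..b} (volterra a b 0 v)"
proof -
  have "v integrable_on {a..b}" using v by (rule integrable_on_lebesgue_on) simp
  then have "continuous_on {a..b} (\<lambda>s. integral {a..s} v)" by (rule indefinite_integral_continuous_1)
  then show ?thesis by (rule continuous_on_eq) (simp add: volterra_0_eq_integral[OF v])
qed

lemma integrable_continuous_ivl:
  fixes f :: "real \<Rightarrow> 'a::euclidean_space"
  shows "continuous_on {a..b} f \<Longrightarrow> integrable (lebesgue_on {a..b}) f"
  by (rule continuous_imp_integrable_real)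

lemma continuous_volterra:
  assumes v: "integrable (lebesgue_on {a..b}) v"
  shows "continuous_on {a..b} (volterra a b m v)"
proof (induction m)
  case (Suc m)
  then have "continuous_on {a..b} (volterra a b 0 (volterra a b m v))"
    by (intro continuous_volterra_0 integrable_continuous_ivl)
  then show ?case by (rule continuous_on_eq) (simp add: volterra_volterra[OF v])
qed (rule continuous_volterra_0[OF v])

section \<open>Integration by parts and weak derivatives\<close>

lemma integral_deriv_test_fun:
  assumes \<phi>: "test_fun a b \<phi>" and \<theta>: "\<theta> \<in> {a..b}"
  shows "(LINT s|lebesgue_on {\<theta>..b}. deriv \<phi> s) = - \<phi> \<theta>"
proof -
  have s: "smooth \<phi>" and b: "\<phi> b = 0" using \<phi> by (auto simp: test_fun_iff)
  have "(deriv \<phi> has_integral (\<phi> b - \<phi> \<theta>)) {\<theta>..b}"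
    using \<theta> smooth_has_derivative[OF s]
    by (intro fundamental_theorem_of_calculus)
      (auto simp: has_real_derivative_iff_has_vector_derivative intro: has_vector_derivative_at_within)
  then have "integral {\<theta>..b} (deriv \<phi>) = - \<phi> \<theta>" by (simp add: b integral_unique)
  moreover have "integrable (lebesgue_on {\<theta>..b}) (deriv \<phi>)"
    by (intro continuous_imp_integrable_real smooth_continuous smooth_deriv s)
  ultimately show ?thesis by (simp add: lebesgue_integral_eq_integral)
qed

text \<open>\<open>v\<close> is merely integrable, so instead of differentiating its primitive the
  order of integration is exchanged: the inner integral of \<open>deriv \<phi>\<close> from
  \<open>\<theta>\<close> to \<open>b\<close> is \<open>- \<phi> \<theta>\<close>. The constant
  \<open>c\<close> drops out because \<open>\<phi>\<close> vanishes at both ends.\<close>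

lemma integral_by_parts_volterra:
  fixes v :: "real \<Rightarrow> 'a::euclidean_space"
  assumes \<phi>: "test_fun a b \<phi>" and v: "integrable (lebesgue_on {a..b}) v" and ab: "a < b"
  shows "(LINT s|lebesgue_on {a..b}. deriv \<phi> s *\<^sub>R (c + volterra a b 0 v s))
    = - (LINT s|lebesgue_on {a..b}. \<phi> s *\<^sub>R v s)"
proof -
  let ?M = "lebesgue_on {a..b}"
  have d: "test_fun a b (deriv \<phi>)" by (rule test_fun_deriv[OF \<phi>])
  obtain B where B: "\<And>s. s \<in> {a..b} \<Longrightarrow> \<bar>deriv \<phi> s\<bar> \<le> B" using test_fun_bounded[OF d] by blast
  have "(LINT s|?M. deriv \<phi> s) = - \<phi> a" using integral_deriv_test_fun[OF \<phi>, of a] ab by simp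
  also have "\<phi> a = 0" using \<phi> by (auto simp: test_fun_iff)
  finally have 0: "(LINT s|?M. deriv \<phi> s *\<^sub>R c) = 0"
    using test_fun_integrable[OF d, of "\<lambda>_. 1::real"] by simp
  have "(LINT s|?M. deriv \<phi> s *\<^sub>R volterra a b 0 v s) = (LINT s|?M. LINT \<theta>|?M. (deriv \<phi> s * vkernel 0 s \<theta>) *\<^sub>R v \<theta>)"
    by (simp add: volterra_def flip: scaleR_scaleR)
  also have "\<dots> = (LINT \<theta>|?M. (LINT s|?M. deriv \<phi> s * vkernel 0 s \<theta>) *\<^sub>R v \<theta>)"
  proof (rule fubini_kernel[OF v])
    have "(\<lambda>p. deriv \<phi> (fst p) * case_prod (vkernel 0) p) \<in> borel_measurable (?M \<Otimes>\<^sub>M ?M)"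
      using measurable_compose[OF measurable_fst test_fun_measurable[OF d]] vkernel_measurable_pair
      by (intro borel_measurable_times) auto
    then show "(\<lambda>(s, \<theta>). deriv \<phi> s * vkernel 0 s \<theta>) \<in> borel_measurable (?M \<Otimes>\<^sub>M ?M)"
      by (simp add: case_prod_beta)
    show "\<bar>deriv \<phi> s * vkernel 0 s \<theta>\<bar> \<le> \<bar>B\<bar> * ((b - a) ^ 0 / fact 0)"
      if "s \<in> {a..b}" "\<theta> \<in> {a..b}" for s \<theta>
      unfolding abs_mult using that B by (intro mult_mono vkernel_bound) force+
  qed
  also have "\<dots> = (LINT \<theta>|?M. - (\<phi> \<theta> *\<^sub>R v \<theta>))"
  proof (intro Bochner_Integration.integral_cong refl)
    fix \<theta> assume "\<theta> \<in> space ?M"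
    then have \<theta>: "\<theta> \<in> {a..b}" by (simp add: space_restrict_space)
    have "(LINT s|?M. deriv \<phi> s * vkernel 0 s \<theta>) = (LINT s|?M. indicator {\<theta>..b} s *\<^sub>R deriv \<phi> s)"
      by (intro Bochner_Integration.integral_cong)
        (auto simp: vkernel_def space_restrict_space split: split_indicator)
    also have "\<dots> = - \<phi> \<theta>"
      using \<theta> integral_deriv_test_fun[OF \<phi> \<theta>] by (subst integral_indicator_subinterval) auto
    finally show "(LINT s|?M. deriv \<phi> s * vkernel 0 s \<theta>) *\<^sub>R v \<theta> = - (\<phi> \<theta> *\<^sub>R v \<theta>)" by simp
  qed
  finally show ?thesis
    using 0 test_fun_integrable[OF d, of "\<lambda>_. c"] test_fun_integrable[OF d integrable_continuous_ivl[OF continuous_volterra_0[OF v]]]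
    by (simp add: scaleR_add_right)
qed

lemma test_fun_iterated_deriv: "test_fun a b \<phi> \<Longrightarrow> test_fun a b ((deriv ^^ k) \<phi>)"
  by (induction k) (auto intro: test_fun_deriv)

text \<open>Each link \<open>f k = c k + primitive of f (k + 1)\<close> takes one derivative off the
  test function at the price of a sign.\<close>

lemma has_weak_deriv_chain:
  assumes ab: "a < b" and int: "\<And>k. k \<le> d \<Longrightarrow> integrable (lebesgue_on {a..b}) (f k)"
    and chain: "\<And>k s. k < d \<Longrightarrow> s \<in> {a..b} \<Longrightarrow> f k s = c k + volterra a b 0 (f (Suc k)) s"
    and "k \<le> d"
  shows "has_weak_deriv a b k (f 0) (f k)"
proof -
  have "(LINT s|lebesgue_on {a..b}. (deriv ^^ k) \<phi> s *\<^sub>R f 0 s) =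
        (-1) ^ k *\<^sub>R (LINT s|lebesgue_on {a..b}. \<phi> s *\<^sub>R f k s)" if "test_fun a b \<phi>" for \<phi>
    using \<open>k \<le> d\<close> that
  proof (induction k arbitrary: \<phi>)
    case (Suc k)
    have "(LINT s|lebesgue_on {a..b}. (deriv ^^ Suc k) \<phi> s *\<^sub>R f 0 s)
      = (LINT s|lebesgue_on {a..b}. (deriv ^^ k) (deriv \<phi>) s *\<^sub>R f 0 s)"
      by (simp only: funpow_Suc_right o_apply)
    also have "\<dots> = (-1) ^ k *\<^sub>R (LINT s|lebesgue_on {a..b}. deriv \<phi> s *\<^sub>R f k s)"
      using Suc by (intro Suc.IH test_fun_deriv) auto
    also have "(LINT s|lebesgue_on {a..b}. deriv \<phi> s *\<^sub>R f k s)
        = (LINT s|lebesgue_on {a..b}. deriv \<phi> s *\<^sub>R (c k + volterra a b 0 (f (Suc k)) s))"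
      using Suc.prems chain by (intro Bochner_Integration.integral_cong) (auto simp: space_restrict_space)
    also have "\<dots> = - (LINT s|lebesgue_on {a..b}. \<phi> s *\<^sub>R f (Suc k) s)"
      using Suc.prems by (intro integral_by_parts_volterra int ab) auto
    finally show ?case by simp
  qed simp
  then show ?thesis by (simp add: has_weak_deriv_def)
qed

lemma weak_deriv_unique:
  assumes ab: "a < b" and v: "v \<in> L2 a b" "v' \<in> L2 a b"
    and "has_weak_deriv a b k u v" "has_weak_deriv a b k u v'"
  shows "L2_eq a b v v'"
proof -
  have "AE s in lebesgue_on {a..b}. v s - v' s = 0"
  proof (rule fundamental_lemma[OF ab])
    show "integrable (lebesgue_on {a..b}) (\<lambda>s. v s - v' s)"
      using v by (intro Bochner_Integration.integrable_diff L2_integrable)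
    fix \<phi> assume \<phi>: "test_fun a b \<phi>"
    then have "(-1) ^ k *\<^sub>R (LINT s|lebesgue_on {a..b}. \<phi> s *\<^sub>R v s) = (-1) ^ k *\<^sub>R (LINT s|lebesgue_on {a..b}. \<phi> s *\<^sub>R v' s)"
      using assms(4,5) by (simp add: has_weak_deriv_def)
    then have "(LINT s|lebesgue_on {a..b}. \<phi> s *\<^sub>R v s) = (LINT s|lebesgue_on {a..b}. \<phi> s *\<^sub>R v' s)"
      by (subst (asm) scaleR_left_imp_eq) auto
    then show "(LINT s|lebesgue_on {a..b}. \<phi> s *\<^sub>R (v s - v' s)) = 0"
      using test_fun_integrable[OF \<phi> L2_integrable[OF v(1)]] test_fun_integrable[OF \<phi> L2_integrable[OF v(2)]]
      by (simp add: scaleR_diff_right)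
  qed
  then show ?thesis by (simp add: L2_eq_def)
qed

lemma wderiv_works:
  assumes "v \<in> L2 a b" "has_weak_deriv a b k u v"
  shows "wderiv a b k u \<in> L2 a b" "has_weak_deriv a b k u (wderiv a b k u)"
  using someI[of "\<lambda>v. v \<in> L2 a b \<and> has_weak_deriv a b k u v" v] assms unfolding wderiv_def by auto

lemma wderiv_eq:
  assumes "a < b" "v \<in> L2 a b" "has_weak_deriv a b k u v"
  shows "L2_eq a b (wderiv a b k u) v"
  using weak_deriv_unique[OF assms(1) wderiv_works(1)[OF assms(2,3)] assms(2) wderiv_works(2)[OF assms(2,3)] assms(3)] .

lemma has_weak_deriv_cong:
  assumes "u \<in> L2 a b" "u' \<in> L2 a b" "L2_eq a b u u'"
  shows "has_weak_deriv a b k u = has_weak_deriv a b k u'"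
proof -
  have "(LINT s|lebesgue_on {a..b}. (deriv ^^ k) \<phi> s *\<^sub>R u s) = (LINT s|lebesgue_on {a..b}. (deriv ^^ k) \<phi> s *\<^sub>R u' s)"
    if "test_fun a b \<phi>" for \<phi>
  proof (rule integral_cong_AE)
    show "AE s in lebesgue_on {a..b}. (deriv ^^ k) \<phi> s *\<^sub>R u s = (deriv ^^ k) \<phi> s *\<^sub>R u' s"
      using assms(3) unfolding L2_eq_def by eventually_elim simp
  qed (intro borel_measurable_scaleR test_fun_measurable test_fun_iterated_deriv that
      L2_D(1)[OF assms(1)] L2_D(1)[OF assms(2)])+
  then show ?thesis by (simp add: has_weak_deriv_def fun_eq_iff cong: imp_cong)
qed

text \<open>An equality of functions and not only of classes: the candidates for the choice are the
  same for both representatives.\<close>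

lemma wderiv_cong:
  assumes "u \<in> L2 a b" "u' \<in> L2 a b" "L2_eq a b u u'"
  shows "wderiv a b k u = wderiv a b k u'"
  by (simp add: wderiv_def has_weak_deriv_cong[OF assms])

text \<open>The set of agreement is closed and of full measure, so it contains the open interval and
  then its closure.\<close>

lemma continuous_AE_eq:
  fixes g h :: "real \<Rightarrow> 'a::euclidean_space"
  assumes ab: "a < b" and g: "continuous_on {a..b} g" and h: "continuous_on {a..b} h"
    and eq: "AE s in lebesgue_on {a..b}. g s = h s" and x: "x \<in> {a..b}"
  shows "g x = h x"
proof -
  define C where "C = {s \<in> {a..b}. g s - h s = 0}"
  have C: "closed C" unfolding C_def
    by (intro continuous_closed_preimage_constant continuous_intros g h closed_atLeastAtMost)
  have "AE s in lebesgue. s \<in> {a..b} \<longrightarrow> g s = h s" using eq by (subst (asm) AE_restrict_space_iff) auto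
  then have "AE s in lebesgue. s \<in> {a<..<b} \<longrightarrow> s \<in> C" by eventually_elim (auto simp: C_def)
  then have "{a<..<b} \<subseteq> C" using mem_closed_if_AE_lebesgue_open[OF open_greaterThanLessThan C] by blast
  then have "closure {a<..<b} \<subseteq> C" using C by (rule closure_minimal)
  then show ?thesis using ab x by (auto simp: C_def)
qed

lemma cont_rep_eq:
  assumes ab: "a < b" and g: "continuous_on {a..b} g" "L2_eq a b g u" and x: "x \<in> {a..b}"
  shows "cont_rep a b u x = g x"
proof -
  have "continuous_on {a..b} (cont_rep a b u) \<and> L2_eq a b (cont_rep a b u) u"
    unfolding cont_rep_def by (rule someI[of _ g]) (use g in auto)
  then show ?thesis using g(2)
    by (intro continuous_AE_eq[OF ab _ g(1) _ x]) (auto simp: L2_eq_def elim: eventually_elim2)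
qed

text \<open>\<open>sobolev\<close> provides the derivatives of the various orders independently of
  each other. This ties consecutive ones together: \<open>w\<close> and the primitive of
  \<open>w'\<close> act equally on derivatives of test functions, so du Bois-Reymond applies to
  their difference.\<close>

lemma weak_deriv_primitive:
  assumes ab: "a < b" and w: "w \<in> L2 a b" "w' \<in> L2 a b"
    and d: "has_weak_deriv a b k u w" "has_weak_deriv a b (Suc k) u w'"
  shows "\<exists>c. L2_eq a b w (\<lambda>s. c + volterra a b 0 w' s)"
proof -
  let ?M = "lebesgue_on {a..b}"
  note w'i = L2_integrable[OF w(2)]
  have vi: "integrable ?M (volterra a b 0 w')" by (intro integrable_continuous_ivl continuous_volterra_0 w'i)
  have "\<exists>c. AE s in ?M. w s - volterra a b 0 w' s = c"
  proof (rule du_bois_reymond[OF ab])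
    show "integrable ?M (\<lambda>s. w s - volterra a b 0 w' s)"
      by (intro Bochner_Integration.integrable_diff vi L2_integrable w)
    fix \<phi> assume \<phi>: "test_fun a b \<phi>"
    note d\<phi> = test_fun_deriv[OF \<phi>]
    have "(-1) ^ k *\<^sub>R (LINT s|?M. deriv \<phi> s *\<^sub>R w s) = (LINT s|?M. (deriv ^^ k) (deriv \<phi>) s *\<^sub>R u s)"
      using d(1) d\<phi> by (simp add: has_weak_deriv_def)
    also have "\<dots> = (LINT s|?M. (deriv ^^ Suc k) \<phi> s *\<^sub>R u s)" by (simp only: funpow_Suc_right o_apply)
    also have "\<dots> = (-1) ^ Suc k *\<^sub>R (LINT s|?M. \<phi> s *\<^sub>R w' s)"
      using d(2) \<phi> unfolding has_weak_deriv_def by blast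
    also have "\<dots> = (-1) ^ k *\<^sub>R (- (LINT s|?M. \<phi> s *\<^sub>R w' s))" by simp
    finally have 1: "(LINT s|?M. deriv \<phi> s *\<^sub>R w s) = - (LINT s|?M. \<phi> s *\<^sub>R w' s)"
      by (rule scaleR_left_imp_eq[rotated]) simp
    have 2: "(LINT s|?M. deriv \<phi> s *\<^sub>R volterra a b 0 w' s) = - (LINT s|?M. \<phi> s *\<^sub>R w' s)"
      using integral_by_parts_volterra[OF \<phi> w'i ab, of 0] by simp
    show "(LINT s|?M. deriv \<phi> s *\<^sub>R (w s - volterra a b 0 w' s)) = 0"
      using 1 2 test_fun_integrable[OF d\<phi> vi] test_fun_integrable[OF d\<phi> L2_integrable[OF w(1)]]
      by (simp add: scaleR_diff_right)
  qed
  then obtain c where "AE s in ?M. w s - volterra a b 0 w' s = c" by blast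
  then have "L2_eq a b w (\<lambda>s. c + volterra a b 0 w' s)"
    unfolding L2_eq_def by eventually_elim (simp add: algebra_simps)
  then show ?thesis by blast
qed

section \<open>The Green operator\<close>

lemma mat_mult_vec: "mat c *v (x :: real ^ 'n::finite) = c *\<^sub>R x"
  by (simp add: matrix_vector_mult_def mat_def vec_eq_iff if_distrib[of "\<lambda>x. x * _"] cong: if_cong)

lemma sum_mat_mult_vec:
  "(\<Sum>i\<in>I. A i) *v x = (\<Sum>i\<in>I. A i *v (x :: real ^ 'n::finite))"
  by (induction I rule: infinite_finite_induct) (auto simp: matrix_vector_mult_add_rdistrib)

lemma mat_mult_vec_sum:
  "A *v (\<Sum>i\<in>I. f i) = (\<Sum>i\<in>I. A *v (f i :: real ^ 'n::finite))"
  by (induction I rule: infinite_finite_induct) (auto simp: matrix_vector_right_distrib)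

lemma mat_mult_vec_scaleR: "A *v (c *\<^sub>R x) = c *\<^sub>R (A *v (x :: real ^ 'n::finite))"
  by (simp add: matrix_vector_mult_scaleR)

lemma bounded_linear_mat_mult_vec: "bounded_linear (\<lambda>x. A *v (x :: real ^ 'n::finite))"
  by (rule matrix_vector_mul_bounded_linear)

text \<open>The solution of \<open>\<partial>\<^sup>d u = v\<close> with \<open>\<partial>\<^sup>j u (a) = c j\<close>, together with its derivatives of order \<open>k < d\<close>.\<close>

definition taylor ::
  "nat \<Rightarrow> real \<Rightarrow> real \<Rightarrow> (nat \<Rightarrow> real ^ 'n::finite) \<Rightarrow> (real \<Rightarrow> real ^ 'n) \<Rightarrow> nat \<Rightarrow> real \<Rightarrow> real ^ 'n" where
  "taylor d a b c v k s =
    (\<Sum>j=k..<d. ((s - a) ^ (j - k) / fact (j - k)) *\<^sub>R c j) + volterra a b (d - 1 - k) v s"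

text \<open>At \<open>k = d\<close> truncated subtraction would make \<open>taylor\<close> return
  the primitive of \<open>v\<close> instead of \<open>v\<close>, hence the case distinction.\<close>

definition taylor_chain where
  "taylor_chain d a b c v k = (if k < d then taylor d a b c v k else v)"

lemma continuous_taylor:
  assumes "integrable (lebesgue_on {a..b}) v" shows "continuous_on {a..b} (taylor d a b c v k)"
  unfolding taylor_def by (auto intro!: continuous_intros continuous_volterra assms)

lemma continuous_L2:
  assumes "continuous_on {a..b} f" shows "f \<in> L2 a b"
proof -
  have "continuous_on {a..b} (\<lambda>s. (norm (f s))\<^sup>2)" by (intro continuous_intros assms)
  then show ?thesis using assms
    by (simp add: L2_def borel_measurable_integrable integrable_continuous_ivl)
qed

lemma taylor_L2: "v \<in> L2 a b \<Longrightarrow> taylor d a b c v k \<in> L2 a b"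
  by (rule continuous_L2[OF continuous_taylor[OF L2_integrable]])

lemma taylor_step:
  assumes v: "integrable (lebesgue_on {a..b}) v" and k: "k < d" and s: "s \<in> {a..b}"
  shows "taylor d a b c v k s = c k + volterra a b 0 (taylor_chain d a b c v (Suc k)) s"
proof (cases "Suc k < d")
  case False
  then have "d = Suc k" using k by simp
  then show ?thesis by (simp add: taylor_def taylor_chain_def)
next
  case True
  have mono: "integrable (lebesgue_on {a..b}) (\<lambda>r. ((r - a) ^ m / fact m) *\<^sub>R c j)" for m j
    by (intro integrable_continuous_ivl continuous_intros) auto
  have vv: "integrable (lebesgue_on {a..b}) (volterra a b m v)" for m
    by (intro integrable_continuous_ivl continuous_volterra v)
  have sm: "integrable (lebesgue_on {a..b}) (\<lambda>r. \<Sum>j=Suc k..<d. ((r - a) ^ (j - Suc k) / fact (j - Suc k)) *\<^sub>R c j)"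
    by (intro Bochner_Integration.integrable_sum mono)
  have "volterra a b 0 (taylor_chain d a b c v (Suc k)) s
    = volterra a b 0 (\<lambda>r. (\<Sum>j=Suc k..<d. ((r - a) ^ (j - Suc k) / fact (j - Suc k)) *\<^sub>R c j) + volterra a b (d - 1 - Suc k) v r) s"
    using True by (simp add: taylor_chain_def taylor_def[abs_def])
  also have "\<dots> = volterra a b 0 (\<lambda>r. \<Sum>j=Suc k..<d. ((r - a) ^ (j - Suc k) / fact (j - Suc k)) *\<^sub>R c j) s
      + volterra a b 0 (volterra a b (d - 1 - Suc k) v) s"
    by (rule volterra_add[OF sm vv s])
  also have "volterra a b 0 (\<lambda>r. \<Sum>j=Suc k..<d. ((r - a) ^ (j - Suc k) / fact (j - Suc k)) *\<^sub>R c j) s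
      = (\<Sum>j=Suc k..<d. volterra a b 0 (\<lambda>r. ((r - a) ^ (j - Suc k) / fact (j - Suc k)) *\<^sub>R c j) s)"
    by (rule volterra_sum[OF mono s])
  also have "\<dots> = (\<Sum>j=Suc k..<d. ((s - a) ^ (j - k) / fact (j - k)) *\<^sub>R c j)"
  proof (rule sum.cong[OF refl])
    fix j assume "j \<in> {Suc k..<d}"
    then have "j - k = Suc (j - Suc k)" by auto
    then show "volterra a b 0 (\<lambda>r. ((r - a) ^ (j - Suc k) / fact (j - Suc k)) *\<^sub>R c j) s = ((s - a) ^ (j - k) / fact (j - k)) *\<^sub>R c j"
      using volterra_monomial[OF s] by (simp only:)
  qed
  also have "volterra a b 0 (volterra a b (d - 1 - Suc k) v) s = volterra a b (d - 1 - k) v s"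
  proof -
    have "d - 1 - k = Suc (d - 1 - Suc k)" using True by auto
    then show ?thesis using volterra_volterra[OF v s] by (simp only:)
  qed
  finally have "c k + volterra a b 0 (taylor_chain d a b c v (Suc k)) s
    = c k + (\<Sum>j=Suc k..<d. ((s - a) ^ (j - k) / fact (j - k)) *\<^sub>R c j) + volterra a b (d - 1 - k) v s"
    by simp
  moreover have "(\<Sum>j=k..<d. ((s - a) ^ (j - k) / fact (j - k)) *\<^sub>R c j)
    = c k + (\<Sum>j=Suc k..<d. ((s - a) ^ (j - k) / fact (j - k)) *\<^sub>R c j)"
    using k by (subst sum.atLeast_Suc_lessThan) auto
  ultimately show ?thesis by (simp add: taylor_def)
qed

lemma taylor_weak_deriv:
  assumes ab: "a < b" and v: "v \<in> L2 a b" and d: "1 \<le> d" and "k \<le> d"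
  shows "has_weak_deriv a b k (taylor d a b c v 0) (taylor_chain d a b c v k)"
proof -
  have "has_weak_deriv a b k (taylor_chain d a b c v 0) (taylor_chain d a b c v k)"
  proof (rule has_weak_deriv_chain[OF ab, of d _ c])
    show "integrable (lebesgue_on {a..b}) (taylor_chain d a b c v k)" for k
      using v by (auto simp: taylor_chain_def intro!: L2_integrable taylor_L2)
    show "taylor_chain d a b c v k s = c k + volterra a b 0 (taylor_chain d a b c v (Suc k)) s"
      if "k < d" "s \<in> {a..b}" for k s
      using taylor_step[OF L2_integrable[OF v] that, of c] that by (simp add: taylor_chain_def[of d a b c v k])
  qed fact
  then show ?thesis using d by (simp add: taylor_chain_def[of d a b c v 0])
qed

lemma taylor_wderiv:
  assumes ab: "a < b" and v: "v \<in> L2 a b" and d: "1 \<le> d" "k \<le> d"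
    and u: "u \<in> L2 a b" "L2_eq a b u (taylor d a b c v 0)"
  shows "wderiv a b k u \<in> L2 a b" "L2_eq a b (wderiv a b k u) (taylor_chain d a b c v k)"
proof -
  have t: "taylor_chain d a b c v k \<in> L2 a b" using v by (auto simp: taylor_chain_def taylor_L2)
  note w = taylor_weak_deriv[OF ab v d, of c]
  have eq: "wderiv a b k u = wderiv a b k (taylor d a b c v 0)" by (rule wderiv_cong[OF u(1) taylor_L2[OF v] u(2)])
  show "wderiv a b k u \<in> L2 a b" "L2_eq a b (wderiv a b k u) (taylor_chain d a b c v k)"
    unfolding eq by (rule wderiv_works(1)[OF t w], rule wderiv_eq[OF ab t w])
qed

lemma taylor_sobolev:
  assumes ab: "a < b" and v: "v \<in> L2 a b" and d: "1 \<le> d"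
    and u: "u \<in> L2 a b" "L2_eq a b u (taylor d a b c v 0)"
  shows "u \<in> sobolev d a b"
proof -
  have "taylor_chain d a b c v k \<in> L2 a b" for k using v by (auto simp: taylor_chain_def taylor_L2)
  then have "\<exists>w\<in>L2 a b. has_weak_deriv a b k u w" if "k \<le> d" for k
    using taylor_weak_deriv[OF ab v d that, of c] has_weak_deriv_cong[OF u(1) taylor_L2[OF v] u(2)] by metis
  then show ?thesis using u by (simp add: sobolev_def)
qed

lemma taylor_cont_rep:
  assumes ab: "a < b" and v: "v \<in> L2 a b" and d: "1 \<le> d" "k < d"
    and u: "u \<in> L2 a b" "L2_eq a b u (taylor d a b c v 0)" and x: "x \<in> {a..b}"
  shows "cont_rep a b (wderiv a b k u) x = taylor d a b c v k x"
proof (rule cont_rep_eq[OF ab _ _ x])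
  show "continuous_on {a..b} (taylor d a b c v k)" by (intro continuous_taylor L2_integrable v)
  show "L2_eq a b (taylor d a b c v k) (wderiv a b k u)"
    using taylor_wderiv(2)[OF ab v d(1) _ u, of k] d by (auto simp: taylor_chain_def L2_eq_def eq_commute)
qed

text \<open>Descends from order \<open>d\<close>, where the derivative is \<open>v\<close> itself:
  each lower derivative is a constant plus the primitive of the next one, and integrating a Taylor
  form again gives a Taylor form. The constants found on the way are the coefficients.\<close>

lemma sobolev_eq_taylor:
  assumes ab: "a < b" and d: "1 \<le> d" and u: "u \<in> sobolev d a b"
  shows "\<exists>c. \<exists>v\<in>L2 a b. L2_eq a b u (taylor d a b c v 0)"
proof -
  have uL: "u \<in> L2 a b" using u by (simp add: sobolev_def)
  have "\<exists>w. w \<in> L2 a b \<and> has_weak_deriv a b k u w" if "k \<le> d" for k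
  proof (cases "k = 0")
    case True
    then show ?thesis using uL by (intro exI[of _ u]) (simp add: has_weak_deriv_def)
  next
    case False
    then have "k \<in> {1..d}" using that by auto
    then show ?thesis using u unfolding sobolev_def by blast
  qed
  then obtain w where w: "\<And>k. k \<le> d \<Longrightarrow> w k \<in> L2 a b" "\<And>k. k \<le> d \<Longrightarrow> has_weak_deriv a b k u (w k)"
    by metis
  have "\<exists>c. L2_eq a b (w k) (\<lambda>s. c + volterra a b 0 (w (Suc k)) s)" if "k < d" for k
    using that by (intro weak_deriv_primitive[OF ab _ _ w(2) w(2)] w(1)) auto
  then obtain c where c: "\<And>k. k < d \<Longrightarrow> L2_eq a b (w k) (\<lambda>s. c k + volterra a b 0 (w (Suc k)) s)" by metis
  define v where "v = w d"
  have v: "v \<in> L2 a b" using w(1) by (simp add: v_def)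
  have wt: "L2_eq a b (w k) (taylor_chain d a b c v k)" if "k \<le> d" for k
    using that
  proof (induction rule: inc_induct)
    case base
    then show ?case by (simp add: taylor_chain_def v_def L2_eq_def)
  next
    case (step k)
    have t: "taylor_chain d a b c v (Suc k) \<in> L2 a b" using v by (auto simp: taylor_chain_def taylor_L2)
    have "volterra a b 0 (w (Suc k)) s = volterra a b 0 (taylor_chain d a b c v (Suc k)) s" for s
      using step w(1)[of "Suc k"] t by (intro volterra_cong_AE L2_integrable) (auto simp: L2_eq_def)
    then have "AE s in lebesgue_on {a..b}. w k s = c k + volterra a b 0 (taylor_chain d a b c v (Suc k)) s"
      using c[OF step(2)] by (simp add: L2_eq_def)
    then show ?case unfolding L2_eq_def using AE_space
    proof eventually_elim
      case (elim s)
      then show ?case using taylor_step[OF L2_integrable[OF v] step(2), of s c] step(2)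
        by (simp add: taylor_chain_def[of d a b c v k] space_restrict_space)
    qed
  qed
  have "L2_eq a b (w 0) (taylor d a b c v 0)" using wt[of 0] d by (simp add: taylor_chain_def)
  moreover have "L2_eq a b (w 0) u"
    using w[of 0] uL by (intro weak_deriv_unique[OF ab, of _ _ 0 u]) (auto simp: has_weak_deriv_def)
  ultimately have "L2_eq a b u (taylor d a b c v 0)"
    unfolding L2_eq_def by eventually_elim simp
  then show ?thesis using v by blast
qed

text \<open>At \<open>a\<close> the monomials of positive degree and the Volterra terms vanish,
  which leaves the coefficients. At \<open>b\<close> the monomials form \<open>Qmat (b - a)\<close>,
  and the Volterra terms, multiplied by \<open>C\<close>, form the inhomogeneity \<open>r\<close>.
  The conditions thus read \<open>K c + r = 0\<close>.\<close>

lemma boundary_condition_iff: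
  fixes B C :: "'n::finite blockmat"
  assumes ab: "a < b" and d: "1 \<le> d" and K: "PIE_compatible d a b B C"
  shows "(\<forall>i<d. (\<Sum>j<d. B i j *v taylor d a b c v j a + C i j *v taylor d a b c v j b) = 0)
    \<longleftrightarrow> (\<forall>l<d. c l = - (\<Sum>k<d. block_inv d (Kmat d a b B C) l k *v (\<Sum>m<d. C k m *v volterra a b (d - 1 - m) v b)))"
proof -
  define Km where "Km = Kmat d a b B C"
  define Y where "Y = block_inv d Km"
  define r where "r k = (\<Sum>m<d. C k m *v volterra a b (d - 1 - m) v b)" for k
  have "block_is_inverse d Km Y"
    using K unfolding PIE_compatible_def block_invertible_def Y_def block_inv_def Km_def by (rule someI_ex)
  then have inv: "\<And>i j. i < d \<Longrightarrow> j < d \<Longrightarrow> (\<Sum>k<d. Km i k ** Y k j) = (if i = j then mat 1 else 0)"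
    "\<And>i j. i < d \<Longrightarrow> j < d \<Longrightarrow> (\<Sum>k<d. Y i k ** Km k j) = (if i = j then mat 1 else 0)"
    by (auto simp: block_is_inverse_def block_mult_def)
  have ta: "taylor d a b c v j a = c j" if "j < d" for j
  proof -
    have "(\<Sum>l=j..<d. ((a - a) ^ (l - j) / fact (l - j)) *\<^sub>R c l) = (\<Sum>l=j..<d. if l = j then c l else 0)"
      by (intro sum.cong) auto
    then show ?thesis using that ab by (simp add: taylor_def volterra_at_left)
  qed
  have tb: "taylor d a b c v j b = (\<Sum>l<d. Qmat (b - a) j l *v c l) + volterra a b (d - 1 - j) v b" for j
  proof -
    have "(\<Sum>l=j..<d. ((b - a) ^ (l - j) / fact (l - j)) *\<^sub>R c l) = (\<Sum>l<d. Qmat (b - a) j l *v c l)"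
      by (rule sum.mono_neutral_cong_left) (auto simp: Qmat_def mat_mult_vec)
    then show ?thesis by (simp add: taylor_def)
  qed
  have Kv: "Km i l *v c l = B i l *v c l + (\<Sum>j<d. C i j *v (Qmat (b - a) j l *v c l))" for i l
    by (simp add: Km_def Kmat_def block_mult_def matrix_vector_mult_add_rdistrib sum_mat_mult_vec
        matrix_vector_mul_assoc)
  have bc: "(\<Sum>j<d. B i j *v taylor d a b c v j a + C i j *v taylor d a b c v j b) = (\<Sum>l<d. Km i l *v c l) + r i" for i
  proof -
    have "(\<Sum>j<d. B i j *v taylor d a b c v j a + C i j *v taylor d a b c v j b)
      = (\<Sum>j<d. B i j *v c j) + (\<Sum>j<d. C i j *v (\<Sum>l<d. Qmat (b - a) j l *v c l)) + r i"
      by (simp add: ta tb r_def matrix_vector_right_distrib sum.distrib)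
    also have "(\<Sum>j<d. C i j *v (\<Sum>l<d. Qmat (b - a) j l *v c l)) = (\<Sum>l<d. \<Sum>j<d. C i j *v (Qmat (b - a) j l *v c l))"
      unfolding mat_mult_vec_sum by (rule sum.swap)
    finally show ?thesis by (simp add: Kv sum.distrib)
  qed
  \<comment> \<open>Stated for arbitrary block matrices, as the two directions of the equivalence
    need the products of \<open>Km\<close> and \<open>Y\<close> in opposite orders.\<close>
  have cancel: "(\<Sum>k<d. X i k *v (\<Sum>m<d. Z k m *v x m)) = x i"
    if "\<And>i j. i < d \<Longrightarrow> j < d \<Longrightarrow> (\<Sum>k<d. X i k ** Z k j) = (if i = j then mat 1 else 0)" "i < d"
    for X Z :: "'n blockmat" and x :: "nat \<Rightarrow> real ^ 'n" and i
  proof -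
    have "(\<Sum>k<d. X i k *v (\<Sum>m<d. Z k m *v x m)) = (\<Sum>m<d. \<Sum>k<d. (X i k ** Z k m) *v x m)"
      unfolding mat_mult_vec_sum matrix_vector_mul_assoc by (rule sum.swap)
    also have "\<dots> = (\<Sum>m<d. if i = m then x m else 0)"
      using that by (intro sum.cong) (auto simp flip: sum_mat_mult_vec)
    finally show ?thesis using that(2) by simp
  qed
  have "(\<forall>i<d. (\<Sum>l<d. Km i l *v c l) + r i = 0) \<longleftrightarrow> (\<forall>l<d. c l = - (\<Sum>k<d. Y l k *v r k))"
  proof (intro iffI allI impI)
    fix l assume *: "\<forall>i<d. (\<Sum>l<d. Km i l *v c l) + r i = 0" and l: "l < d"
    have "c l = (\<Sum>k<d. Y l k *v (\<Sum>m<d. Km k m *v c m))" by (rule cancel[OF inv(2) l, symmetric])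
    also have "\<dots> = (\<Sum>k<d. Y l k *v (- r k))"
      using * by (intro sum.cong refl arg_cong2[where f = "\<lambda>A x. A *v x"]) (auto simp: eq_neg_iff_add_eq_0)
    also have "\<dots> = - (\<Sum>k<d. Y l k *v r k)"
      by (simp add: mat_mult_vec_scaleR[of _ "-1", simplified] sum_negf)
    finally show "c l = - (\<Sum>k<d. Y l k *v r k)" .
  next
    fix i assume *: "\<forall>l<d. c l = - (\<Sum>k<d. Y l k *v r k)" and i: "i < d"
    have "(\<Sum>l<d. Km i l *v c l) = (\<Sum>l<d. Km i l *v ((-1) *\<^sub>R (\<Sum>k<d. Y l k *v r k)))"
      using * by (intro sum.cong) auto
    also have "\<dots> = - (\<Sum>l<d. Km i l *v (\<Sum>k<d. Y l k *v r k))"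
      unfolding mat_mult_vec_scaleR by (simp add: sum_negf)
    also have "\<dots> = - r i" by (simp add: cancel[OF inv(1) i])
    finally show "(\<Sum>l<d. Km i l *v c l) + r i = 0" by simp
  qed
  then show ?thesis by (simp add: bc r_def Y_def Km_def)
qed

text \<open>The initial data forced by the boundary conditions: \<open>- K^(-1) C\<close> applied to
  the values at \<open>b\<close> of the iterated integrals of \<open>v\<close>.\<close>

definition init_values ::
  "nat \<Rightarrow> real \<Rightarrow> real \<Rightarrow> 'n::finite blockmat \<Rightarrow> 'n blockmat \<Rightarrow> (real \<Rightarrow> real ^ 'n) \<Rightarrow> nat \<Rightarrow> real ^ 'n" where
  "init_values d a b B C v l =
    - (\<Sum>k<d. block_inv d (Kmat d a b B C) l k *v (\<Sum>m<d. C k m *v volterra a b (d - 1 - m) v b))"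

text \<open>An explicit representative of the derivative of order \<open>k\<close> of the solution,
  free of the choice made in \<open>wderiv\<close>.\<close>

definition green :: "nat \<Rightarrow> real \<Rightarrow> real \<Rightarrow> 'n::finite blockmat \<Rightarrow> 'n blockmat \<Rightarrow> nat \<Rightarrow> 'n l2op" where
  "green d a b B C k v = taylor_chain d a b (init_values d a b B C v) v k"

text \<open>In the block \<open>(0, d - 1)\<close>, the first block row of
  \<open>Qmat (s - a)\<close> contributes the Taylor monomials and the last block column of
  \<open>Qmat (b - \<theta>)\<close> the Volterra kernels at \<open>b\<close>. Integration over
  \<open>\<theta>\<close> turns the latter into the iterated integrals in
  \<open>init_values\<close>.\<close>

lemma Top_eq_green:
  fixes B C :: "'n::finite blockmat"
  assumes ab: "a < b" and d: "1 \<le> d" and v: "v \<in> L2 a b" and s: "s \<in> {a..b}"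
  shows "Top d a b B C v s = green d a b B C 0 v s"
proof -
  let ?M = "lebesgue_on {a..b}"
  define Y where "Y = block_inv d (Kmat d a b B C)"
  define H where "H \<theta> = (\<Sum>j<d. ((s - a) ^ j / fact j) *\<^sub>R
    (\<Sum>k<d. Y j k *v (\<Sum>m<d. C k m *v (vkernel (d - 1 - m) b \<theta> *\<^sub>R v \<theta>))))" for \<theta>
  note vi = L2_integrable[OF v]
  have b: "b \<in> {a..b}" using ab by simp
  have E: "Ghat d a b B C s \<theta> 0 (d - 1) *v v \<theta> = vkernel (d - 1) s \<theta> *\<^sub>R v \<theta> - H \<theta>"
    if \<theta>: "\<theta> \<in> {a..b}" for \<theta>
  proof -
    have Qb: "Qmat (b - \<theta>) m (d - 1) *v v \<theta> = vkernel (d - 1 - m) b \<theta> *\<^sub>R v \<theta>" if "m < d" for m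
      using that \<theta> by (simp add: Qmat_def vkernel_def mat_mult_vec)
    have Q0: "Qmat (s - a) 0 j *v x = ((s - a) ^ j / fact j) *\<^sub>R x" for j and x :: "real ^ 'n"
      by (simp add: Qmat_def mat_mult_vec)
    have "block_mult d (Qmat (s - a)) (block_mult d Y (block_mult d C (Qmat (b - \<theta>)))) 0 (d - 1) *v v \<theta>
      = (\<Sum>j<d. Qmat (s - a) 0 j *v (\<Sum>k<d. Y j k *v (\<Sum>m<d. C k m *v (Qmat (b - \<theta>) m (d - 1) *v v \<theta>))))"
      by (simp add: block_mult_def sum_mat_mult_vec flip: matrix_vector_mul_assoc)
    also have "\<dots> = H \<theta>"
      by (simp add: H_def Q0 Qb del: One_nat_def cong: sum.cong_simp)
    finally show ?thesis
      by (simp add: Ghat_def Let_def Y_def[symmetric] matrix_vector_mult_diff_rdistrib Qmat_def mat_mult_vec vkernel_def)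
        (simp add: matrix_vector_mult_def sum_negf vec_eq_iff)
  qed
  have int: "integrable ?M (\<lambda>\<theta>. X *v u \<theta>)" "(LINT \<theta>|?M. X *v u \<theta>) = X *v (LINT \<theta>|?M. u \<theta>)"
    if "integrable ?M u" for X :: "real ^ 'n ^ 'n" and u
    using that bounded_linear_mat_mult_vec[of X] by (auto intro: integrable_bounded_linear integral_bounded_linear)
  have 1: "integrable ?M (\<lambda>\<theta>. vkernel m b \<theta> *\<^sub>R v \<theta>)" for m by (rule vkernel_integrable[OF vi b])
  have 2: "integrable ?M (\<lambda>\<theta>. \<Sum>m<d. C k m *v (vkernel (d - 1 - m) b \<theta> *\<^sub>R v \<theta>))" for k
    by (intro Bochner_Integration.integrable_sum int 1)
  have 3: "integrable ?M (\<lambda>\<theta>. \<Sum>k<d. Y j k *v (\<Sum>m<d. C k m *v (vkernel (d - 1 - m) b \<theta> *\<^sub>R v \<theta>)))" for j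
    by (intro Bochner_Integration.integrable_sum int 2)
  have 4: "integrable ?M H"
    unfolding H_def[abs_def] by (intro Bochner_Integration.integrable_sum integrable_scaleR_right 3)
  have "Top d a b B C v s = (LINT \<theta>|?M. vkernel (d - 1) s \<theta> *\<^sub>R v \<theta> - H \<theta>)"
    unfolding Top_def by (intro Bochner_Integration.integral_cong refl E) (simp add: space_restrict_space)
  also have "\<dots> = volterra a b (d - 1) v s - (LINT \<theta>|?M. H \<theta>)"
    unfolding volterra_def by (rule Bochner_Integration.integral_diff[OF vkernel_integrable[OF vi s] 4])
  also have "(LINT \<theta>|?M. H \<theta>)
    = (\<Sum>j<d. ((s - a) ^ j / fact j) *\<^sub>R (\<Sum>k<d. Y j k *v (\<Sum>m<d. C k m *v volterra a b (d - 1 - m) v b)))"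
    by (simp only: H_def Bochner_Integration.integral_sum[OF integrable_scaleR_right[OF 3]] integral_scaleR_right
        Bochner_Integration.integral_sum[OF int(1)[OF 2]] int(2)[OF 2]
        Bochner_Integration.integral_sum[OF int(1)[OF 1]] int(2)[OF 1] volterra_def)
  finally show ?thesis
    using d by (simp add: green_def taylor_chain_def taylor_def init_values_def Y_def atLeast0LessThan sum_negf)
qed

lemma bc_domain_iff:
  fixes B C :: "'n::finite blockmat"
  assumes ab: "a < b" and d: "1 \<le> d" and K: "PIE_compatible d a b B C"
  shows "u \<in> bc_domain d a b B C \<longleftrightarrow> u \<in> L2 a b \<and> (\<exists>v\<in>L2 a b. L2_eq a b u (green d a b B C 0 v))"
proof
  assume u: "u \<in> bc_domain d a b B C"
  then have us: "u \<in> sobolev d a b" by (simp add: bc_domain_def)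
  then have uL: "u \<in> L2 a b" by (simp add: sobolev_def)
  obtain c v where v: "v \<in> L2 a b" "L2_eq a b u (taylor d a b c v 0)"
    using sobolev_eq_taylor[OF ab d us] by blast
  have "(\<Sum>j<d. B i j *v taylor d a b c v j a + C i j *v taylor d a b c v j b) = 0" if "i < d" for i
    using u that ab taylor_cont_rep[OF ab v(1) d _ uL v(2)] by (simp add: bc_domain_def)
  then have "\<forall>l<d. c l = init_values d a b B C v l"
    using boundary_condition_iff[OF ab d K, of c v] by (simp add: init_values_def)
  then have "taylor d a b c v 0 = taylor d a b (init_values d a b B C v) v 0"
    by (simp add: taylor_def fun_eq_iff)
  then show "u \<in> L2 a b \<and> (\<exists>v\<in>L2 a b. L2_eq a b u (green d a b B C 0 v))"
    using uL v d by (auto simp: green_def taylor_chain_def)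
next
  assume "u \<in> L2 a b \<and> (\<exists>v\<in>L2 a b. L2_eq a b u (green d a b B C 0 v))"
  then obtain v where uL: "u \<in> L2 a b" and v: "v \<in> L2 a b" "L2_eq a b u (taylor d a b (init_values d a b B C v) v 0)"
    using d by (auto simp: green_def taylor_chain_def)
  have "(\<Sum>j<d. B i j *v taylor d a b (init_values d a b B C v) v j a + C i j *v taylor d a b (init_values d a b B C v) v j b) = 0"
    if "i < d" for i
    using boundary_condition_iff[OF ab d K, of "init_values d a b B C v" v] that by (auto simp: init_values_def)
  then show "u \<in> bc_domain d a b B C"
    using taylor_sobolev[OF ab v(1) d uL v(2)] taylor_cont_rep[OF ab v(1) d _ uL v(2)] ab
    by (simp add: bc_domain_def)
qed

section \<open>Boundedness of the operators \<open>T\<close> and \<open>AT\<close>\<close>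

lemma L2_eqI: "(\<And>s. s \<in> {a..b} \<Longrightarrow> u s = v s) \<Longrightarrow> L2_eq a b u v"
  unfolding L2_eq_def by (rule AE_I2) (simp add: space_restrict_space)

lemma L2_norm_le:
  assumes f: "f \<in> L2 a b" and B: "0 \<le> B" "\<And>s. s \<in> {a..b} \<Longrightarrow> norm (f s) \<le> B * norm (g s)" and g: "g \<in> L2 a b"
  shows "L2_norm a b f \<le> B * L2_norm a b g"
proof (rule power2_le_imp_le)
  have "(L2_norm a b f)\<^sup>2 = (LINT s|lebesgue_on {a..b}. (norm (f s))\<^sup>2)"
    by (simp add: L2_norm_square L2_inner_def power2_norm_eq_inner)
  also have "\<dots> \<le> (LINT s|lebesgue_on {a..b}. B\<^sup>2 * (norm (g s))\<^sup>2)"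
  proof (rule integral_mono)
    show "(norm (f s))\<^sup>2 \<le> B\<^sup>2 * (norm (g s))\<^sup>2" if "s \<in> space (lebesgue_on {a..b})" for s
      using power_mono[OF B(2)[of s] norm_ge_zero, of 2] that
      by (simp add: power_mult_distrib space_restrict_space)
  qed (use L2_D(2)[OF f] L2_D(2)[OF g] in auto)
  also have "\<dots> = (B * L2_norm a b g)\<^sup>2"
    by (simp add: L2_norm_square L2_inner_def power2_norm_eq_inner power_mult_distrib)
  finally show "(L2_norm a b f)\<^sup>2 \<le> (B * L2_norm a b g)\<^sup>2" .
  show "0 \<le> B * L2_norm a b g" using B(1) by (simp add: L2_norm_nonneg)
qed

text \<open>\<open>L2_norm_L1_bound\<close> with \<open>c\<close> equal to the norm of
  \<open>u\<close>; if that is 0, with arbitrarily small \<open>c\<close>.\<close>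

lemma L2_norm_ge_L1:
  assumes u: "u \<in> L2 a b"
  shows "(LINT s|lebesgue_on {a..b}. norm (u s)) \<le> (measure lebesgue {a..b} + 1) * L2_norm a b u"
proof (cases "L2_norm a b u = 0")
  case True
  have "(LINT s|lebesgue_on {a..b}. norm (u s)) \<le> 0"
  proof (rule field_le_epsilon)
    fix e :: real assume "0 < e"
    define c where "c = e / (measure lebesgue {a..b} + 1)"
    have \<mu>: "0 < measure lebesgue {a..b} + 1" by (simp add: add_nonneg_pos)
    then have "0 < c" using \<open>0 < e\<close> by (simp add: c_def)
    from L2_norm_L1_bound[OF u this] have "(LINT s|lebesgue_on {a..b}. norm (u s)) \<le> c * measure lebesgue {a..b}"
      using True by simp
    also have "\<dots> \<le> c * (measure lebesgue {a..b} + 1)" using \<open>0 < c\<close> by (intro mult_left_mono) auto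
    also have "\<dots> = 0 + e" using \<mu> by (simp add: c_def)
    finally show "(LINT s|lebesgue_on {a..b}. norm (u s)) \<le> 0 + e" .
  qed
  then show ?thesis using True by simp
next
  case False
  then have "0 < L2_norm a b u" using L2_norm_nonneg[of a b u] by linarith
  from L2_norm_L1_bound[OF u this] this show ?thesis
    by (simp add: power2_eq_square algebra_simps)
qed

text \<open>On a bounded interval the L2 norm controls the L1 norm, and a uniform pointwise bound
  controls the L2 norm of the result. The constant function \<open>e\<close> is what the result is
  compared with; only \<open>norm e > 0\<close> matters.\<close>

lemma L2_bounded_op_L1I:
  fixes R :: "'n::finite l2op"
  assumes R: "\<And>v. v \<in> L2 a b \<Longrightarrow> R v \<in> L2 a b"
    and add: "\<And>u v s. u \<in> L2 a b \<Longrightarrow> v \<in> L2 a b \<Longrightarrow> s \<in> {a..b} \<Longrightarrow> R (\<lambda>s. u s + v s) s = R u s + R v s"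
    and scale: "\<And>c v s. v \<in> L2 a b \<Longrightarrow> s \<in> {a..b} \<Longrightarrow> R (\<lambda>s. c *\<^sub>R v s) s = c *\<^sub>R R v s"
    and bnd: "\<And>v s. v \<in> L2 a b \<Longrightarrow> s \<in> {a..b} \<Longrightarrow> norm (R v s) \<le> C * (LINT s|lebesgue_on {a..b}. norm (v s))"
  shows "L2_bounded_op a b R"
proof -
  define e :: "real ^ 'n" where "e = 1"
  define \<mu> where "\<mu> = measure lebesgue {a..b} + 1"
  define K where "K = \<bar>C\<bar> * \<mu> * L2_norm a b (\<lambda>_. e) / norm e"
  have e: "norm e > 0" by (simp add: e_def)
  have "L2_norm a b (R v) \<le> K * L2_norm a b v" if v: "v \<in> L2 a b" for v
  proof -
    define B where "B = \<bar>C\<bar> * \<mu> * L2_norm a b v / norm e"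
    have "L2_norm a b (R v) \<le> B * L2_norm a b (\<lambda>_. e)"
    proof (rule L2_norm_le[OF R[OF v] _ _ L2_const])
      show "0 \<le> B" by (simp add: B_def \<mu>_def L2_norm_nonneg)
      fix s assume "s \<in> {a..b}"
      from bnd[OF v this] have "norm (R v s) \<le> C * (LINT s|lebesgue_on {a..b}. norm (v s))" .
      also have "\<dots> \<le> \<bar>C\<bar> * (LINT s|lebesgue_on {a..b}. norm (v s))" by (intro mult_right_mono) auto
      also have "\<dots> \<le> \<bar>C\<bar> * (\<mu> * L2_norm a b v)"
        unfolding \<mu>_def by (intro mult_left_mono L2_norm_ge_L1 v) auto
      also have "\<dots> = B * norm e" using e by (simp add: B_def)
      finally show "norm (R v s) \<le> B * norm e" .
    qed
    then show ?thesis by (simp add: B_def K_def mult_ac)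
  qed
  then show ?thesis unfolding L2_bounded_op_def using R add scale by (auto intro!: L2_eqI)
qed

lemma init_values_add:
  assumes "u \<in> L2 a b" "v \<in> L2 a b" "a < b"
  shows "init_values d a b B C (\<lambda>s. u s + v s) l = init_values d a b B C u l + init_values d a b B C v l"
  using assms by (simp add: init_values_def volterra_add L2_integrable matrix_vector_right_distrib sum.distrib)

lemma init_values_scale:
  "init_values d a b B C (\<lambda>s. c *\<^sub>R v s) l = c *\<^sub>R init_values d a b B C v l"
  by (simp add: init_values_def volterra_scale mat_mult_vec_scaleR flip: scaleR_sum_right)

lemma init_values_bound:
  fixes B C :: "'a::finite blockmat"
  assumes ab: "a < b"
  shows "\<exists>K\<ge>0. \<forall>v\<in>L2 a b. norm (init_values d a b B C v l) \<le> K * (LINT s|lebesgue_on {a..b}. norm (v s))"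
proof -
  define Y where "Y = block_inv d (Kmat d a b B C)"
  define k1 where "k1 k m = onorm (\<lambda>x. C k m *v x) * ((b - a) ^ (d - 1 - m) / fact (d - 1 - m))" for k m
  define K where "K = (\<Sum>k<d. onorm (\<lambda>x. Y l k *v x) * (\<Sum>m<d. k1 k m))"
  have pos: "0 \<le> onorm (\<lambda>x. X *v x)" for X :: "real ^ 'a ^ 'a" by (rule onorm_pos_le[OF bounded_linear_mat_mult_vec])
  have on: "norm (X *v x) \<le> onorm (\<lambda>x. X *v x) * norm x" for X :: "real ^ 'a ^ 'a" and x
    by (rule onorm[OF bounded_linear_mat_mult_vec])
  have "norm (init_values d a b B C v l) \<le> K * (LINT s|lebesgue_on {a..b}. norm (v s))" (is "_ \<le> _ * ?I")
    if v: "v \<in> L2 a b" for v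
  proof -
    have "norm (C k m *v volterra a b (d - 1 - m) v b) \<le> k1 k m * ?I" for k m
      using order_trans[OF on mult_left_mono[OF volterra_norm_bound[OF L2_integrable[OF v]] pos]] ab
      by (simp add: k1_def mult.assoc)
    then have 1: "norm (\<Sum>m<d. C k m *v volterra a b (d - 1 - m) v b) \<le> (\<Sum>m<d. k1 k m) * ?I" for k
      unfolding sum_distrib_right by (intro sum_norm_le)
    have "norm (Y l k *v (\<Sum>m<d. C k m *v volterra a b (d - 1 - m) v b)) \<le> onorm (\<lambda>x. Y l k *v x) * (\<Sum>m<d. k1 k m) * ?I" for k
      using order_trans[OF on mult_left_mono[OF 1 pos]] by (simp add: mult.assoc)
    then show ?thesis unfolding init_values_def norm_minus_cancel K_def sum_distrib_right Y_def[symmetric]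
      by (intro sum_norm_le)
  qed
  moreover have "0 \<le> K" unfolding K_def k1_def using pos ab by (intro sum_nonneg mult_nonneg_nonneg) auto
  ultimately show ?thesis by blast
qed

lemma green_L2: "v \<in> L2 a b \<Longrightarrow> green d a b B C k v \<in> L2 a b"
  by (simp add: green_def taylor_chain_def taylor_L2)

lemma L2_bounded_op_green:
  fixes B C :: "'a::finite blockmat"
  assumes ab: "a < b"
  shows "L2_bounded_op a b (green d a b B C k)"
proof (cases "k < d")
  case False
  then have "green d a b B C k = id" by (simp add: green_def taylor_chain_def fun_eq_iff)
  then show ?thesis using ab by (intro L2_bounded_opI_emb[of _ _ _ "\<lambda>x. x"]) auto
next
  case True
  have g: "green d a b B C k v = taylor d a b (init_values d a b B C v) v k" for v
    using True by (simp add: green_def taylor_chain_def)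
  obtain K where K: "\<And>l. 0 \<le> K l"
    "\<And>l v. v \<in> L2 a b \<Longrightarrow> norm (init_values d a b B C v l) \<le> K l * (LINT s|lebesgue_on {a..b}. norm (v s))"
    using init_values_bound[OF ab, of d B C] by metis
  show ?thesis
  proof (rule L2_bounded_op_L1I)
    show "green d a b B C k v \<in> L2 a b" if "v \<in> L2 a b" for v using that by (rule green_L2)
    show "green d a b B C k (\<lambda>s. u s + v s) s = green d a b B C k u s + green d a b B C k v s"
      if "u \<in> L2 a b" "v \<in> L2 a b" "s \<in> {a..b}" for u v s
      using that ab by (simp add: g taylor_def volterra_add L2_integrable init_values_add scaleR_add_right sum.distrib)
    show "green d a b B C k (\<lambda>s. c *\<^sub>R v s) s = c *\<^sub>R green d a b B C k v s" for c v s
      by (simp add: g taylor_def volterra_scale init_values_scale scaleR_add_right scaleR_sum_right mult.commute)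
    fix v :: "real \<Rightarrow> real ^ 'a" and s assume v: "v \<in> L2 a b" and s: "s \<in> {a..b}"
    let ?I = "LINT s|lebesgue_on {a..b}. norm (v s)"
    have "norm (((s - a) ^ (j - k) / fact (j - k)) *\<^sub>R init_values d a b B C v j) \<le> (b - a) ^ (j - k) / fact (j - k) * K j * ?I" for j
    proof -
      have "\<bar>(s - a) ^ (j - k) / fact (j - k)\<bar> \<le> (b - a) ^ (j - k) / fact (j - k)"
        using s by (auto intro!: divide_right_mono power_mono)
      then have "\<bar>(s - a) ^ (j - k) / fact (j - k)\<bar> * norm (init_values d a b B C v j)
          \<le> (b - a) ^ (j - k) / fact (j - k) * (K j * ?I)"
        using ab by (intro mult_mono K v) auto
      then show ?thesis by (simp only: norm_scaleR mult.assoc)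
    qed
    then have "norm (\<Sum>j=k..<d. ((s - a) ^ (j - k) / fact (j - k)) *\<^sub>R init_values d a b B C v j)
        \<le> (\<Sum>j=k..<d. (b - a) ^ (j - k) / fact (j - k) * K j) * ?I"
      unfolding sum_distrib_right by (intro sum_norm_le)
    then show "norm (green d a b B C k v s) \<le> ((\<Sum>j=k..<d. (b - a) ^ (j - k) / fact (j - k) * K j)
        + (b - a) ^ (d - 1 - k) / fact (d - 1 - k)) * ?I"
      unfolding g taylor_def distrib_right
      by (intro norm_triangle_mono volterra_norm_bound L2_integrable v s)
  qed
qed

text \<open>Reduces measurability and bounds for a matrix function to those of its columns, which
  are vector-valued.\<close>

lemma mat_mult_vec_columns: "A *v x = (\<Sum>j\<in>UNIV. (x \<bullet> axis j 1) *\<^sub>R column j (A :: real ^ 'n::finite ^ 'n))"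
  by (simp add: matrix_mult_sum inner_axis scalar_mult_eq_scaleR)

lemma L2_mat_mult:
  fixes X :: "real \<Rightarrow> real ^ 'n::finite ^ 'n"
  assumes X: "\<And>j. continuous_on {a..b} (\<lambda>s. column j (X s))" and v: "v \<in> L2 a b"
  shows "(\<lambda>s. X s *v v s) \<in> L2 a b"
    and "\<exists>K\<ge>0. \<forall>s\<in>{a..b}. \<forall>x. norm (X s *v x) \<le> K * norm x"
proof -
  have "continuous_on {a..b} (\<lambda>s. \<Sum>j\<in>UNIV. norm (column j (X s)))" by (intro continuous_intros X)
  from compact_imp_bounded[OF compact_continuous_image[OF this compact_Icc]]
  obtain K where K: "\<forall>s\<in>{a..b}. \<bar>\<Sum>j\<in>UNIV. norm (column j (X s))\<bar> \<le> K" by (auto simp: bounded_iff)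
  have bnd: "norm (X s *v x) \<le> \<bar>K\<bar> * norm x" if "s \<in> {a..b}" for s x
  proof -
    have "norm (X s *v x) \<le> (\<Sum>j\<in>UNIV. norm x * norm (column j (X s)))"
      unfolding mat_mult_vec_columns
    proof (rule sum_norm_le)
      fix j
      have "\<bar>x \<bullet> axis j 1\<bar> \<le> norm x" using Cauchy_Schwarz_ineq2[of x "axis j 1"] by simp
      then show "norm ((x \<bullet> axis j 1) *\<^sub>R column j (X s)) \<le> norm x * norm (column j (X s))"
        by (auto intro: mult_right_mono)
    qed
    also have "\<dots> = norm x * (\<Sum>j\<in>UNIV. norm (column j (X s)))" by (simp add: sum_distrib_left)
    also have "\<dots> \<le> norm x * \<bar>K\<bar>" using bspec[OF K that] by (intro mult_left_mono) auto
    finally show ?thesis by (simp add: mult.commute)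
  qed
  then show "\<exists>K\<ge>0. \<forall>s\<in>{a..b}. \<forall>x. norm (X s *v x) \<le> K * norm x" by (intro exI[of _ "\<bar>K\<bar>"]) auto
  have "(\<lambda>s. column j (X s)) \<in> borel_measurable (lebesgue_on {a..b})" for j
    by (intro continuous_imp_measurable_on_sets_lebesgue X) auto
  then have m: "(\<lambda>s. X s *v v s) \<in> borel_measurable (lebesgue_on {a..b})"
    unfolding mat_mult_vec_columns
    by (intro borel_measurable_sum borel_measurable_scaleR borel_measurable_inner L2_D(1)[OF v] borel_measurable_const)
  have "integrable (lebesgue_on {a..b}) (\<lambda>s. (norm (X s *v v s))\<^sup>2)"
  proof (rule Bochner_Integration.integrable_bound)
    show "integrable (lebesgue_on {a..b}) (\<lambda>s. K\<^sup>2 * (norm (v s))\<^sup>2)" using L2_D(2)[OF v] by simp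
    show "(\<lambda>s. (norm (X s *v v s))\<^sup>2) \<in> borel_measurable (lebesgue_on {a..b})"
      by (rule measurable_compose[OF m]) measurable
    show "AE s in lebesgue_on {a..b}. norm ((norm (X s *v v s))\<^sup>2) \<le> norm (K\<^sup>2 * (norm (v s))\<^sup>2)"
    proof (rule AE_I2)
      fix s assume "s \<in> space (lebesgue_on {a..b})"
      then have "norm (X s *v v s) \<le> \<bar>K\<bar> * norm (v s)" using bnd by (simp add: space_restrict_space)
      from power_mono[OF this norm_ge_zero, of 2]
      show "norm ((norm (X s *v v s))\<^sup>2) \<le> norm (K\<^sup>2 * (norm (v s))\<^sup>2)" by (simp add: power_mult_distrib)
    qed
  qed
  with m show "(\<lambda>s. X s *v v s) \<in> L2 a b" by (simp add: L2_def)
qed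

lemma L2_bounded_op_mat_mult:
  fixes X :: "real \<Rightarrow> real ^ 'n::finite ^ 'n"
  assumes X: "\<And>j. continuous_on {a..b} (\<lambda>s. column j (X s))"
  shows "L2_bounded_op a b (\<lambda>v s. X s *v v s)"
proof -
  obtain K where K: "0 \<le> K" "\<And>s x. s \<in> {a..b} \<Longrightarrow> norm (X s *v x) \<le> K * norm x"
    using L2_mat_mult(2)[OF X L2_const] by blast
  have "L2_norm a b (\<lambda>s. X s *v v s) \<le> K * L2_norm a b v" if "v \<in> L2 a b" for v
    using that by (intro L2_norm_le L2_mat_mult X K)
  then show ?thesis unfolding L2_bounded_op_def
    by (auto simp: matrix_vector_right_distrib mat_mult_vec_scaleR intro!: L2_mat_mult X L2_eqI)
qed

lemma continuous_column_poly_mat: "continuous_on S (\<lambda>s. column j (poly_mat P s))"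
  unfolding column_def poly_mat_def by (auto intro!: continuous_intros continuous_on_vec_lambda)

lemma diff_op_cong:
  assumes "u \<in> L2 a b" "u' \<in> L2 a b" "L2_eq a b u u'"
  shows "diff_op d a b Ak u = diff_op d a b Ak u'"
  by (simp add: diff_op_def wderiv_cong[OF assms])

lemma Top_L2:
  assumes "a < b" "1 \<le> d" "v \<in> L2 a b"
  shows "Top d a b B C v \<in> L2 a b" "L2_eq a b (Top d a b B C v) (green d a b B C 0 v)"
proof -
  have "green d a b B C 0 v = taylor d a b (init_values d a b B C v) v 0"
    using assms by (simp add: green_def taylor_chain_def)
  then have "continuous_on {a..b} (green d a b B C 0 v)"
    by (simp add: continuous_taylor L2_integrable assms)
  then have "continuous_on {a..b} (Top d a b B C v)"
    by (rule continuous_on_eq) (simp add: Top_eq_green[OF assms])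
  then show "Top d a b B C v \<in> L2 a b" by (rule continuous_L2)
  show "L2_eq a b (Top d a b B C v) (green d a b B C 0 v)"
    by (intro L2_eqI Top_eq_green assms)
qed

lemma diff_op_Top:
  assumes ab: "a < b" and d: "1 \<le> d" and v: "v \<in> L2 a b"
  shows "diff_op d a b Ak (Top d a b B C v) \<in> L2 a b"
    and "L2_eq a b (diff_op d a b Ak (Top d a b B C v)) (\<lambda>s. \<Sum>k\<le>d. poly_mat (Ak k) s *v green d a b B C k v s)"
proof -
  have "green d a b B C 0 v = taylor d a b (init_values d a b B C v) v 0"
    using d by (simp add: green_def taylor_chain_def)
  note g = this
  have u: "Top d a b B C v \<in> L2 a b" "L2_eq a b (Top d a b B C v) (taylor d a b (init_values d a b B C v) v 0)"
    using Top_L2[OF ab d v, of B C] unfolding g by auto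
  note w = taylor_wderiv[OF ab v d _ u]
  show "diff_op d a b Ak (Top d a b B C v) \<in> L2 a b"
    unfolding diff_op_def by (intro L2_sum L2_mat_mult continuous_column_poly_mat w(1)) auto
  have "AE s in lebesgue_on {a..b}. \<forall>k\<in>{..d}. wderiv a b k (Top d a b B C v) s = green d a b B C k v s"
    using w(2) by (intro AE_finite_allI) (auto simp: L2_eq_def green_def)
  then show "L2_eq a b (diff_op d a b Ak (Top d a b B C v)) (\<lambda>s. \<Sum>k\<le>d. poly_mat (Ak k) s *v green d a b B C k v s)"
    unfolding L2_eq_def diff_op_def by eventually_elim simp
qed

lemma L2_bounded_op_Top:
  fixes B C :: "'a::finite blockmat"
  assumes ab: "a < b" and d: "1 \<le> d" shows "L2_bounded_op a b (Top d a b B C)"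
proof (rule L2_bounded_opI_emb[OF ab])
  note G = L2_bounded_op_green[OF ab, of d B C 0]
  show "bounded_linear (op_emb a b (green d a b B C 0))" by (rule bounded_linear_op_emb[OF ab G])
  fix v :: "real \<Rightarrow> real ^ 'a" assume v: "v \<in> L2 a b"
  note T = Top_L2[OF ab d v, of B C]
  show "Top d a b B C v \<in> L2 a b" by (rule T)
  show "emb a b (Top d a b B C v) = op_emb a b (green d a b B C 0) (emb a b v)"
    unfolding op_emb[OF ab G v] using emb_eq_iff[OF ab T(1) green_L2[OF v]] T(2) by blast
qed

text \<open>Differentiation of order at most \<open>d\<close> is compensated by \<open>T\<close>:
  the term of order \<open>k\<close> is a multiplication operator after the bounded operator
  \<open>green d a b B C k\<close>, which for \<open>k = d\<close> is the identity.\<close>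

lemma L2_bounded_op_diff_op_Top:
  fixes B C :: "'a::finite blockmat"
  assumes ab: "a < b" and d: "1 \<le> d"
  shows "L2_bounded_op a b (diff_op d a b Ak \<circ> Top d a b B C)"
proof (rule L2_bounded_opI_emb[OF ab])
  define X where "X k = (\<lambda>v s. poly_mat (Ak k) s *v v s)" for k
  have X: "L2_bounded_op a b (X k)" for k
    unfolding X_def by (intro L2_bounded_op_mat_mult continuous_column_poly_mat)
  note G = L2_bounded_op_green[OF ab]
  show "bounded_linear (\<lambda>h. \<Sum>k\<le>d. op_emb a b (X k) (op_emb a b (green d a b B C k) h))"
    by (intro bounded_linear_sum bounded_linear_compose[OF bounded_linear_op_emb bounded_linear_op_emb] ab X G)
  fix v :: "real \<Rightarrow> real ^ 'a" assume v: "v \<in> L2 a b"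
  show "(diff_op d a b Ak \<circ> Top d a b B C) v \<in> L2 a b" using diff_op_Top(1)[OF ab d v] by simp
  have XG: "X k (green d a b B C k v) \<in> L2 a b" for k by (intro L2_bounded_opD(1)[OF X] green_L2 v)
  have "emb a b ((diff_op d a b Ak \<circ> Top d a b B C) v) = emb a b (\<lambda>s. \<Sum>k\<le>d. X k (green d a b B C k v) s)"
    using diff_op_Top[OF ab d v, of Ak B C] by (subst emb_eq_iff[OF ab]) (auto simp: X_def[symmetric] intro!: L2_sum XG, simp add: X_def)
  also have "\<dots> = (\<Sum>k\<le>d. emb a b (X k (green d a b B C k v)))" by (rule emb_sum[OF ab XG])
  also have "\<dots> = (\<Sum>k\<le>d. op_emb a b (X k) (op_emb a b (green d a b B C k) (emb a b v)))"
    by (simp add: op_emb[OF ab] X G green_L2 v)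
  finally show "emb a b ((diff_op d a b Ak \<circ> Top d a b B C) v)
      = (\<Sum>k\<le>d. op_emb a b (X k) (op_emb a b (green d a b B C k) (emb a b v)))" .
qed

section \<open>Generation of the semigroup\<close>

lemma L2_inner_add_right:
  "u \<in> L2 a b \<Longrightarrow> v \<in> L2 a b \<Longrightarrow> w \<in> L2 a b \<Longrightarrow>
    L2_inner a b w (\<lambda>s. u s + v s) = L2_inner a b w u + L2_inner a b w v"
  using L2_inner_add_left[of u a b v w] by (simp add: L2_inner_commute)

lemma L2_inner_scale_right: "L2_inner a b v (\<lambda>s. c *\<^sub>R u s) = c * L2_inner a b v u"
  using L2_inner_scale_left[of a b c u v] by (simp add: L2_inner_commute)

lemma L2_inner_diff_right:
  assumes "u \<in> L2 a b" "v \<in> L2 a b" "w \<in> L2 a b"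
  shows "L2_inner a b w (\<lambda>s. u s - v s) = L2_inner a b w u - L2_inner a b w v"
  using L2_inner_add_right[OF assms(1) L2_scale[OF assms(2)] assms(3), of "-1"]
    L2_inner_scale_right[of a b w "-1" v] by simp

lemma L2_op_nonnegD:
  assumes "L2_op_le a b S R" "v \<in> L2 a b"
  shows "0 \<le> L2_inner a b v (op_diff R S v)"
  using assms by (simp add: L2_op_le_def L2_op_nonneg_def)

theorem corollary13:
  fixes d :: nat and a b :: real
    and B C :: "nat \<Rightarrow> nat \<Rightarrow> real ^ 'n::finite ^ 'n"
    and Ak :: "nat \<Rightarrow> real poly ^ 'n ^ 'n"
    and P :: "'n l2op"
    and \<epsilon>1 \<epsilon>2 \<omega> l :: real
  defines "D \<equiv> bc_domain d a b B C"
    and "A \<equiv> diff_op d a b Ak"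
    and "T \<equiv> Top d a b B C"
  defines "AT \<equiv> A \<circ> T"
  defines "T' \<equiv> L2_adjoint a b T"
    and "AT' \<equiv> L2_adjoint a b AT"
  assumes "d \<ge> 1" and "a < b"
    and "PIE_compatible d a b B C"
    and "\<epsilon>1 > 0" and "\<epsilon>2 > 0"
    and "PI_operator a b P" and "l > \<omega>"
    and "L2_op_le a b (op_scale (\<epsilon>1\<^sup>2) id) P"
    and "L2_op_le a b (op_add (T' \<circ> P \<circ> AT) (AT' \<circ> P \<circ> T)) (op_scale (2 * \<omega>) (T' \<circ> P \<circ> T))"
    and "L2_op_le a b (op_scale (\<epsilon>2\<^sup>2) id)
           (op_diff (op_scale l T) AT \<circ> op_diff (op_scale l T') AT')"
  shows "\<exists>S. C0_semigroup a b S \<and> is_generator a b S D A \<and>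
             has_growth a b S \<omega> (sqrt (L2_onorm a b P) / \<epsilon>1)"
proof -
  note d = \<open>d \<ge> 1\<close> and ab = \<open>a < b\<close>
  note P_ge = \<open>L2_op_le a b (op_scale (\<epsilon>1\<^sup>2) id) P\<close>
    and dissip = \<open>L2_op_le a b (op_add (T' \<circ> P \<circ> AT) (AT' \<circ> P \<circ> T)) (op_scale (2 * \<omega>) (T' \<circ> P \<circ> T))\<close>
    and coerc = \<open>L2_op_le a b (op_scale (\<epsilon>2\<^sup>2) id)
           (op_diff (op_scale l T) AT \<circ> op_diff (op_scale l T') AT')\<close>
  have T: "L2_bounded_op a b T" unfolding T_def by (rule L2_bounded_op_Top[OF ab d])
  have AT: "L2_bounded_op a b AT" unfolding AT_def A_def T_def by (rule L2_bounded_op_diff_op_Top[OF ab d])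
  have T': "L2_bounded_op a b T'" unfolding T'_def by (rule L2_bounded_op_adjoint[OF ab T])
  have AT': "L2_bounded_op a b AT'" unfolding AT'_def by (rule L2_bounded_op_adjoint[OF ab AT])
  note adjT = L2_inner_adjoint[OF ab T, folded T'_def] and adjAT = L2_inner_adjoint[OF ab AT, folded AT'_def]
  \<comment> \<open>The inequality for \<open>P\<close> asserts boundedness and symmetry of this
    difference; those of \<open>P\<close> itself are recovered by adding the multiple of the
    identity back.\<close>
  define Q where "Q = op_diff P (op_scale (\<epsilon>1\<^sup>2) id)"
  have Q: "L2_bounded_op a b Q" and Q_sym: "\<And>u v. u \<in> L2 a b \<Longrightarrow> v \<in> L2 a b \<Longrightarrow> L2_inner a b (Q u) v = L2_inner a b u (Q v)"
    using P_ge by (auto simp: L2_op_le_def L2_op_nonneg_def L2_selfadjoint_def Q_def)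
  have P_Q: "P v = (\<lambda>s. Q v s + \<epsilon>1\<^sup>2 *\<^sub>R v s)" for v by (simp add: Q_def op_diff_def op_scale_def)
  have embP: "emb a b (P v) = op_emb a b Q (emb a b v) + \<epsilon>1\<^sup>2 *\<^sub>R emb a b v" if "v \<in> L2 a b" for v
    using that ab by (simp add: P_Q emb_add emb_scale L2_scale L2_bounded_opD(1)[OF Q] op_emb[OF ab Q])
  have P: "L2_bounded_op a b P"
  proof (rule L2_bounded_opI_emb[OF ab, where F = "\<lambda>h. op_emb a b Q h + \<epsilon>1\<^sup>2 *\<^sub>R h"])
    show "bounded_linear (\<lambda>h. op_emb a b Q h + \<epsilon>1\<^sup>2 *\<^sub>R h)"
      by (intro bounded_linear_add bounded_linear_op_emb ab Q bounded_linear_const_scaleR bounded_linear_ident)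
    show "P v \<in> L2 a b" if "v \<in> L2 a b" for v
      unfolding P_Q using that by (intro L2_add L2_scale L2_bounded_opD(1)[OF Q])
  qed (rule embP)
  note mem = L2_bounded_opD(1)[OF T] L2_bounded_opD(1)[OF AT] L2_bounded_opD(1)[OF T']
    L2_bounded_opD(1)[OF AT'] L2_bounded_opD(1)[OF P]
  have P_sym: "L2_inner a b (P u) v = L2_inner a b u (P v)" if "u \<in> L2 a b" "v \<in> L2 a b" for u v
    using that unfolding P_Q
    by (simp add: L2_inner_add_left L2_inner_add_right L2_scale L2_bounded_opD(1)[OF Q] Q_sym
        L2_inner_scale_left L2_inner_scale_right)
  define Th Ah Ph where "Th = op_emb a b T" and "Ah = op_emb a b AT" and "Ph = op_emb a b P"
  define Tt At where "Tt = op_emb a b T'" and "At = op_emb a b AT'"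
  have bl: "bounded_linear Th" "bounded_linear Ah" "bounded_linear Ph" "bounded_linear Tt" "bounded_linear At"
    unfolding Th_def Ah_def Ph_def Tt_def At_def by (intro bounded_linear_op_emb ab T AT P T' AT')+
  interpret Th: bounded_linear Th by (rule bl)
  interpret Ah: bounded_linear Ah by (rule bl)
  have emb_op: "Th (emb a b v) = emb a b (T v)" "Ah (emb a b v) = emb a b (AT v)" "Ph (emb a b v) = emb a b (P v)"
    "Tt (emb a b v) = emb a b (T' v)" "At (emb a b v) = emb a b (AT' v)" if "v \<in> L2 a b" for v
    unfolding Th_def Ah_def Ph_def Tt_def At_def using op_emb[OF ab _ that] T AT P T' AT' by auto
  have un: "\<exists>v\<in>L2 a b. h = emb a b v" for h :: "'n ltwo"
    using emb_unemb[OF ab, of h] unemb_L2[OF ab, of h] by metis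
  \<comment> \<open>Total on the type, but meaningful only on \<open>range Th\<close>, where it is
    determined by \<open>G (Th h) = Ah h\<close>; elsewhere weak derivatives need not exist.\<close>
  define G where "G h = emb a b (A (unemb a b h))" for h
  have A_emb: "A u = A (unemb a b (emb a b u))" if "u \<in> L2 a b" for u
    unfolding A_def using that L2_eq_unemb_emb[OF ab that] by (intro diff_op_cong[symmetric] unemb_L2 ab)
  have G_emb: "G (emb a b u) = emb a b (A u)" if "u \<in> L2 a b" for u
    unfolding G_def A_emb[OF that, symmetric] ..
  have G_Th: "G (Th h) = Ah h" for h
  proof -
    obtain v where "v \<in> L2 a b" "h = emb a b v" using un by blast
    then show ?thesis by (simp add: emb_op G_emb mem AT_def)
  qed
  have inn: "inner (emb a b u) (emb a b v) = L2_inner a b u v" if "u \<in> L2 a b" "v \<in> L2 a b" for u v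
    using inner_emb[OF ab that] .
  obtain S where S: "\<And>t. 0 \<le> t \<Longrightarrow> bounded_linear (S t)"
    "\<And>x. S 0 x = x" "\<And>t r x. 0 \<le> t \<Longrightarrow> 0 \<le> r \<Longrightarrow> S (t + r) x = S t (S r x)"
    "\<And>x. ((\<lambda>t. S t x) \<longlongrightarrow> x) (at_right 0)"
    "\<And>x. x \<in> range Th \<Longrightarrow> ((\<lambda>t. (1 / t) *\<^sub>R (S t x - x)) \<longlongrightarrow> G x) (at_right 0)"
    "\<And>x y. ((\<lambda>t. (1 / t) *\<^sub>R (S t x - x)) \<longlongrightarrow> y) (at_right 0) \<Longrightarrow> x \<in> range Th"
    "\<And>t x. 0 \<le> t \<Longrightarrow> norm (S t x) \<le> sqrt (onorm Ph) / \<epsilon>1 * exp (\<omega> * t) * norm x"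
  proof (rule lumer_phillips[of Ph \<epsilon>1 "range Th" G \<omega> l])
    show "inner x (Ph y) = inner (Ph x) y" for x y
    proof -
      obtain u v where "u \<in> L2 a b" "x = emb a b u" "v \<in> L2 a b" "y = emb a b v" using un by metis
      then show ?thesis by (simp add: emb_op inn mem P_sym)
    qed
    show "\<epsilon>1\<^sup>2 * (norm x)\<^sup>2 \<le> inner x (Ph x)" for x
    proof -
      obtain v where v: "v \<in> L2 a b" "x = emb a b v" using un by metis
      have "0 \<le> L2_inner a b v (\<lambda>s. P v s - \<epsilon>1\<^sup>2 *\<^sub>R v s)"
        using L2_op_nonnegD[OF P_ge v(1)] by (simp add: op_diff_def op_scale_def)
      then show ?thesis using v
        by (simp add: emb_op inn mem power2_norm_eq_inner L2_inner_diff_right L2_scale L2_inner_scale_right)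
    qed
    show "subspace (range Th)" by (rule linear_subspace_image[OF Th.linear subspace_UNIV])
    show "G (x + y) = G x + G y" if "x \<in> range Th" "y \<in> range Th" for x y
      using that by (auto simp: G_Th Ah.add simp flip: Th.add)
    show "G (c *\<^sub>R x) = c *\<^sub>R G x" if "x \<in> range Th" for c x
      using that by (auto simp: G_Th Ah.scale simp flip: Th.scale)
    show "inner x (Ph (G x)) \<le> \<omega> * inner x (Ph x)" if xT: "x \<in> range Th" for x
    proof -
      obtain h where h: "x = Th h" using xT by blast
      obtain v where "v \<in> L2 a b" "h = emb a b v" using un by blast
      with h have v: "v \<in> L2 a b" "x = Th (emb a b v)" by auto
      \<comment> \<open>The second inequality tested at \<open>v\<close>. Once the adjoints are
        moved across, the two mixed terms agree by symmetry of \<open>P\<close>, which accounts for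
        the factor 2 of \<open>\<omega>\<close>.\<close>
      have "0 \<le> L2_inner a b v (\<lambda>s. (2 * \<omega>) *\<^sub>R T' (P (T v)) s - (T' (P (AT v)) s + AT' (P (T v)) s))"
        using L2_op_nonnegD[OF dissip v(1)] by (simp add: op_diff_def op_scale_def op_add_def)
      then have "0 \<le> 2 * \<omega> * L2_inner a b (T v) (P (T v)) - (L2_inner a b (T v) (P (AT v)) + L2_inner a b (AT v) (P (T v)))"
        using v(1) by (simp add: L2_inner_diff_right L2_inner_add_right L2_inner_scale_right L2_scale L2_add mem adjT adjAT)
      also have "L2_inner a b (AT v) (P (T v)) = L2_inner a b (T v) (P (AT v))"
        using v(1) P_sym[of "AT v" "T v"] by (simp add: mem L2_inner_commute)
      finally have "L2_inner a b (T v) (P (AT v)) \<le> \<omega> * L2_inner a b (T v) (P (T v))" by simp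
      moreover have "x = emb a b (T v)" "G x = emb a b (AT v)"
        unfolding v(2) G_Th by (simp_all only: emb_op[OF v(1)])
      ultimately show ?thesis using v(1) by (simp add: emb_op inn mem)
    qed
    show "\<exists>x\<in>range Th. l *\<^sub>R x - G x = y" for y
    proof -
      \<comment> \<open>\<open>N\<close> is \<open>R\<close> after its adjoint for
        \<open>R = l Th - Ah\<close>; its coercivity is the third inequality.\<close>
      define N where "N h = l *\<^sub>R Th (l *\<^sub>R Tt h - At h) - Ah (l *\<^sub>R Tt h - At h)" for h
      have "\<exists>z. N z = y"
      proof (rule lax_milgram)
        show "bounded_linear N" unfolding N_def
          by (intro bounded_linear_sub bounded_linear_const_scaleR bounded_linear_compose[OF bl(1)]
              bounded_linear_compose[OF bl(2)] bl)
        show "0 < \<epsilon>2\<^sup>2" using \<open>\<epsilon>2 > 0\<close> by simp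
        fix x :: "'n ltwo" obtain v where v: "v \<in> L2 a b" "x = emb a b v" using un by metis
        define w where "w = (\<lambda>s. l *\<^sub>R T' v s - AT' v s)"
        have w: "w \<in> L2 a b" unfolding w_def by (intro L2_diff L2_scale mem v)
        have "l *\<^sub>R Tt x - At x = emb a b w"
          using v by (simp add: w_def emb_op emb_diff[OF ab] emb_scale[OF ab] mem L2_scale)
        then have N: "N x = emb a b (\<lambda>s. l *\<^sub>R T w s - AT w s)"
          using w by (simp add: N_def emb_op emb_diff[OF ab] emb_scale[OF ab] mem L2_scale)
        have "0 \<le> L2_inner a b v (\<lambda>s. (l *\<^sub>R T w s - AT w s) - \<epsilon>2\<^sup>2 *\<^sub>R v s)"
          using L2_op_nonnegD[OF coerc v(1)] by (simp add: op_diff_def op_scale_def w_def)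
        then show "\<epsilon>2\<^sup>2 * (norm x)\<^sup>2 \<le> inner x (N x)"
          unfolding N unfolding v(2) using v(1) w
          by (simp add: inn mem power2_norm_eq_inner L2_inner_diff_right L2_diff L2_scale L2_inner_scale_right)
      qed
      then obtain z where "N z = y" ..
      \<comment> \<open>The adjoint of \<open>R\<close> maps \<open>z\<close> to a preimage of
        \<open>y\<close> under \<open>R\<close>, and \<open>Th\<close> of that preimage solves the
        equation for \<open>G\<close>.\<close>
      then show ?thesis unfolding N_def
        by (intro bexI[of _ "Th (l *\<^sub>R Tt z - At z)"]) (simp_all add: G_Th)
    qed
  qed (use bl \<open>\<epsilon>1 > 0\<close> \<open>l > \<omega>\<close> that in auto)
  \<comment> \<open>Needed in both directions: the difference quotients converge on
    \<open>range Th\<close> and nowhere else, and the generator has to have exactly \<open>D\<close>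
    as its domain.\<close>
  have D_iff: "u \<in> D \<longleftrightarrow> u \<in> L2 a b \<and> emb a b u \<in> range Th" for u
  proof -
    have "(\<exists>v\<in>L2 a b. L2_eq a b u (green d a b B C 0 v)) \<longleftrightarrow> emb a b u \<in> range Th" if u: "u \<in> L2 a b"
    proof -
      have "L2_eq a b u (green d a b B C 0 v) \<longleftrightarrow> emb a b u = Th (emb a b v)" if v: "v \<in> L2 a b" for v
        using Top_L2[OF ab d v, of B C] emb_eq_iff[OF ab u green_L2[OF v]]
          emb_eq_iff[OF ab Top_L2(1)[OF ab d v] green_L2[OF v], of B C d B C 0]
        by (simp add: emb_op v T_def)
      moreover have "emb a b u \<in> range Th \<longleftrightarrow> (\<exists>v\<in>L2 a b. emb a b u = Th (emb a b v))"
        unfolding image_iff using un by auto metis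
      ultimately show ?thesis by blast
    qed
    then show ?thesis unfolding D_def bc_domain_iff[OF ab d \<open>PIE_compatible d a b B C\<close>] by blast
  qed
  define U where "U t = op_unemb a b (S t)" for t
  have U: "U t v \<in> L2 a b" "emb a b (U t v) = S t (emb a b v)" for t v
    by (simp_all add: U_def op_unemb_L2[OF ab] emb_op_unemb[OF ab])
  have tendsto_iff: "L2_tendsto a b f g F \<longleftrightarrow> ((\<lambda>t. emb a b (f t)) \<longlongrightarrow> emb a b g) F"
    if "\<And>t. f t \<in> L2 a b" "g \<in> L2 a b" for f :: "real \<Rightarrow> real \<Rightarrow> real ^ 'n" and g and F :: "real filter"
  proof -
    have "L2_norm a b (\<lambda>s. f t s - g s) = dist (emb a b (f t)) (emb a b g)" for t
      using that by (simp add: dist_norm norm_emb[OF ab] L2_diff flip: emb_diff[OF ab])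
    then show ?thesis unfolding L2_tendsto_def by (simp add: tendsto_dist_iff[of _ "emb a b g"])
  qed
  have quot: "L2_tendsto a b (\<lambda>t s. (1 / t) *\<^sub>R (U t u s - u s)) v (at_right 0)
      \<longleftrightarrow> ((\<lambda>t. (1 / t) *\<^sub>R (S t (emb a b u) - emb a b u)) \<longlongrightarrow> emb a b v) (at_right 0)"
    if "u \<in> L2 a b" "v \<in> L2 a b" for u v
    using that U by (subst tendsto_iff) (auto intro!: L2_scale L2_diff simp: emb_scale[OF ab] emb_diff[OF ab] L2_diff)
  have U_bounded: "L2_bounded_op a b (U t)" if "0 \<le> t" for t
    unfolding U_def by (rule L2_bounded_op_op_unemb[OF ab S(1)[OF that]])
  have "C0_semigroup a b U"
    unfolding C0_semigroup_def
  proof (intro conjI allI impI ballI)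
    fix v :: "real \<Rightarrow> real ^ 'n" assume v: "v \<in> L2 a b"
    show "L2_eq a b (U 0 v) v" using v by (simp add: U S flip: emb_eq_iff[OF ab])
    show "L2_eq a b (U (t + r) v) (U t (U r v))" if "0 \<le> t" "0 \<le> r" for t r
      using that by (simp add: U S(3) flip: emb_eq_iff[OF ab])
    show "L2_tendsto a b (\<lambda>t. U t v) v (at_right 0)"
      using v S(4) by (simp add: tendsto_iff U)
  qed (rule U_bounded)
  moreover have "is_generator a b U D A"
    unfolding is_generator_def
  proof (intro conjI ballI set_eqI)
    have A_mem: "A u \<in> L2 a b" if "u \<in> D" for u
    proof -
      have u: "u \<in> L2 a b" "emb a b u \<in> range Th" using that by (auto simp: D_iff)
      then obtain h where h: "emb a b u = Th h" by blast
      obtain v where "v \<in> L2 a b" "h = emb a b v" using un by blast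
      with h have v: "v \<in> L2 a b" "emb a b u = emb a b (T v)" by (simp_all add: emb_op)
      \<comment> \<open>Equality as functions, because \<open>diff_op\<close> depends on the class
        only; so membership in \<open>L2 a b\<close> carries over directly.\<close>
      then have "A u = A (T v)" using A_emb[OF u(1)] A_emb[of "T v"] by (simp add: mem)
      then show ?thesis using mem(2)[OF v(1)] by (simp add: AT_def)
    qed
    fix u assume u: "u \<in> D"
    then show "A u \<in> L2 a b" by (rule A_mem)
    show "L2_tendsto a b (\<lambda>t s. (1 / t) *\<^sub>R (U t u s - u s)) (A u) (at_right 0)"
      using u A_mem[OF u] S(5)[of "emb a b u"] by (simp add: quot D_iff G_emb)
  next
    fix u
    have "((\<lambda>t. (1 / t) *\<^sub>R (S t (emb a b u) - emb a b u)) \<longlongrightarrow> y) (at_right 0) \<Longrightarrow> emb a b u \<in> range Th" for y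
      by (rule S(6))
    then show "u \<in> D \<longleftrightarrow> u \<in> {u \<in> L2 a b. \<exists>v\<in>L2 a b. L2_tendsto a b (\<lambda>t s. (1 / t) *\<^sub>R (U t u s - u s)) v (at_right 0)}"
      using S(5)[of "emb a b u"] un[of "G (emb a b u)"] by (auto simp: D_iff quot)
  qed
  moreover have "has_growth a b U \<omega> (sqrt (L2_onorm a b P) / \<epsilon>1)"
  proof -
    have onP: "L2_onorm a b P = onorm Ph" unfolding Ph_def by (rule L2_onorm_eq_onorm[OF ab P])
    \<comment> \<open>The gain is at least 1 because the bound holds at time 0, where the semigroup
      is the identity, on some nonzero vector.\<close>
    obtain h :: "'n ltwo" where "h \<noteq> 0" using UNIV_not_singleton[of 0] by auto
    moreover have "1 * norm h \<le> sqrt (onorm Ph) / \<epsilon>1 * norm h" using S(7)[of 0 h] by (simp add: S(2))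
    ultimately have "1 \<le> sqrt (onorm Ph) / \<epsilon>1" using mult_right_le_imp_le zero_less_norm_iff by blast
    moreover have "L2_onorm a b (U t) \<le> sqrt (onorm Ph) / \<epsilon>1 * exp (\<omega> * t)" if "0 \<le> t" for t
    proof -
      have "op_emb a b (U t) = S t"
        by (simp add: op_emb_def U emb_unemb[OF ab] fun_eq_iff)
      then have "L2_onorm a b (U t) = onorm (S t)" using L2_onorm_eq_onorm[OF ab U_bounded[OF that]] by simp
      also have "\<dots> \<le> sqrt (onorm Ph) / \<epsilon>1 * exp (\<omega> * t)"
        using onorm_pos_le[OF bl(3)] \<open>\<epsilon>1 > 0\<close> by (intro onorm_bound S(7) that) auto
      finally show ?thesis .
    qed
    ultimately show ?thesis by (simp add: has_growth_def onP)
  qed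
  ultimately show ?thesis by blast
qed

end
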